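(* Let $\mathfrak g$ be a simple Lie algebra and $f$ a minimal nilpotent element of $\mathfrak g$, included in an $\mathfrak{sl}_2$-triple $\{f,2x,e\}$. Let $s\in\mathfrak g_{\frac12}$ be embeddable, i.e. there is $s^*\in\mathfrak g_{-\frac12}$ with $[s,s^*]=2x$. Then $f+zs\in\mathfrak g((z^{-1}))$ is semisimple, and we have the decomposition $\mathfrak g((z^{-1}))=\mathfrak h\oplus\mathfrak h^\perp$, where $$\mathfrak h:=\mathbb F(f+zs)((z^{-1}))\oplus\mathfrak g_0^s((z^{-1}))\oplus\mathbb F(e+z^{-1}s^* )((z^{-1}))=\ker\mathrm{ad}(f+zs)$$ and $$\begin{aligned}\mathfrak h^\perp:={}&\mathbb F(2f-zs)((z^{-1}))\oplus\mathbb Fx((z^{-1}))\oplus\mathbb F(2e-z^{-1}s^* )((z^{-1}))\oplus[f,\mathfrak g^s_{\frac12}]((z^{-1}))\\&\oplus[s,[f,\mathfrak g^s_{\frac12}]]((z^{-1}))\oplus[s,[s,[f,\mathfrak g^s_{\frac12}]]]((z^{-1}))=\mathrm{im}\,\mathrm{ad}(f+zs).\end{aligned}$$ In fact, we have: (i) $[f+zs,2x]=2f-zs$; (ii) $[f+zs,-\frac16(2e-z^{-1}s^* )]=x$; (iii) $[f+zs,[s^*,e]z^{-1}]=2e-z^{-1}s^*$; (iv) $[f+zs,u]=[f,u]\in[f,\mathfrak g^s_{\frac12}]$ for all $u\in\mathfrak g^s_{\frac12}$; (v) $[f+zs,[f,u]z^{-1}]=[s,[f,u]]\in[s,[f,\mathfrak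 g^s_{\frac12}]]$ for all $u\in\mathfrak g^s_{\frac12}$; (vi) $[f+zs,[s,[f,u]]z^{-1}]=[s,[s,[f,u]]]\in[s,[s,[f,\mathfrak g^s_{\frac12}]]]$ for all $u\in\mathfrak g^s_{\frac12}$.
   Context: The base field $\mathbb F$ is algebraically closed of characteristic $0$; $\mathfrak g$ is finite-dimensional. The triple satisfies $[e,f]=2x$, $[x,e]=e$, $[x,f]=-f$; $\mathfrak g_i$ is the $\mathrm{ad}\,x$-eigenspace of eigenvalue $i\in\frac12\mathbb Z$. $f$ is minimal if it is a lowest root vector, equivalently $\mathfrak g=\mathbb Ff\oplus\mathfrak g_{-1/2}\oplus\mathfrak g_0\oplus\mathfrak g_{1/2}\oplus\mathbb Fe$. $\mathfrak g((z^{-1}))=\mathfrak g\otimes\mathbb F((z^{-1}))$ is the Lie algebra over the field of formal Laurent series in $z^{-1}$; for a subspace $V$ of $\mathfrak g$ (or a line spanned by an element of $\mathfrak g((z^{-1}))$), $V((z^{-1}))$ is its $\mathbb F((z^{-1}))$-span. $\mathfrak g_i^s$ is the centralizer of $s$ in $\mathfrak g_i$. An element $\Lambda$ of $\mathfrak g((z^{-1}))$ is semisimple if $\mathrm{ad}\,\Lambda$ is a semisimple endomorphism (over $\mathbb F((z^{-1}))$). *)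

theory Defs
  imports "HOL-Computational_Algebra.Computational_Algebra"
begin

text \<open>A Lie algebra is a whole type \<open>'g\<close> with a scalar multiplication by the field \<open>'k\<close> and a
  bracket; all later notions take these two operations as arguments, so that they apply both to
  $\mathfrak g$ over $\mathbb F$ and to $\mathfrak g((z^{-1}))$ over $\mathbb F((z^{-1}))$.\<close>

locale lie_algebra = vector_space scale
  for scale :: "'k::field \<Rightarrow> 'g::ab_group_add \<Rightarrow> 'g" +
  fixes bracket :: "'g \<Rightarrow> 'g \<Rightarrow> 'g"
  assumes linear_bracket_left: "Vector_Spaces.linear scale scale (\<lambda>a. bracket a b)"
    and linear_bracket_right: "Vector_Spaces.linear scale scale (\<lambda>b. bracket a b)"
    and bracket_self: "bracket a a = 0"
    and jacobi: "bracket a (bracket b c) + bracket b (bracket c a) + bracket c (bracket a b) = 0"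

definition fin_dim :: "('k::field \<Rightarrow> 'g::ab_group_add \<Rightarrow> 'g) \<Rightarrow> bool" where
  "fin_dim scale \<longleftrightarrow> (\<exists>B. finite B \<and> module.span scale B = UNIV)"

definition lie_ideal ::
  "('k::field \<Rightarrow> 'g::ab_group_add \<Rightarrow> 'g) \<Rightarrow> ('g \<Rightarrow> 'g \<Rightarrow> 'g) \<Rightarrow> 'g set \<Rightarrow> bool" where
  "lie_ideal scale br I \<longleftrightarrow> module.subspace scale I \<and> (\<forall>a. \<forall>b\<in>I. br a b \<in> I)"

definition simple_lie_algebra ::
  "('k::field \<Rightarrow> 'g::ab_group_add \<Rightarrow> 'g) \<Rightarrow> ('g \<Rightarrow> 'g \<Rightarrow> 'g) \<Rightarrow> bool" where
  "simple_lie_algebra scale br \<longleftrightarrow>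
     lie_algebra scale br \<and> (\<exists>a b. br a b \<noteq> 0) \<and>
     (\<forall>I. lie_ideal scale br I \<longrightarrow> I = {0} \<or> I = UNIV)"

text \<open>\<open>listset Vs\<close> is the set of lists whose \<open>i\<close>-th entry is in the \<open>i\<close>-th member of \<open>Vs\<close>. The sum of
  the subspaces is direct iff every element arises from exactly one such list.\<close>

definition sum_of :: "'v::comm_monoid_add set list \<Rightarrow> 'v set" where
  "sum_of Vs = sum_list ` listset Vs"

definition direct_sum_of :: "'v::comm_monoid_add set list \<Rightarrow> 'v set \<Rightarrow> bool" where
  "direct_sum_of Vs W \<longleftrightarrow> bij_betw sum_list (listset Vs) W"

text \<open>Semisimplicity of an endomorphism over a field that need not be algebraically closed:
  every invariant subspace has an invariant complement.\<close>

definition semisimple_endo ::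
  "('k::field \<Rightarrow> 'v::ab_group_add \<Rightarrow> 'v) \<Rightarrow> ('v \<Rightarrow> 'v) \<Rightarrow> bool" where
  "semisimple_endo scale T \<longleftrightarrow>
     Vector_Spaces.linear scale scale T \<and>
     (\<forall>U. module.subspace scale U \<and> T ` U \<subseteq> U \<longrightarrow>
       (\<exists>W. module.subspace scale W \<and> T ` W \<subseteq> W \<and> direct_sum_of [U, W] UNIV))"

definition semisimple_element ::
  "('k::field \<Rightarrow> 'g::ab_group_add \<Rightarrow> 'g) \<Rightarrow> ('g \<Rightarrow> 'g \<Rightarrow> 'g) \<Rightarrow> 'g \<Rightarrow> bool" where
  "semisimple_element scale br a \<longleftrightarrow> semisimple_endo scale (br a)"

definition ad_eigenspace ::
  "('k::field \<Rightarrow> 'g::ab_group_add \<Rightarrow> 'g) \<Rightarrow> ('g \<Rightarrow> 'g \<Rightarrow> 'g) \<Rightarrow> 'g \<Rightarrow> 'k \<Rightarrow> 'g set" where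
  "ad_eigenspace scale br x i = {v. br x v = scale i v}"

definition centralizer_in :: "('g \<Rightarrow> 'g \<Rightarrow> 'g::zero) \<Rightarrow> 'g \<Rightarrow> 'g set \<Rightarrow> 'g set" where
  "centralizer_in br s V = {v \<in> V. br s v = 0}"

subsection \<open>Lowest root vectors\<close>

text \<open>Cartan subalgebras of a semisimple Lie algebra: maximal abelian subalgebras (maximal among all
  abelian subalgebras) whose elements are ad-semisimple.\<close>

definition abelian_subalgebra ::
  "('k::field \<Rightarrow> 'g::ab_group_add \<Rightarrow> 'g) \<Rightarrow> ('g \<Rightarrow> 'g \<Rightarrow> 'g) \<Rightarrow> 'g set \<Rightarrow> bool" where
  "abelian_subalgebra scale br H \<longleftrightarrow>
     module.subspace scale H \<and> (\<forall>a\<in>H. \<forall>b\<in>H. br a b = 0)"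

definition cartan_subalgebra ::
  "('k::field \<Rightarrow> 'g::ab_group_add \<Rightarrow> 'g) \<Rightarrow> ('g \<Rightarrow> 'g \<Rightarrow> 'g) \<Rightarrow> 'g set \<Rightarrow> bool" where
  "cartan_subalgebra scale br H \<longleftrightarrow>
     abelian_subalgebra scale br H \<and>
     (\<forall>H'. abelian_subalgebra scale br H' \<and> H \<subseteq> H' \<longrightarrow> H' = H) \<and>
     (\<forall>h\<in>H. semisimple_element scale br h)"

text \<open>A root is represented by any function on \<open>'g\<close> with the right values on \<open>H\<close>; its values outside
  \<open>H\<close> never matter. Linearity on \<open>H\<close> follows from the existence of a root vector.\<close>

definition root_space ::
  "('k::field \<Rightarrow> 'g::ab_group_add \<Rightarrow> 'g) \<Rightarrow> ('g \<Rightarrow> 'g \<Rightarrow> 'g) \<Rightarrow> 'g set \<Rightarrow> ('g \<Rightarrow> 'k) \<Rightarrow> 'g set" where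
  "root_space scale br H \<alpha> = {v. \<forall>h\<in>H. br h v = scale (\<alpha> h) v}"

definition is_root ::
  "('k::field \<Rightarrow> 'g::ab_group_add \<Rightarrow> 'g) \<Rightarrow> ('g \<Rightarrow> 'g \<Rightarrow> 'g) \<Rightarrow> 'g set \<Rightarrow> ('g \<Rightarrow> 'k) \<Rightarrow> bool" where
  "is_root scale br H \<alpha> \<longleftrightarrow>
     (\<exists>h\<in>H. \<alpha> h \<noteq> 0) \<and> (\<exists>v. v \<noteq> 0 \<and> v \<in> root_space scale br H \<alpha>)"

definition nat_combination :: "'g set \<Rightarrow> ('g \<Rightarrow> 'k::field) set \<Rightarrow> ('g \<Rightarrow> 'k) \<Rightarrow> bool" where
  "nat_combination H \<Delta> \<mu> \<longleftrightarrow>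
     (\<exists>c :: ('g \<Rightarrow> 'k) \<Rightarrow> nat. \<forall>h\<in>H. \<mu> h = (\<Sum>\<delta>\<in>\<Delta>. of_nat (c \<delta>) * \<delta> h))"

text \<open>A base (system of simple roots): linearly independent on \<open>H\<close>, and every root is a
  combination of simple roots with integer coefficients all nonnegative or all nonpositive.\<close>

definition root_base ::
  "('k::field \<Rightarrow> 'g::ab_group_add \<Rightarrow> 'g) \<Rightarrow> ('g \<Rightarrow> 'g \<Rightarrow> 'g) \<Rightarrow> 'g set \<Rightarrow> ('g \<Rightarrow> 'k) set \<Rightarrow> bool" where
  "root_base scale br H \<Delta> \<longleftrightarrow>
     finite \<Delta> \<and> (\<forall>\<delta>\<in>\<Delta>. is_root scale br H \<delta>) \<and>
     (\<forall>c :: ('g \<Rightarrow> 'k) \<Rightarrow> 'k. (\<forall>h\<in>H. (\<Sum>\<delta>\<in>\<Delta>. c \<delta> * \<delta> h) = 0) \<longrightarrow> (\<forall>\<delta>\<in>\<Delta>. c \<delta> = 0)) \<and>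
     (\<forall>\<beta>. is_root scale br H \<beta> \<longrightarrow>
        nat_combination H \<Delta> \<beta> \<or> nat_combination H \<Delta> (\<lambda>h. - \<beta> h))"

text \<open>The order on weights is: $\alpha \preceq \beta$ iff $\beta - \alpha$ is a sum of simple roots.\<close>

definition lowest_root ::
  "('k::field \<Rightarrow> 'g::ab_group_add \<Rightarrow> 'g) \<Rightarrow> ('g \<Rightarrow> 'g \<Rightarrow> 'g) \<Rightarrow> 'g set \<Rightarrow> ('g \<Rightarrow> 'k) set \<Rightarrow>
    ('g \<Rightarrow> 'k) \<Rightarrow> bool" where
  "lowest_root scale br H \<Delta> \<alpha> \<longleftrightarrow>
     is_root scale br H \<alpha> \<and>
     (\<forall>\<beta>. is_root scale br H \<beta> \<longrightarrow> nat_combination H \<Delta> (\<lambda>h. \<beta> h - \<alpha> h))"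

text \<open>A nilpotent element is minimal if it is a lowest root vector, for some Cartan subalgebra and
  some base of its root system.\<close>

definition minimal_nilpotent ::
  "('k::field \<Rightarrow> 'g::ab_group_add \<Rightarrow> 'g) \<Rightarrow> ('g \<Rightarrow> 'g \<Rightarrow> 'g) \<Rightarrow> 'g \<Rightarrow> bool" where
  "minimal_nilpotent scale br f \<longleftrightarrow>
     (\<exists>H \<Delta> \<alpha>. cartan_subalgebra scale br H \<and> root_base scale br H \<Delta> \<and>
        lowest_root scale br H \<Delta> \<alpha> \<and> f \<noteq> 0 \<and> f \<in> root_space scale br H \<alpha>)"

text \<open>Normalisation: the semisimple element of the triple is \<open>2x\<close>.\<close>

definition sl2_triple ::
  "('k::field \<Rightarrow> 'g::ab_group_add \<Rightarrow> 'g) \<Rightarrow> ('g \<Rightarrow> 'g \<Rightarrow> 'g) \<Rightarrow> 'g \<Rightarrow> 'g \<Rightarrow> 'g \<Rightarrow> bool" where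
  "sl2_triple scale br f x e \<longleftrightarrow> br e f = scale 2 x \<and> br x e = e \<and> br x f = - f"

subsection \<open>Laurent series in the inverse of z\<close>

text \<open>\<open>'k fls\<close> is the field of formal Laurent series with \<open>fls_X\<close> playing the role of $z^{-1}$, hence
  \<open>fls_X_inv\<close> that of $z$. For finite-dimensional $\mathfrak g$ the space
  $\mathfrak g \otimes \mathbb F((z^{-1}))$ is the space \<open>'g fls\<close> of Laurent series with coefficients
  in $\mathfrak g$; \<open>fls_const\<close> is the inclusion of $\mathfrak g$. A bilinear map on coefficients
  extends by the Cauchy product.\<close>

definition fls_bilinear ::
  "('a::zero \<Rightarrow> 'b::zero \<Rightarrow> 'c::comm_monoid_add) \<Rightarrow> 'a fls \<Rightarrow> 'b fls \<Rightarrow> 'c fls" where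
  "fls_bilinear B a b =
     Abs_fls (\<lambda>n. \<Sum>i = fls_subdegree a..n - fls_subdegree b. B (fls_nth a i) (fls_nth b (n - i)))"

lemma fls_bilinear_nth:
  "fls_nth (fls_bilinear B a b) n = (\<Sum>i = fls_subdegree a..n - fls_subdegree b. B (fls_nth a i) (fls_nth b (n - i)))"
  unfolding fls_bilinear_def
proof (rule nth_Abs_fls_lower_bound)
  show "\<forall>k<fls_subdegree a + fls_subdegree b.
      (\<Sum>i = fls_subdegree a..k - fls_subdegree b. B (fls_nth a i) (fls_nth b (k - i))) = 0"
    by auto
qed

abbreviation laurent_scale ::
  "('k::field \<Rightarrow> 'g::ab_group_add \<Rightarrow> 'g) \<Rightarrow> 'k fls \<Rightarrow> 'g fls \<Rightarrow> 'g fls" where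
  "laurent_scale scale \<equiv> fls_bilinear scale"

abbreviation laurent_bracket ::
  "('g \<Rightarrow> 'g \<Rightarrow> 'g::ab_group_add) \<Rightarrow> 'g fls \<Rightarrow> 'g fls \<Rightarrow> 'g fls" where
  "laurent_bracket br \<equiv> fls_bilinear br"

definition laurent_span ::
  "('k::field \<Rightarrow> 'g::ab_group_add \<Rightarrow> 'g) \<Rightarrow> 'g set \<Rightarrow> 'g fls set" where
  "laurent_span scale V = module.span (laurent_scale scale) (fls_const ` V)"

definition laurent_line ::
  "('k::field \<Rightarrow> 'g::ab_group_add \<Rightarrow> 'g) \<Rightarrow> 'g fls \<Rightarrow> 'g fls set" where
  "laurent_line scale a = module.span (laurent_scale scale) {a}"

end

theory Submission
  imports Defs
begin

text \<open>
  A lowest root vector \<open>f\<close> satisfies $[f,[f,\mathfrak g]] \subseteq \mathbb F f$: if $\beta$ and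
  $2\alpha + \beta$ are roots, then so is $-\beta$ (the Killing form is nondegenerate), and minimality of
  $\alpha$ makes both $-\beta - \alpha$ and $\alpha + \beta$ sums of simple roots. Hence $(ad f)^3 = 0$,
  which gives the grading of $\mathfrak g$ for any \<open>sl\<^sub>2\<close>-triple through \<open>f\<close>. The second triple
  $(s, 4x, 2s^*)$ then splits each graded piece as claimed. For semisimplicity, $T = ad (f + zs)$
  satisfies $T (T^6 - 9 b z^4)(T^6 + b z^4 / 3) = 0$ for a nonzero scalar \<open>b\<close>, because \<open>f\<close>, \<open>s\<close>, \<open>s\<^sup>*\<close>, \<open>e\<close>
  generate an \<open>sl\<^sub>3\<close> under which $\mathfrak g$ is a sum of one adjoint, standard, dual standard and trivial
  modules. A polynomial of this shape also forces the kernel and the image of \<open>T\<close> to meet trivially.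
\<close>

section \<open>Eigenvectors, direct sums and semisimple endomorphisms\<close>

text \<open>The constants come from a model of \<open>sl\<^sub>3\<close>: \<open>f\<close> is the
  corner matrix unit E31, \<open>2 x\<close> is E11 - E33 and \<open>s\<close> is E12 + r E23, so
  that \<open>f + z s\<close> is a cyclic matrix. On the standard module its cube is a scalar, hence
  its sixth power is some scalar c. On the adjoint module its nonzero eigenvalues are differences of
  two distinct cube roots of one element; as (1 - \<omega>)^6 = -27 for a primitive cube root of
  unity \<omega>, the sixth power is -27 c there. This is the ratio of \<open>9 b\<close> to
  \<open>- b / 3\<close>. These eigenvalues need not lie in the field of Laurent series, so nothing
  is diagonalised over it: invariant complements are obtained by averaging over powers of
  \<open>T\<close>, with only the scalars \<open>T^6\<close> known. No module decomposition is
  constructed either; the relations are checked on explicit orbits, and a subspace containing enough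
  generators is everything. The given triple need not be adapted to the Cartan subalgebra that
  exhibits \<open>f\<close> as a lowest root vector, so its grading cannot be read off from the
  roots.\<close>

lemma sum_of_Nil: "sum_of [] = {0}"
  by (simp add: sum_of_def)

lemma sum_of_Cons: "sum_of (V # Vs) = {a + b |a b. a \<in> V \<and> b \<in> sum_of Vs}"
proof (intro set_eqI iffI)
  fix v assume "v \<in> sum_of (V # Vs)"
  then obtain l where l: "l \<in> listset (V # Vs)" "v = sum_list l" by (auto simp: sum_of_def)
  then obtain a l' where "l = a # l'" "a \<in> V" "l' \<in> listset Vs" by (auto simp: set_Cons_def)
  then show "v \<in> {a + b |a b. a \<in> V \<and> b \<in> sum_of Vs}" using l(2) by (auto simp: sum_of_def)
next
  fix v assume "v \<in> {a + b |a b. a \<in> V \<and> b \<in> sum_of Vs}"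
  then obtain a l where "v = a + sum_list l" "a \<in> V" "l \<in> listset Vs" by (auto simp: sum_of_def)
  then have "a # l \<in> listset (V # Vs)" "v = sum_list (a # l)" by (auto simp: set_Cons_def)
  then show "v \<in> sum_of (V # Vs)" unfolding sum_of_def by blast
qed

lemma sum_of_2: "sum_of [A, B] = {a + b |a b. a \<in> A \<and> b \<in> B}"
  by (simp add: sum_of_Cons sum_of_Nil)

context vector_space
begin

text \<open>Applying \<open>T - \<nu>\<close> multiplies each \<open>w \<mu>\<close> by
  \<open>\<mu> - \<nu>\<close> and removes the term at \<open>\<nu>\<close>, which leaves a shorter
  vanishing sum.\<close>

lemma eigenvectors_sum_eq_0:
  assumes T: "Vector_Spaces.linear scale scale T" and "finite M"
    and "\<And>\<mu>. \<mu> \<in> M \<Longrightarrow> T (w \<mu>) = scale \<mu> (w \<mu>)" "(\<Sum>\<mu>\<in>M. w \<mu>) = 0" "\<mu> \<in> M"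
  shows "w \<mu> = 0"
  using assms(2-)
proof (induction M arbitrary: w \<mu> rule: finite_induct)
  case (insert \<nu> M)
  interpret T: Vector_Spaces.linear scale scale T by (rule T)
  define w' where "w' \<mu> = scale (\<mu> - \<nu>) (w \<mu>)" for \<mu>
  have "T (\<Sum>\<mu>\<in>insert \<nu> M. w \<mu>) = (\<Sum>\<mu>\<in>insert \<nu> M. scale \<mu> (w \<mu>))"
    using insert.prems(1) by (simp add: T.sum)
  then have "(\<Sum>\<mu>\<in>insert \<nu> M. scale \<mu> (w \<mu>)) - scale \<nu> (\<Sum>\<mu>\<in>insert \<nu> M. w \<mu>) = 0"
    using insert.prems(2) by simp
  then have "(\<Sum>\<mu>\<in>insert \<nu> M. w' \<mu>) = 0"
    by (simp only: w'_def scale_left_diff_distrib sum_subtractf scale_sum_right)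
  then have 0: "(\<Sum>\<mu>\<in>M. w' \<mu>) = 0"
    using insert.hyps by (simp add: w'_def)
  have "w' \<mu> = 0" if "\<mu> \<in> M" for \<mu>
    by (rule insert.IH[OF _ 0 that]) (use insert.prems(1) in \<open>auto simp: w'_def T.scale scale_left_commute\<close>)
  then have w0: "w \<mu> = 0" if "\<mu> \<in> M" for \<mu>
    using that insert.hyps by (auto simp: w'_def)
  then show ?case
    using insert.prems insert.hyps by auto
qed simp

text \<open>\<open>fold\<close> applies the factors \<open>T - \<mu>\<close> one after the other. If
  \<open>T v - \<nu> v\<close> is a sum of eigenvectors, each can be divided by
  \<open>\<mu> - \<nu>\<close>; subtracting the results from \<open>v\<close> leaves a vector killed
  by \<open>T - \<nu>\<close>.\<close>

lemma sum_of_eigenvectors_if_fold_eq_0: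
  assumes T: "Vector_Spaces.linear scale scale T" and "distinct \<mu>s"
    and "fold (\<lambda>\<mu> v. T v - scale \<mu> v) \<mu>s v = 0"
  shows "\<exists>w. v = (\<Sum>\<mu>\<in>set \<mu>s. w \<mu>) \<and> (\<forall>\<mu>\<in>set \<mu>s. T (w \<mu>) = scale \<mu> (w \<mu>))"
  using assms(2-)
proof (induction \<mu>s arbitrary: v)
  case (Cons \<nu> \<mu>s)
  interpret T: Vector_Spaces.linear scale scale T by (rule T)
  obtain w where w: "T v - scale \<nu> v = (\<Sum>\<mu>\<in>set \<mu>s. w \<mu>)"
      "\<And>\<mu>. \<mu> \<in> set \<mu>s \<Longrightarrow> T (w \<mu>) = scale \<mu> (w \<mu>)"
    using Cons.IH[of "T v - scale \<nu> v"] Cons.prems by auto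
  define w' where "w' \<mu> = scale (1 / (\<mu> - \<nu>)) (w \<mu>)" for \<mu>
  define u where "u = v - (\<Sum>\<mu>\<in>set \<mu>s. w' \<mu>)"
  have "T (w' \<mu>) - scale \<nu> (w' \<mu>) = w \<mu>" if "\<mu> \<in> set \<mu>s" for \<mu>
  proof -
    have "\<mu> \<noteq> \<nu>" using that Cons.prems by auto
    have "T (w' \<mu>) - scale \<nu> (w' \<mu>) = scale (1 / (\<mu> - \<nu>)) (scale (\<mu> - \<nu>) (w \<mu>))"
      by (simp add: w'_def T.scale w(2)[OF that] scale_left_diff_distrib scale_right_diff_distrib)
    then show ?thesis
      using \<open>\<mu> \<noteq> \<nu>\<close> by simp
  qed
  then have "(\<Sum>\<mu>\<in>set \<mu>s. T (w' \<mu>) - scale \<nu> (w' \<mu>)) = (\<Sum>\<mu>\<in>set \<mu>s. w \<mu>)"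
    by (intro sum.cong) auto
  then have "T u = scale \<nu> u"
    unfolding u_def using w(1)
    by (simp add: T.diff T.sum sum_subtractf scale_right_diff_distrib scale_sum_right algebra_simps)
  moreover have "T (w' \<mu>) = scale \<mu> (w' \<mu>)" if "\<mu> \<in> set \<mu>s" for \<mu>
    using w(2)[OF that] by (simp add: w'_def T.scale mult.commute)
  moreover have "(\<Sum>\<mu>\<in>set \<mu>s. (w'(\<nu> := u)) \<mu>) = (\<Sum>\<mu>\<in>set \<mu>s. w' \<mu>)"
    using Cons.prems by (intro sum.cong) auto
  then have "v = (\<Sum>\<mu>\<in>set (\<nu> # \<mu>s). (w'(\<nu> := u)) \<mu>)"
    using Cons.prems by (simp add: u_def)
  ultimately show ?case
    by (intro exI[of _ "w'(\<nu> := u)"]) auto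
qed auto

lemma span_eigenvectors_sum:
  assumes T: "Vector_Spaces.linear scale scale T" and "v \<in> span {v. \<exists>\<mu>. T v = scale \<mu> v}"
  shows "\<exists>M w. finite M \<and> v = (\<Sum>\<mu>\<in>M. w \<mu>) \<and> (\<forall>\<mu>. T (w \<mu>) = scale \<mu> (w \<mu>))"
  using assms(2)
proof (induction rule: span_induct_alt)
  case base
  interpret T: Vector_Spaces.linear scale scale T by (rule T)
  show ?case by (intro exI[of _ "{}"] exI[of _ "\<lambda>_. 0"]) simp
next
  case (step c x y)
  interpret T: Vector_Spaces.linear scale scale T by (rule T)
  obtain \<nu> where \<nu>: "T x = scale \<nu> x" using step by auto
  obtain M w where w: "finite M" "y = (\<Sum>\<mu>\<in>M. w \<mu>)" "\<And>\<mu>. T (w \<mu>) = scale \<mu> (w \<mu>)"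
    using step by blast
  \<comment> \<open>\<open>w\<close> may be nonzero outside \<open>M\<close>, so it is cut off there
    before the new eigenvector is merged in at \<open>\<nu>\<close>.\<close>
  define w' where "w' \<mu> = (if \<mu> \<in> M then w \<mu> else 0) + (if \<mu> = \<nu> then scale c x else 0)" for \<mu>
  have "(\<Sum>\<mu>\<in>insert \<nu> M. w' \<mu>) = y + scale c x"
    using w(1) by (simp add: w'_def sum.distrib sum.insert_if w(2))
  moreover have "T (w' \<mu>) = scale \<mu> (w' \<mu>)" for \<mu>
    using w(3) \<nu> by (auto simp: w'_def T.add T.scale scale_right_distrib scale_left_commute)
  ultimately show ?case
    using w(1) by (intro exI[of _ "insert \<nu> M"] exI[of _ w']) (auto simp: add.commute)
qed

text \<open>Let \<open>v\<close> be a common eigenvector for \<open>S\<close> and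
  \<open>w \<mu>\<close> its components under \<open>T\<close>. If \<open>T'\<close> has eigenvalue
  \<open>\<nu>\<close> at \<open>v\<close>, the vectors
  \<open>T' (w \<mu>) - \<nu> (w \<mu>)\<close> are \<open>T\<close>-eigenvectors for distinct
  eigenvalues with sum 0, so each vanishes and the components stay eigenvectors for
  \<open>S\<close>.\<close>

lemma span_common_eigenvectors:
  assumes "finite S" and "\<And>T. T \<in> S \<Longrightarrow> Vector_Spaces.linear scale scale T"
    and "\<And>T T' v. T \<in> S \<Longrightarrow> T' \<in> S \<Longrightarrow> T (T' v) = T' (T v)"
    and "\<And>T. T \<in> S \<Longrightarrow> span {v. \<exists>\<mu>. T v = scale \<mu> v} = UNIV"
  shows "span {v. \<forall>T\<in>S. \<exists>\<mu>. T v = scale \<mu> v} = UNIV"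
  using assms
proof (induction S rule: finite_induct)
  case (insert T S)
  let ?E = "\<lambda>S. {v. \<forall>T\<in>S. \<exists>\<mu>. T v = scale \<mu> v}"
  have IH: "span (?E S) = UNIV" by (rule insert.IH) (use insert.prems in auto)
  have T: "Vector_Spaces.linear scale scale T" using insert.prems by auto
  have "v \<in> span (?E (insert T S))" if v: "v \<in> ?E S" for v
  proof -
    have "v \<in> span {v. \<exists>\<mu>. T v = scale \<mu> v}" using insert.prems(3)[of T] by simp
    then obtain M w where w: "finite M" "v = (\<Sum>\<mu>\<in>M. w \<mu>)" "\<And>\<mu>. T (w \<mu>) = scale \<mu> (w \<mu>)"
      using span_eigenvectors_sum[OF T] by blast
    have wE: "w \<mu> \<in> ?E (insert T S)" if \<mu>: "\<mu> \<in> M" for \<mu>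
    proof -
      have "\<exists>\<nu>. T' (w \<mu>) = scale \<nu> (w \<mu>)" if T': "T' \<in> S" for T'
      proof -
        interpret T: Vector_Spaces.linear scale scale T by (rule T)
        interpret T': Vector_Spaces.linear scale scale T' using insert.prems T' by auto
        obtain \<nu> where \<nu>: "T' v = scale \<nu> v" using v T' by auto
        have "T' (w \<mu>) - scale \<nu> (w \<mu>) = 0"
        proof (rule eigenvectors_sum_eq_0[OF T w(1) _ _ \<mu>, of "\<lambda>\<mu>. T' (w \<mu>) - scale \<nu> (w \<mu>)"])
          show "(\<Sum>\<mu>\<in>M. T' (w \<mu>) - scale \<nu> (w \<mu>)) = 0"
            using \<nu> by (simp add: w(2) T'.sum sum_subtractf scale_sum_right)
          fix \<mu> assume "\<mu> \<in> M"
          have "T (T' (w \<mu>)) = T' (T (w \<mu>))" using insert.prems(2)[of T T'] T' by auto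
          then show "T (T' (w \<mu>) - scale \<nu> (w \<mu>)) = scale \<mu> (T' (w \<mu>) - scale \<nu> (w \<mu>))"
            by (simp add: T.diff T.scale w(3) T'.scale scale_right_diff_distrib scale_left_commute)
        qed
        then show ?thesis by auto
      qed
      then show ?thesis using w(3) by auto
    qed
    show ?thesis
      unfolding w(2) by (rule span_sum[OF span_base[OF wE]])
  qed
  then have "span (?E S) \<subseteq> span (?E (insert T S))"
    by (intro span_minimal) auto
  then show ?case using IH by auto
qed simp

end

section \<open>Polynomials in an endomorphism and existence of eigenvectors\<close>

definition poly_apply :: "('k::field \<Rightarrow> 'v::ab_group_add \<Rightarrow> 'v) \<Rightarrow> ('v \<Rightarrow> 'v) \<Rightarrow> 'k poly \<Rightarrow> 'v \<Rightarrow> 'v" where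
  "poly_apply scale T p = fold_coeffs (\<lambda>a g v. scale a v + g (T v)) p (\<lambda>_. 0)"

context vector_space
begin

lemma poly_apply_0 [simp]: "poly_apply scale T 0 v = 0"
  by (simp add: poly_apply_def)

lemma poly_apply_pCons [simp]: "poly_apply scale T (pCons a p) v = scale a v + poly_apply scale T p (T v)"
  by (cases "p = 0 \<and> a = 0") (auto simp: poly_apply_def)

lemma poly_apply_add: "poly_apply scale T (p + q) v = poly_apply scale T p v + poly_apply scale T q v"
  by (induction p q arbitrary: v rule: poly_induct2) (auto simp: scale_left_distrib)

lemma poly_apply_smult: "poly_apply scale T (smult c p) v = scale c (poly_apply scale T p v)"
  by (induction p arbitrary: v) (auto simp: scale_right_distrib)

lemma poly_apply_diff_arg:
  assumes "Vector_Spaces.linear scale scale T"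
  shows "poly_apply scale T p (v - w) = poly_apply scale T p v - poly_apply scale T p w"
proof -
  interpret T: Vector_Spaces.linear scale scale T by fact
  show ?thesis
    by (induction p arbitrary: v w) (auto simp: scale_right_diff_distrib T.diff)
qed

lemma poly_apply_scale_arg:
  assumes "Vector_Spaces.linear scale scale T"
  shows "poly_apply scale T p (scale c v) = scale c (poly_apply scale T p v)"
proof -
  interpret T: Vector_Spaces.linear scale scale T by fact
  show ?thesis
    by (induction p arbitrary: v) (auto simp: scale_right_distrib T.scale mult.commute)
qed

lemma poly_apply_monom: "poly_apply scale T (monom c n) v = scale c ((T ^^ n) v)"
  by (induction n arbitrary: v) (auto simp: monom_0 monom_Suc funpow_swap1)

lemma poly_apply_sum: "poly_apply scale T (sum p I) v = (\<Sum>i\<in>I. poly_apply scale T (p i) v)"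
  by (induction I rule: infinite_finite_induct) (auto simp: poly_apply_add)

text \<open>Linear dependence is a property of sets and does not see repetitions. Hence the split:
  infinitely many distinct powers are dependent, and a coincidence of two powers gives a relation
  directly.\<close>

lemma exists_annihilating_poly:
  assumes "finite B" "span B = UNIV"
  shows "\<exists>p. p \<noteq> 0 \<and> poly_apply scale T p v = 0"
proof (cases "inj (\<lambda>i. (T ^^ i) v)")
  case True
  then have "infinite (range (\<lambda>i. (T ^^ i) v))"
    by (simp add: finite_image_iff)
  then have "dependent (range (\<lambda>i. (T ^^ i) v))"
    using independent_span_bound[OF assms(1)] assms(2) by auto
  then obtain t u x where t: "finite t" "t \<subseteq> range (\<lambda>i. (T ^^ i) v)" "(\<Sum>x\<in>t. scale (u x) x) = 0" "x \<in> t" "u x \<noteq> 0"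
    unfolding dependent_explicit by blast
  obtain I where I: "t = (\<lambda>i. (T ^^ i) v) ` I"
    using t(2) by (auto simp: subset_image_iff)
  have inj: "inj_on (\<lambda>i. (T ^^ i) v) I" using True by (auto simp: inj_on_def)
  have "finite I" using t(1) I inj by (simp add: finite_image_iff)
  obtain i where i: "i \<in> I" "x = (T ^^ i) v" using t(4) I by auto
  define p where "p = (\<Sum>i\<in>I. monom (u ((T ^^ i) v)) i)"
  have "poly_apply scale T p v = 0"
    using t(3) by (simp add: p_def poly_apply_sum poly_apply_monom I sum.reindex[OF inj])
  moreover have "coeff p i = u x"
    using i \<open>finite I\<close> by (simp add: p_def coeff_sum if_distrib cong: if_cong)
  then have "p \<noteq> 0" using t(5) by (intro notI) simp
  ultimately show ?thesis by blast
next
  case False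
  then obtain i j where ij: "i \<noteq> j" "(T ^^ i) v = (T ^^ j) v" by (auto simp: inj_on_def)
  let ?p = "monom (1::'a) i + monom (-1) j"
  have "coeff ?p i = 1" using ij by simp
  then have "coeff ?p i \<noteq> coeff 0 i" by simp
  then have "?p \<noteq> 0" by (rule contrapos_nn) (rule arg_cong)
  moreover have "poly_apply scale T ?p v = 0"
    using ij by (simp add: poly_apply_add poly_apply_monom)
  ultimately show ?thesis by blast
qed

end

text \<open>Splitting a root \<open>\<mu>\<close> off an annihilating polynomial of
  \<open>v\<close>: either \<open>v\<close> is an eigenvector, or \<open>T v - \<mu> v\<close> is a
  nonzero vector of \<open>U\<close> annihilated in lower degree.\<close>

lemma exists_eigenvector:
  fixes scale :: "'k::alg_closed_field \<Rightarrow> 'v::ab_group_add \<Rightarrow> 'v"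
  assumes "vector_space scale" and "finite B" "module.span scale B = UNIV"
    and T: "Vector_Spaces.linear scale scale T"
    and U: "module.subspace scale U" "T ` U \<subseteq> U" and "v \<in> U" "v \<noteq> 0"
  shows "\<exists>w\<in>U. w \<noteq> 0 \<and> (\<exists>\<mu>. T w = scale \<mu> w)"
proof -
  interpret vector_space scale by fact
  interpret T: Vector_Spaces.linear scale scale T by (rule T)
  obtain p where p: "p \<noteq> 0" "poly_apply scale T p v = 0"
    using exists_annihilating_poly[OF assms(2,3)] by blast
  show ?thesis using p \<open>v \<in> U\<close> \<open>v \<noteq> 0\<close>
  proof (induction "degree p" arbitrary: p v)
    case 0
    then obtain a where "p = [:a:]" by (metis degree_eq_zeroE)
    then show ?case using 0 by auto
  next
    case (Suc n)
    then obtain \<mu> where "poly p \<mu> = 0"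
      using alg_closed_imp_poly_has_root[of p] by auto
    then obtain q where q: "p = [:- \<mu>, 1:] * q" by (auto simp: poly_eq_0_iff_dvd)
    have "q \<noteq> 0" using Suc q by auto
    have deg: "n = degree q"
      using Suc.hyps(2) \<open>q \<noteq> 0\<close> unfolding q by (subst (asm) degree_mult_eq) auto
    let ?w = "T v - scale \<mu> v"
    have "poly_apply scale T q ?w = poly_apply scale T p v"
    proof -
      have "p = smult (- \<mu>) q + pCons 0 q" by (simp add: q)
      then show ?thesis
        by (simp only: poly_apply_add poly_apply_smult poly_apply_pCons poly_apply_diff_arg[OF T]
            poly_apply_scale_arg[OF T]) simp
    qed
    then have "poly_apply scale T q ?w = 0" using Suc.prems by simp
    moreover have "?w \<in> U"
      using Suc.prems U by (auto intro!: subspace_diff subspace_scale)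
    ultimately show ?case
      using Suc.hyps(1)[OF deg \<open>q \<noteq> 0\<close>] Suc.prems by (cases "?w = 0") auto
  qed
qed

text \<open>An invariant complement of the span of all eigenvectors contains no eigenvector, hence
  is zero.\<close>

lemma semisimple_endo_span_eigenvectors:
  fixes scale :: "'k::alg_closed_field \<Rightarrow> 'v::ab_group_add \<Rightarrow> 'v"
  assumes "vector_space scale" and fin: "finite B" "module.span scale B = UNIV"
    and ss: "semisimple_endo scale T"
  shows "module.span scale {v. \<exists>\<mu>. T v = scale \<mu> v} = UNIV"
proof -
  interpret vector_space scale by fact
  have T: "Vector_Spaces.linear scale scale T" using ss by (simp add: semisimple_endo_def)
  interpret T: Vector_Spaces.linear scale scale T by (rule T)
  let ?E = "{v. \<exists>\<mu>. T v = scale \<mu> v}"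
  have "T ` ?E \<subseteq> span ?E"
  proof safe
    fix v \<mu> assume "T v = scale \<mu> v"
    then have "T v \<in> span {v}" by (simp add: span_scale span_base)
    also have "span {v} \<subseteq> span ?E" using \<open>T v = scale \<mu> v\<close> by (intro span_mono) auto
    finally show "T v \<in> span ?E" .
  qed
  then have "T ` span ?E \<subseteq> span ?E"
    unfolding T.span_image[symmetric] by (rule span_minimal) simp
  moreover have "\<exists>W. subspace W \<and> T ` W \<subseteq> W \<and> direct_sum_of [U, W] UNIV"
    if "subspace U" "T ` U \<subseteq> U" for U
    using ss that by (simp only: semisimple_endo_def)
  ultimately obtain W where W: "subspace W" "T ` W \<subseteq> W" and dir: "direct_sum_of [span ?E, W] UNIV"
    using subspace_span by blast
  have W0: "w = 0" if w: "w \<in> W" for w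
  proof (rule ccontr)
    assume "w \<noteq> 0"
    then obtain v where v: "v \<in> W" "v \<noteq> 0" "v \<in> ?E"
      using exists_eigenvector[OF assms(1-3) T W w \<open>w \<noteq> 0\<close>] by auto
    \<comment> \<open>Two lists with the same sum: a common vector of both summands contradicts
      uniqueness.\<close>
    have "[v, 0] \<in> listset [span ?E, W]" "[0, v] \<in> listset [span ?E, W]"
      using v W by (auto simp: set_Cons_def span_zero subspace_0 intro: span_base)
    moreover have "inj_on sum_list (listset [span ?E, W])"
      using dir unfolding direct_sum_of_def by (rule bij_betw_imp_inj_on)
    ultimately have "[v, 0] = [0, v]"
      by (simp only: inj_on_eq_iff[symmetric]) simp
    then show False using v by simp
  qed
  have sum: "sum_of [span ?E, W] = UNIV"
    using dir unfolding direct_sum_of_def sum_of_def by (rule bij_betw_imp_surj_on)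
  have "v \<in> span ?E" for v
  proof -
    have "v \<in> sum_of [span ?E, W]" unfolding sum by simp
    then obtain a b where "v = a + b" "a \<in> span ?E" "b \<in> W"
      unfolding sum_of_2 by blast
    then show ?thesis using W0 by (metis add.right_neutral)
  qed
  then show ?thesis by blast
qed

section \<open>Direct sums and a criterion for semisimplicity\<close>

context vector_space
begin

lemma subspace_sum_of: "(\<And>V. V \<in> set Vs \<Longrightarrow> subspace V) \<Longrightarrow> subspace (sum_of Vs)"
  by (induction Vs) (simp_all add: sum_of_Nil sum_of_Cons subspace_sums)

lemma subset_sum_of:
  assumes "\<And>V. V \<in> set Vs \<Longrightarrow> subspace V" "V \<in> set Vs"
  shows "V \<subseteq> sum_of Vs"
  using assms
proof (induction Vs)
  case (Cons V' Vs)
  have 0: "0 \<in> V'" "0 \<in> sum_of Vs"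
    using Cons.prems(1) by (auto intro!: subspace_0 subspace_sum_of)
  show ?case
  proof
    fix v assume v: "v \<in> V"
    show "v \<in> sum_of (V' # Vs)"
    proof (cases "V = V'")
      case True
      have "v = v + 0" by simp
      then show ?thesis unfolding sum_of_Cons using True v 0 by blast
    next
      case False
      then have "v \<in> sum_of Vs" using Cons v by auto
      moreover have "v = 0 + v" by simp
      ultimately show ?thesis unfolding sum_of_Cons using 0 by blast
    qed
  qed
qed simp

lemma sum_of_subset: "subspace W \<Longrightarrow> (\<And>V. V \<in> set Vs \<Longrightarrow> V \<subseteq> W) \<Longrightarrow> sum_of Vs \<subseteq> W"
  by (induction Vs) (auto simp: sum_of_Nil sum_of_Cons subspace_0 intro!: subspace_add)

text \<open>Entrywise differences of two lists with equal sum reduce injectivity to lists with sum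
  0.\<close>

lemma direct_sum_ofI:
  assumes "\<And>V. V \<in> set Vs \<Longrightarrow> subspace V"
    and "\<And>l. l \<in> listset Vs \<Longrightarrow> sum_list l = 0 \<Longrightarrow> \<forall>v\<in>set l. v = 0"
  shows "direct_sum_of Vs (sum_of Vs)"
proof -
  have diff: "map2 (-) l l' \<in> listset Vs \<and> sum_list (map2 (-) l l') = sum_list l - sum_list l'
      \<and> length l = length Vs"
    if "l \<in> listset Vs" "l' \<in> listset Vs" for l l'
    using that assms(1)
  proof (induction Vs arbitrary: l l')
    case (Cons V Vs)
    from Cons.prems(1) obtain a m where l: "l = a # m" "a \<in> V" "m \<in> listset Vs" by (auto simp: set_Cons_def)
    from Cons.prems(2) obtain a' m' where l': "l' = a' # m'" "a' \<in> V" "m' \<in> listset Vs" by (auto simp: set_Cons_def)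
    have "a - a' \<in> V" using l l' Cons.prems(3) by (intro subspace_diff) auto
    moreover note Cons.IH[OF l(3) l'(3)]
    ultimately show ?case using Cons.prems(3) by (simp add: l(1) l'(1) set_Cons_def)
  qed simp
  have "inj_on sum_list (listset Vs)"
  proof (rule inj_onI)
    fix l l' assume l: "l \<in> listset Vs" "l' \<in> listset Vs" "sum_list l = sum_list l'"
    have len: "length l = length l'" using diff[OF l(1,2)] diff[OF l(2,1)] by simp
    have zero: "\<forall>v\<in>set (map2 (-) l l'). v = 0"
      by (rule assms(2)) (use diff[OF l(1,2)] l(3) in simp_all)
    have "l ! i = l' ! i" if "i < length l" for i
    proof -
      have "map2 (-) l l' ! i \<in> set (map2 (-) l l')" using that len by (intro nth_mem) simp
      then have "map2 (-) l l' ! i = 0" using zero by blast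
      then show ?thesis using that len by simp
    qed
    then show "l = l'" using len by (intro nth_equalityI)
  qed
  then show ?thesis by (simp add: direct_sum_of_def bij_betw_def sum_of_def)
qed

text \<open>The kernel of an equivariant projection onto \<open>U\<close> is an invariant
  complement.\<close>

lemma semisimple_endoI:
  assumes T: "Vector_Spaces.linear scale scale T"
    and proj: "\<And>U. subspace U \<Longrightarrow> T ` U \<subseteq> U \<Longrightarrow> \<exists>Q. Vector_Spaces.linear scale scale Q \<and>
      (\<forall>v. Q (T v) = T (Q v)) \<and> (\<forall>v. Q v \<in> U) \<and> (\<forall>u\<in>U. Q u = u)"
  shows "semisimple_endo scale T"
  unfolding semisimple_endo_def
proof (intro conjI allI impI T)
  interpret T: Vector_Spaces.linear scale scale T by (rule T)
  fix U assume U: "subspace U \<and> T ` U \<subseteq> U"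
  then obtain Q where Q: "Vector_Spaces.linear scale scale Q"
    "\<And>v. Q (T v) = T (Q v)" "\<And>v. Q v \<in> U" "\<And>u. u \<in> U \<Longrightarrow> Q u = u"
    using proj[of U] by blast
  interpret Q: Vector_Spaces.linear scale scale Q by (rule Q(1))
  define W where "W = {v. Q v = 0}"
  have sub: "subspace U" "subspace W" using U by (simp_all add: W_def Q.subspace_kernel)
  have "direct_sum_of [U, W] (sum_of [U, W])"
  proof (rule direct_sum_ofI)
    show "subspace V" if "V \<in> set [U, W]" for V using that sub by auto
    fix l assume l: "l \<in> listset [U, W]" "sum_list l = 0"
    from l(1) obtain u w where uw: "l = [u, w]" "u \<in> U" "w \<in> W" by (auto simp: set_Cons_def)
    have "u + w = 0" using l(2) uw(1) by simp
    have "Q (u + w) = u" using uw Q(4)[of u] by (simp add: Q.add W_def)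
    then have "u = 0" using \<open>u + w = 0\<close> by simp
    then show "\<forall>v\<in>set l. v = 0" using \<open>u + w = 0\<close> uw(1) by simp
  qed
  moreover have "v \<in> sum_of [U, W]" for v
  proof -
    have "v - Q v \<in> W" by (simp add: W_def Q.diff Q(4)[OF Q(3)])
    moreover have "v = Q v + (v - Q v)" by simp
    ultimately show ?thesis unfolding sum_of_2 using Q(3) by blast
  qed
  then have "sum_of [U, W] = UNIV" by blast
  moreover have "T ` W \<subseteq> W" by (auto simp: W_def Q(2))
  ultimately show "\<exists>W. subspace W \<and> T ` W \<subseteq> W \<and> direct_sum_of [U, W] UNIV"
    using sub(2) by auto
qed

text \<open>Averaging a projection \<open>\<pi>\<close> over the powers of \<open>T\<close>, as in Maschke's theorem, on a block
  where \<open>T\<close> is invertible because \<open>T\<^sup>n\<close> is a nonzero scalar.\<close>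

lemma equivariant_averaging:
  assumes T: "Vector_Spaces.linear scale scale T" and P: "Vector_Spaces.linear scale scale P"
    and PT: "\<And>v. P (T v) = T (P v)" and PP: "\<And>v. P (P v) = P v"
    and Tn: "\<And>v. (T ^^ n) (P v) = scale c (P v)" and "c \<noteq> 0" "of_nat n \<noteq> (0 :: 'a)"
    and U: "subspace U" "T ` U \<subseteq> U" "P ` U \<subseteq> U"
  shows "\<exists>Q. Vector_Spaces.linear scale scale Q \<and> (\<forall>v. Q (T v) = T (Q v)) \<and> (\<forall>v. Q v \<in> U) \<and> (\<forall>u\<in>U. Q u = P u)"
proof -
  interpret T: Vector_Spaces.linear scale scale T by (rule T)
  interpret P: Vector_Spaces.linear scale scale P by (rule P)
  interpret vector_space_pair scale scale ..
  obtain \<pi> where \<pi>: "Vector_Spaces.linear scale scale \<pi>" "range \<pi> \<subseteq> U" "\<And>u. u \<in> U \<Longrightarrow> \<pi> u = u"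
    using linear_exists_left_inverse_on[OF linear_id U(1)] by auto
  interpret \<pi>: Vector_Spaces.linear scale scale \<pi> by (rule \<pi>(1))
  have pow_add: "(T ^^ i) (v + w) = (T ^^ i) v + (T ^^ i) w"
    and pow_scale: "(T ^^ i) (scale r v) = scale r ((T ^^ i) v)" for i v w r
    by (induction i) (simp_all add: T.add T.scale)
  have pow_U: "(T ^^ i) u \<in> U" if "u \<in> U" for i u
    using that U(2) by (induction i) auto
  have P_pow: "P ((T ^^ i) v) = (T ^^ i) (P v)" for i v by (induction i) (simp_all add: PT)
  \<comment> \<open>\<open>T\<close> need not be invertible on the whole space, so
    \<open>T^(m - i)\<close> stands in for \<open>T^(-i)\<close>; for \<open>m = n\<close> the two
    differ on the block by the factor \<open>c\<close>. The value \<open>m = n + 1\<close> also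
    occurs, because composing with \<open>T\<close> on either side lengthens the total power by
    one.\<close>
  define g where "g m i v = (T ^^ i) (P (\<pi> ((T ^^ (m - i)) (P v))))" for m i v
  define Q where "Q v = scale (1 / (of_nat n * c)) (\<Sum>i<n. g n i v)" for v
  have "g n i (v + w) = g n i v + g n i w" "g n i (scale r v) = scale r (g n i v)" for i v w r
    by (simp_all add: g_def P.add P.scale \<pi>.add \<pi>.scale pow_add pow_scale)
  then have "Vector_Spaces.linear scale scale Q"
    by (unfold_locales; simp add: Q_def sum.distrib scale_right_distrib mult.commute
        flip: scale_sum_right)
  moreover have "Q (T v) = T (Q v)" for v
  proof -
    have "g n i (T v) = g (Suc n) i v" if "i < n" for i
      using that by (simp add: g_def PT Suc_diff_le funpow_swap1)
    then have "(\<Sum>i<n. g n i (T v)) = (\<Sum>i<n. g (Suc n) i v)" by simp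
    moreover have "T (g n i v) = g (Suc n) (Suc i) v" for i by (simp add: g_def)
    then have "(\<Sum>i<n. T (g n i v)) = (\<Sum>i<n. g (Suc n) (Suc i) v)" by simp
    moreover have "g (Suc n) 0 v + (\<Sum>i<n. g (Suc n) (Suc i) v) = (\<Sum>i<n. g (Suc n) i v) + g (Suc n) n v"
      using sum.lessThan_Suc_shift[of "\<lambda>i. g (Suc n) i v" n] by simp
    \<comment> \<open>The two sums differ only in their end terms, which agree because
      \<open>T^n\<close> is \<open>c\<close> on the image of \<open>P\<close>.\<close>
    moreover have "g (Suc n) 0 v = g (Suc n) n v"
    proof -
      have "g (Suc n) 0 v = P (\<pi> (T (scale c (P v))))" by (simp add: g_def Tn)
      also have "\<dots> = scale c (P (\<pi> (T (P v))))" by (simp add: T.scale \<pi>.scale P.scale)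
      also have "\<dots> = g (Suc n) n v" by (simp add: g_def Tn)
      finally show ?thesis .
    qed
    ultimately have "(\<Sum>i<n. g n i (T v)) = (\<Sum>i<n. T (g n i v))" by simp
    then show ?thesis by (simp add: Q_def T.scale T.sum)
  qed
  moreover have "g n i v \<in> U" for i v
    unfolding g_def using \<pi>(2) U(3) by (intro pow_U) blast
  then have "Q v \<in> U" for v
    unfolding Q_def by (intro subspace_scale[OF U(1)] subspace_sum[OF U(1)])
  moreover have "Q u = P u" if u: "u \<in> U" for u
  proof -
    have "g n i u = scale c (P u)" if "i < n" for i
    proof -
      have "(T ^^ (n - i)) (P u) \<in> U" using u U(3) by (intro pow_U) blast
      then have "g n i u = (T ^^ i) (P ((T ^^ (n - i)) (P u)))" by (simp add: g_def \<pi>(3))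
      also have "\<dots> = (T ^^ i) ((T ^^ (n - i)) (P u))" by (simp add: P_pow PP)
      also have "\<dots> = (T ^^ n) (P u)"
        using that by (simp add: funpow_add[symmetric, THEN fun_cong, unfolded o_apply])
      finally show ?thesis by (simp add: Tn)
    qed
    then have "(\<Sum>i<n. g n i u) = scale (of_nat n * c) (P u)"
      by (simp add: sum_constant_scale)
    then show ?thesis using assms(6,7) by (simp add: Q_def)
  qed
  ultimately show ?thesis by blast
qed

text \<open>With \<open>R = T^n\<close> the hypothesis reads \<open>T (R - c) (R - d) = 0\<close>,
  so the space splits into the kernel of \<open>T\<close> and two parts on which \<open>R\<close> is
  the scalar \<open>c\<close> or \<open>d\<close>. On the kernel any projection commutes with
  \<open>T\<close>; on the other two parts a projection is averaged.\<close>

lemma semisimple_endo_if_annihilated: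
  assumes T: "Vector_Spaces.linear scale scale T"
    and ann: "\<And>v. T ((T ^^ n) ((T ^^ n) v) - scale (c + d) ((T ^^ n) v) + scale (c * d) v) = 0"
    and cd: "c \<noteq> 0" "d \<noteq> 0" "c \<noteq> d" and n: "of_nat n \<noteq> (0 :: 'a)"
  shows "semisimple_endo scale T"
proof (rule semisimple_endoI[OF T])
  interpret T: Vector_Spaces.linear scale scale T by (rule T)
  define R where "R = T ^^ n"
  have R_add: "R (v + w) = R v + R w" and R_scale: "R (scale r v) = scale r (R v)"
    and RT: "R (T v) = T (R v)" for v w r
  proof -
    have "(T ^^ i) (v + w) = (T ^^ i) v + (T ^^ i) w" "(T ^^ i) (scale r v) = scale r ((T ^^ i) v)" for i
      by (induction i) (simp_all add: T.add T.scale)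
    then show "R (v + w) = R v + R w" "R (scale r v) = scale r (R v)" by (simp_all add: R_def)
    show "R (T v) = T (R v)" by (simp add: R_def funpow_swap1)
  qed
  have R_diff: "R (v - w) = R v - R w" for v w
    using R_add[of v "scale (-1) w"] R_scale[of "-1" w] by simp
  \<comment> \<open>A positive exponent puts the kernel of \<open>T\<close> into the kernel of
    \<open>R\<close>.\<close>
  obtain m where m: "n = Suc m" using n by (cases n) auto
  have R_ker: "R v = 0" if "T v = 0" for v
  proof -
    have "(T ^^ m) 0 = 0" by (induction m) simp_all
    then show ?thesis using that by (simp add: R_def m funpow_swap1)
  qed
  define p where "p v = R (R v) - scale (c + d) (R v) + scale (c * d) v" for v
  have Tp: "T (p v) = 0" for v using ann by (simp add: p_def R_def)
  have Rp: "R (R (R v)) = scale (c + d) (R (R v)) - scale (c * d) (R v)" for v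
  proof -
    have "R (p v) = 0" by (rule R_ker[OF Tp])
    then show ?thesis by (simp add: p_def R_add R_diff R_scale algebra_simps)
  qed
  \<comment> \<open>Lagrange interpolation at the nodes 0, \<open>c\<close> and \<open>d\<close>:
    \<open>P0\<close> is \<open>(R - c) (R - d) / (c d)\<close>, and \<open>block c d\<close> is
    \<open>R (R - d) / (c (c - d))\<close>.\<close>
  define P0 where "P0 v = scale (1 / (c * d)) (p v)" for v
  define block where "block c d v = scale (1 / (c * (c - d))) (R (R v) - scale d (R v))" for c d v
  note ops = T.add T.diff T.scale R_add R_diff R_scale RT
  have lin_block: "Vector_Spaces.linear scale scale (block c d)" for c d
    by unfold_locales (simp_all add: block_def ops scale_right_distrib scale_right_diff_distrib algebra_simps)
  have lin_P0: "Vector_Spaces.linear scale scale P0"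
    by unfold_locales (simp_all add: P0_def p_def ops scale_right_distrib scale_right_diff_distrib algebra_simps)
  have block_T: "block c d (T v) = T (block c d v)" for c d v by (simp add: block_def ops)
  have R_block: "R (block c d v) = scale c (block c d v)"
    if "R (R (R v)) = scale (c + d) (R (R v)) - scale (c * d) (R v)" for c d v
  proof -
    have *: "R (R (R v)) - scale d (R (R v)) = scale c (R (R v) - scale d (R v))"
      using that by (simp add: scale_left_distrib scale_right_diff_distrib)
    show ?thesis
      unfolding block_def R_scale R_diff * by (rule scale_left_commute)
  qed
  have block_idem: "block c d (block c d v) = block c d v"
    if "R (block c d v) = scale c (block c d v)" "c \<noteq> 0" "c \<noteq> d" for c d v
  proof -
    let ?w = "block c d v"
    have "block c d ?w = scale (1 / (c * (c - d))) (scale (c * c) ?w - scale (d * c) ?w)"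
      by (subst block_def) (simp add: that(1) R_scale)
    also have "\<dots> = scale (1 / (c * (c - d)) * (c * (c - d))) ?w"
      by (simp only: scale_left_diff_distrib[symmetric] scale_scale) (simp add: algebra_simps)
    finally show ?thesis using that by simp
  qed
  have Rp': "R (R (R v)) = scale (d + c) (R (R v)) - scale (d * c) (R v)" for v
    using Rp[of v] by (simp add: add.commute mult.commute)
  have T_P0: "T (P0 v) = 0" for v by (simp add: P0_def T.scale Tp)
  have P0_T: "P0 (T v) = 0" for v
  proof -
    have "p (T v) = T (p v)" by (simp add: p_def ops)
    then show ?thesis by (simp add: P0_def Tp)
  qed
  have P0_ker: "P0 v = v" if "T v = 0" for v
    using cd R_ker[OF that] by (simp add: P0_def p_def R_ker[OF T.zero])
  have sum: "P0 v + block c d v + block d c v = v" for v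
  proof -
    let ?k = "c * d * (c - d)"
    have k: "?k \<noteq> 0" using cd by simp
    have "scale ?k (P0 v) = scale (c - d) (p v)" using cd by (simp add: P0_def)
    moreover have "scale ?k (block c d v) = scale d (R (R v) - scale d (R v))"
    proof -
      have "?k * (1 / (c * (c - d))) = d" using cd by simp
      then show ?thesis unfolding block_def scale_scale by (simp only:)
    qed
    moreover have "scale ?k (block d c v) = scale (- c) (R (R v) - scale c (R v))"
    proof -
      have "?k * (1 / (d * (d - c))) = - c" using cd by (simp add: divide_simps) (simp add: algebra_simps)
      then show ?thesis unfolding block_def scale_scale by (simp only:)
    qed
    ultimately have "scale ?k (P0 v + block c d v + block d c v) =
        scale (c - d) (p v) + scale d (R (R v) - scale d (R v)) + scale (- c) (R (R v) - scale c (R v))"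
      by (simp only: scale_right_distrib)
    also have "\<dots> = scale ?k v"
      by (simp add: p_def scale_left_distrib scale_right_distrib scale_left_diff_distrib scale_right_diff_distrib)
        (simp add: algebra_simps scale_left_distrib scale_left_diff_distrib)
    finally show ?thesis using k by (simp only: scale_cancel_left) simp
  qed
  fix U assume U: "subspace U" "T ` U \<subseteq> U"
  interpret vector_space_pair scale scale ..
  obtain \<pi> where \<pi>: "Vector_Spaces.linear scale scale \<pi>" "range \<pi> \<subseteq> U" "\<And>u. u \<in> U \<Longrightarrow> \<pi> u = u"
    using linear_exists_left_inverse_on[OF linear_id U(1)] by auto
  interpret \<pi>: Vector_Spaces.linear scale scale \<pi> by (rule \<pi>(1))
  interpret P0: Vector_Spaces.linear scale scale P0 by (rule lin_P0)
  have RU: "R u \<in> U" if "u \<in> U" for u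
  proof -
    have "(T ^^ i) u \<in> U" for i using that U(2) by (induction i) auto
    then show ?thesis by (simp add: R_def)
  qed
  have block_U: "block c d ` U \<subseteq> U" for c d
    by (auto simp: block_def intro!: subspace_scale[OF U(1)] subspace_diff[OF U(1)] RU)
  have P0_U: "P0 u \<in> U" if "u \<in> U" for u
    using that unfolding P0_def p_def
    by (intro subspace_scale[OF U(1)] subspace_diff[OF U(1)] subspace_add[OF U(1)] RU)
  obtain Q1 where Q1: "Vector_Spaces.linear scale scale Q1" "\<And>v. Q1 (T v) = T (Q1 v)" "\<And>v. Q1 v \<in> U"
    "\<And>u. u \<in> U \<Longrightarrow> Q1 u = block c d u"
    using equivariant_averaging[OF T lin_block block_T block_idem[OF R_block[OF Rp] cd(1,3)]
        R_block[OF Rp, unfolded R_def[THEN fun_cong]] cd(1) n U block_U] by blast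
  obtain Q2 where Q2: "Vector_Spaces.linear scale scale Q2" "\<And>v. Q2 (T v) = T (Q2 v)" "\<And>v. Q2 v \<in> U"
    "\<And>u. u \<in> U \<Longrightarrow> Q2 u = block d c u"
    using equivariant_averaging[OF T lin_block block_T block_idem[OF R_block[OF Rp'] cd(2) cd(3)[symmetric]]
        R_block[OF Rp', unfolded R_def[THEN fun_cong]] cd(2) n U block_U] by blast
  interpret Q1: Vector_Spaces.linear scale scale Q1 by (rule Q1(1))
  interpret Q2: Vector_Spaces.linear scale scale Q2 by (rule Q2(1))
  define Q where "Q v = P0 (\<pi> (P0 v)) + Q1 v + Q2 v" for v
  have "Vector_Spaces.linear scale scale Q"
    by unfold_locales (simp_all add: Q_def P0.add P0.scale \<pi>.add \<pi>.scale Q1.add Q1.scale Q2.add Q2.scale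
        scale_right_distrib)
  moreover have "Q (T v) = T (Q v)" for v
    by (simp add: Q_def P0_T Q1(2) Q2(2) T.add T_P0 P0.zero \<pi>.zero)
  moreover have "Q v \<in> U" for v
    unfolding Q_def using \<pi>(2) by (intro subspace_add[OF U(1)] P0_U Q1(3) Q2(3)) blast
  moreover have "Q u = u" if "u \<in> U" for u
    using sum[of u] that P0_U[OF that] by (simp add: Q_def \<pi>(3) P0_ker[OF T_P0] Q1(4) Q2(4))
  ultimately show "\<exists>Q. Vector_Spaces.linear scale scale Q \<and> (\<forall>v. Q (T v) = T (Q v)) \<and> (\<forall>v. Q v \<in> U) \<and> (\<forall>u\<in>U. Q u = u)"
    by blast
qed

end

section \<open>Modules over \<open>sl\<^sub>2\<close>\<close>

locale sl2_module = vector_space scale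
  for scale :: "'k::field_char_0 \<Rightarrow> 'v::ab_group_add \<Rightarrow> 'v" +
  fixes E F H :: "'v \<Rightarrow> 'v"
  assumes linear_E: "Vector_Spaces.linear scale scale E"
    and linear_F: "Vector_Spaces.linear scale scale F"
    and linear_H: "Vector_Spaces.linear scale scale H"
    and E_F: "E (F v) = F (E v) + H v"
    and H_E: "H (E v) = E (H v) + scale 2 (E v)"
    and H_F: "H (F v) = F (H v) - scale 2 (F v)"
begin

interpretation E: Vector_Spaces.linear scale scale E by (rule linear_E)
interpretation F: Vector_Spaces.linear scale scale F by (rule linear_F)
interpretation H: Vector_Spaces.linear scale scale H by (rule linear_H)

text \<open>Exchanges lowest and highest weight vectors, so that the statements below serve for
  both.\<close>

lemma dual: "sl2_module scale F E (\<lambda>v. - H v)"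
  by unfold_locales (auto simp: E_F H_E H_F E.neg F.neg H.add H.scale E.add F.add E.scale F.scale)

lemma weight_E_pow:
  assumes "H v = scale \<kappa> v"
  shows "H ((E ^^ n) v) = scale (\<kappa> + 2 * of_nat n) ((E ^^ n) v)"
proof (induction n)
  case (Suc n)
  then show ?case
    by (simp add: H_E E.scale flip: scale_left_distrib)
qed (simp add: assms)

text \<open>Moving \<open>F\<close> past the powers of \<open>E\<close> collects the weights
  \<open>\<kappa>\<close>, \<open>\<kappa> + 2\<close>, ..., \<open>\<kappa> + 2 n\<close>, whose
  sum is \<open>(n + 1) (\<kappa> + n)\<close>.\<close>

lemma F_E_pow:
  assumes "F v = 0" and v: "H v = scale \<kappa> v"
  shows "F ((E ^^ Suc n) v) = scale (- (of_nat (Suc n) * (\<kappa> + of_nat n))) ((E ^^ n) v)"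
proof (induction n)
  case 0
  have "F (E v) = E (F v) - H v" by (simp add: E_F)
  then show ?case using assms by simp
next
  case (Suc n)
  have "F ((E ^^ Suc (Suc n)) v) = E (F ((E ^^ Suc n) v)) - H ((E ^^ Suc n) v)"
    by (simp add: E_F)
  also have "\<dots> = scale (- (of_nat (Suc n) * (\<kappa> + of_nat n)) - (\<kappa> + 2 * of_nat (Suc n))) ((E ^^ Suc n) v)"
    unfolding Suc.IH weight_E_pow[OF v] by (simp only: E.scale scale_left_diff_distrib funpow.simps o_apply)
  also have "- (of_nat (Suc n) * (\<kappa> + of_nat n)) - (\<kappa> + 2 * of_nat (Suc n))
      = - (of_nat (Suc (Suc n)) * (\<kappa> + of_nat (Suc n)))"
    by (simp add: algebra_simps)
  finally show ?case .
qed

text \<open>\<open>F\<close> undoes each application of \<open>E\<close> up to a scalar that the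
  hypothesis on \<open>\<kappa>\<close> keeps nonzero, so the vanishing of \<open>E^N v\<close>
  descends to \<open>v\<close>.\<close>

lemma lowest_weight_vector_eq_0:
  assumes "F v = 0" "H v = scale \<kappa> v" "(E ^^ N) v = 0" "\<And>n. n < N \<Longrightarrow> \<kappa> + of_nat n \<noteq> 0"
  shows "v = 0"
  using assms(3,4)
proof (induction N)
  case (Suc n)
  have "scale (- (of_nat (Suc n) * (\<kappa> + of_nat n))) ((E ^^ n) v) = 0"
    using F_E_pow[OF assms(1,2), of n] Suc.prems(1) by simp
  moreover have "- (of_nat (Suc n) * (\<kappa> + of_nat n)) \<noteq> 0"
    using Suc.prems(2)[of n] by (simp del: of_nat_Suc)
  ultimately have "(E ^^ n) v = 0" by (simp only: scale_eq_0_iff) simp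
  then show ?case using Suc.IH Suc.prems(2) by simp
qed simp

text \<open>Local nilpotency takes the place of finite dimension. Lowering \<open>v\<close> as far
  as possible gives a lowest weight vector of weight \<open>\<kappa> - 2 m\<close>; were this not
  minus a natural number, no power of \<open>E\<close> could kill it.\<close>

lemma weight_integral:
  assumes "v \<noteq> 0" and v: "H v = scale \<kappa> v" and nil: "\<And>v. \<exists>n. (E ^^ n) v = 0" "\<And>v. \<exists>n. (F ^^ n) v = 0"
  shows "\<kappa> \<in> \<int>"
proof -
  interpret dual: sl2_module scale F E "\<lambda>v. - H v" by (rule dual)
  define n where "n = (LEAST n. (F ^^ n) v = 0)"
  have n: "(F ^^ n) v = 0" unfolding n_def using nil(2) by (rule LeastI_ex)
  then obtain m where m: "n = Suc m" using \<open>v \<noteq> 0\<close> by (cases n) auto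
  define w where "w = (F ^^ m) v"
  have "w \<noteq> 0" unfolding w_def using not_less_Least[of m "\<lambda>n. (F ^^ n) v = 0"] m by (simp add: n_def)
  have Fw: "F w = 0" using n m by (simp add: w_def)
  have "- H v = scale (- \<kappa>) v" using v by simp
  then have "- H w = scale (- \<kappa> + 2 * of_nat m) w"
    unfolding w_def by (rule dual.weight_E_pow)
  then have "H w = - scale (- \<kappa> + 2 * of_nat m) w"
    by (rule minus_equation_iff[THEN iffD1, symmetric])
  also have "\<dots> = scale (\<kappa> - 2 * of_nat m) w"
    by (simp only: scale_minus_left[symmetric]) simp
  finally have w: "H w = scale (\<kappa> - 2 * of_nat m) w" .
  obtain N where N: "(E ^^ N) w = 0" using nil(1) by blast
  have "\<exists>k<N. \<kappa> - 2 * of_nat m + of_nat k = 0"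
  proof (rule ccontr)
    assume *: "\<not> ?thesis"
    have "w = 0"
      by (rule lowest_weight_vector_eq_0[OF Fw w N]) (use * in blast)
    then show False using \<open>w \<noteq> 0\<close> by simp
  qed
  then obtain k where "\<kappa> - 2 * of_nat m + of_nat k = 0" by blast
  moreover have "\<kappa> = (\<kappa> - 2 * of_nat m + of_nat k) + of_int (2 * int m - int k)" by simp
  ultimately have "\<kappa> = of_int (2 * int m - int k)" by simp
  then show ?thesis by (simp only: Ints_of_int)
qed

end

text \<open>If \<open>F\<^sup>3 = 0\<close>, then commuting with \<open>E\<close> three times turns \<open>F\<^sup>3 = 0\<close> into a polynomial
  relation for \<open>H\<close>; hence \<open>H\<close> is diagonalisable, without complete reducibility.\<close>

locale sl2_module_cube_zero = sl2_module +
  assumes F_cube: "F (F (F v)) = 0"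
begin

interpretation E: Vector_Spaces.linear scale scale E by (rule linear_E)
interpretation F: Vector_Spaces.linear scale scale F by (rule linear_F)
interpretation H: Vector_Spaces.linear scale scale H by (rule linear_H)

lemma E_H: "E (H v) = H (E v) - (E v + E v)"
  using scale_left_distrib[of 1 1] by (simp add: H_E)

lemma H_F': "H (F v) = F (H v) - (F v + F v)"
  using scale_left_distrib[of 1 1] by (simp add: H_F)

lemmas ops = E.add F.add H.add E.diff F.diff H.diff E.neg F.neg H.neg

lemma numeral_scale_cancel: "scale (numeral n) v = 0 \<Longrightarrow> v = 0"
  by simp

lemma scale_numeral_unfold:
  "scale (numeral (Num.Bit0 n)) v = scale (numeral n) v + scale (numeral n) v"
  "scale (numeral (Num.Bit1 n)) v = scale (numeral n) v + scale (numeral n) v + v"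
  "scale (numeral Num.One) v = v"
  by (simp_all only: numeral_Bit0 numeral_Bit1 scale_left_distrib scale_one numeral_One)

text \<open>The commutator of \<open>E\<close> with \<open>F^3 = 0\<close> is
  \<open>3 (F^2 H - 2 F^2)\<close>. Commuting \<open>E\<close> with this relation yields
  \<open>FFE\<close>, and once more \<open>cubic_H\<close>.\<close>

lemma FFH: "F (F (H v)) = F (F v) + F (F v)"
proof -
  have "E (F (F (F v))) - F (F (F (E v))) = 0" by (simp only: F_cube E.zero) simp
  then have "scale 3 (F (F (H v)) - (F (F v) + F (F v))) = 0"
    by (simp add: E_F H_F' ops scale_numeral_unfold algebra_simps)
  then show ?thesis by simp
qed

lemma FFE: "F (F (E v)) = F (H (H v)) - scale 3 (F (H v)) + scale 2 (F v)"
proof -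
  have "E (F (F (H v))) = E (F (F v) + F (F v))" by (simp only: FFH)
  then have "scale 2 (F (F (E v)) - (F (H (H v)) - scale 3 (F (H v)) + scale 2 (F v))) = 0"
    using FFH[of "E v"]
    by (simp add: E_F E_H H_F' ops scale_numeral_unfold algebra_simps)
  then show ?thesis by simp
qed

lemma cubic_H: "H (H (H v)) - scale 3 (H (H v)) + scale 2 (H v) = scale 6 (F (E (H v)))"
proof -
  have "E (F (F (E v))) = E (F (H (H v)) - scale 3 (F (H v)) + scale 2 (F v))" by (simp only: FFE)
  then show ?thesis
    using FFE[of "E v"]
    by (simp add: E_F E_H H_F' ops scale_numeral_unfold algebra_simps)
qed

text \<open>Applying \<open>F\<close> to \<open>cubic_H\<close> gives \<open>?Q = 6 ?Q\<close>,
  because \<open>FFE\<close> turns \<open>F^2 E H\<close> back into \<open>?Q\<close>.\<close>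

lemma F_cubic_H: "F (H (H (H v))) - scale 3 (F (H (H v))) + scale 2 (F (H v)) = 0" (is "?Q = 0")
proof -
  have "F (H (H (H v)) - scale 3 (H (H v)) + scale 2 (H v)) = F (scale 6 (F (E (H v))))"
    by (simp only: cubic_H)
  then have "?Q = scale 6 ?Q"
    using FFE[of "H v"] by (simp add: F.add F.diff F.scale)
  then have "scale 5 ?Q = 0"
    by (simp add: scale_numeral_unfold algebra_simps)
  then show ?thesis by (rule numeral_scale_cancel)
qed

lemma quintic_H:
  "fold (\<lambda>\<mu> v. H v - scale \<mu> v) [-2, -1, 0, 1, 2] v = 0"
proof -
  \<comment> \<open>This is \<open>(H + 1) (H + 2) v\<close>. Moving \<open>E\<close> to the right
    across \<open>H\<close> shifts \<open>H\<close> by -2, so \<open>E H (H + 1) (H + 2)\<close>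
    becomes \<open>H (H - 1) (H - 2) E\<close>, which \<open>F_cubic_H\<close> kills after applying
    \<open>F\<close>. The left side of \<open>cubic_H\<close> supplies the remaining factor
    \<open>H (H - 1) (H - 2)\<close>.\<close>
  let ?w = "H (H v) + scale 3 (H v) + scale 2 v"
  have "scale 6 (F (E (H ?w))) = 0"
    using F_cubic_H[of "E v"] 
    by (simp add: E_F E_H ops scale_numeral_unfold algebra_simps)
  then have "H (H (H ?w)) - scale 3 (H (H ?w)) + scale 2 (H ?w) = 0"
    by (simp only: cubic_H)
  then show ?thesis
    by (simp add: H.scale H.add H.diff ops scale_numeral_unfold algebra_simps)
qed

lemma sum_of_weight_vectors:
  "\<exists>w. v = (\<Sum>\<mu>\<in>{-2, -1, 0, 1, 2}. w \<mu>) \<and> (\<forall>\<mu>\<in>{-2, -1, 0, 1, 2}. H (w \<mu>) = scale \<mu> (w \<mu>))"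
  using sum_of_eigenvectors_if_fold_eq_0[OF linear_H _ quintic_H, of v] by simp

lemma weight_cases:
  assumes "v \<noteq> 0" "H v = scale \<kappa> v"
  shows "\<kappa> \<in> {-2, -1, 0, 1, 2}"
proof -
  have "fold (\<lambda>\<mu> v. H v - scale \<mu> v) \<mu>s (scale c v) = scale (c * prod_list (map (\<lambda>\<mu>. \<kappa> - \<mu>) \<mu>s)) v" for c \<mu>s
    using assms(2) by (induction \<mu>s arbitrary: c)
      (auto simp: H.scale algebra_simps simp flip: scale_left_diff_distrib)
  from this[of "[-2, -1, 0, 1, 2]" 1] quintic_H[of v] show ?thesis
    using \<open>v \<noteq> 0\<close> by (auto simp: eq_neg_iff_add_eq_0)
qed

end

section \<open>Extremality of lowest root vectors\<close>

context lie_algebra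
begin

interpretation left: Vector_Spaces.linear scale scale "\<lambda>a. bracket a b" for b
  by (rule linear_bracket_left)
interpretation right: Vector_Spaces.linear scale scale "bracket a" for a
  by (rule linear_bracket_right)

lemmas bracket_add_left = left.add and bracket_add_right = right.add
lemmas bracket_diff_left = left.diff and bracket_diff_right = right.diff
lemmas bracket_scale_left = left.scale and bracket_scale_right = right.scale
lemmas bracket_minus_left = left.neg and bracket_minus_right = right.neg
lemmas bracket_zero_left [simp] = left.zero and bracket_zero_right [simp] = right.zero
lemmas bracket_sum_left = left.sum and bracket_sum_right = right.sum

lemma bracket_swap: "bracket a b = - bracket b a"
proof -
  have "bracket (a + b) (a + b) = bracket a b + bracket b a"
    by (subst bracket_add_left, subst (1 2) bracket_add_right) (simp add: bracket_self)
  then have "bracket a b + bracket b a = 0"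
    by (simp only: bracket_self)
  then show ?thesis by (simp add: eq_neg_iff_add_eq_0)
qed

lemma bracket_bracket_right: "bracket a (bracket b c) = bracket (bracket a b) c + bracket b (bracket a c)"
proof -
  have "bracket b (bracket c a) = - bracket b (bracket a c)"
    by (simp add: bracket_swap[of c a] bracket_minus_right)
  moreover have "bracket c (bracket a b) = - bracket (bracket a b) c"
    by (rule bracket_swap)
  ultimately show ?thesis
    using jacobi[of a b c] by (simp add: algebra_simps)
qed

lemma bracket_bracket_left: "bracket (bracket a b) c = bracket a (bracket b c) - bracket b (bracket a c)"
  using bracket_bracket_right[of a b c] by simp

lemma bracket_root_spaces:
  assumes "v \<in> root_space scale bracket H \<beta>" "w \<in> root_space scale bracket H \<gamma>"
  shows "bracket v w \<in> root_space scale bracket H (\<lambda>h. \<beta> h + \<gamma> h)"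
  using assms
  by (auto simp: root_space_def bracket_bracket_right[of _ v w] bracket_scale_left bracket_scale_right
      scale_left_distrib)

end

lemma sl2_module_ad:
  fixes scale :: "'k::field_char_0 \<Rightarrow> 'g::ab_group_add \<Rightarrow> 'g"
  assumes "lie_algebra scale br" and "br e f = h" "br h e = scale 2 e" "br h f = - scale 2 f"
  shows "sl2_module scale (br e) (br f) (br h)"
proof -
  interpret lie_algebra scale br by fact
  show ?thesis
    by unfold_locales
      (simp_all add: bracket_add_right bracket_scale_right bracket_bracket_right[of e f]
        bracket_bracket_right[of h e] bracket_bracket_right[of h f] assms(2-) bracket_scale_left
        bracket_minus_left add.commute)
qed

text \<open>What is used of a Cartan subalgebra \<open>H\<close>: a finite basis of common
  eigenvectors, and that \<open>H\<close> contains its centralizer. \<open>wt b\<close> carries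
  meaning on \<open>H\<close> only, like the functions that represent roots.\<close>

locale weight_decomposition = lie_algebra scale br
  for scale :: "'k::field_char_0 \<Rightarrow> 'g::ab_group_add \<Rightarrow> 'g" and br +
  fixes H B :: "'g set" and wt :: "'g \<Rightarrow> 'g \<Rightarrow> 'k"
  assumes finite_B: "finite B" and independent_B: "independent B" and span_B: "span B = UNIV"
    and br_B: "b \<in> B \<Longrightarrow> h \<in> H \<Longrightarrow> br h b = scale (wt b h) b"
    and centralizer_H: "(\<And>h. h \<in> H \<Longrightarrow> br h v = 0) \<Longrightarrow> v \<in> H"
begin

abbreviation "coord v b \<equiv> representation B v b"

lemma sum_coord: "(\<Sum>b\<in>B. scale (coord v b) b) = v"
  using sum_representation_eq[OF independent_B _ finite_B, of v] span_B by simp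

lemma coord_add: "coord (v + w) b = coord v b + coord w b"
  using representation_add[OF independent_B] span_B by simp

lemma coord_diff: "coord (v - w) b = coord v b - coord w b"
  using representation_diff[OF independent_B] span_B by simp

lemma coord_scale: "coord (scale c v) b = c * coord v b"
  using representation_scale[OF independent_B] span_B by simp

lemma coord_sum: "coord (sum v I) b = (\<Sum>i\<in>I. coord (v i) b)"
  using representation_sum[OF independent_B, of I v] span_B by simp

lemma coord_basis: "c \<in> B \<Longrightarrow> coord c b = (if b = c then 1 else 0)"
  using representation_basis[OF independent_B] by simp

lemma coord_bracket:
  assumes h: "h \<in> H" and b: "b \<in> B"
  shows "coord (br h v) b = wt b h * coord v b"
proof -
  have "br h v = (\<Sum>c\<in>B. scale (coord v c) (br h c))"
    by (subst sum_coord[symmetric]) (simp add: bracket_sum_right bracket_scale_right)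
  also have "\<dots> = (\<Sum>c\<in>B. scale (coord v c * wt c h) c)"
    using br_B h by simp
  finally have "coord (br h v) b = (\<Sum>c\<in>B. coord v c * wt c h * coord c b)"
    by (simp add: coord_sum coord_scale)
  also have "\<dots> = (\<Sum>c\<in>B. if b = c then coord v c * wt c h else 0)"
    by (intro sum.cong) (auto simp: coord_basis)
  finally show ?thesis using b finite_B by (simp add: mult.commute)
qed

abbreviation "RS \<equiv> root_space scale br H"

lemma coord_root_space:
  assumes "v \<in> RS \<beta>" "b \<in> B" "coord v b \<noteq> 0" "h \<in> H"
  shows "wt b h = \<beta> h"
  using coord_bracket[OF assms(4,2), of v] assms by (simp add: root_space_def coord_scale)

lemma root_space_weight:
  assumes "v \<in> RS \<beta>" "v \<noteq> 0"
  obtains b where "b \<in> B" "\<forall>h\<in>H. wt b h = \<beta> h"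
proof -
  have "(\<Sum>b\<in>B. scale (coord v b) b) = 0" if "\<forall>b\<in>B. coord v b = 0"
    using that by (intro sum.neutral) simp
  then obtain b where "b \<in> B" "coord v b \<noteq> 0"
    using \<open>v \<noteq> 0\<close> unfolding sum_coord by blast
  then show thesis using coord_root_space[OF assms(1)] by (intro that[of b] ballI)
qed

lemma B_root_space: "b \<in> B \<Longrightarrow> b \<in> RS (wt b)"
  by (simp add: root_space_def br_B)

lemma subspace_root_space: "subspace (RS \<beta>)"
  by (auto simp: subspace_def root_space_def bracket_add_right bracket_scale_right scale_right_distrib mult.commute)

lemma root_space_cong: "(\<And>h. h \<in> H \<Longrightarrow> \<beta> h = \<gamma> h) \<Longrightarrow> RS \<beta> = RS \<gamma>"
  by (simp add: root_space_def)

lemma root_space_zero: "(\<And>h. h \<in> H \<Longrightarrow> \<beta> h = 0) \<Longrightarrow> v \<in> RS \<beta> \<Longrightarrow> v \<in> H"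
  using centralizer_H by (simp add: root_space_def)

definition proj :: "('g \<Rightarrow> 'k) \<Rightarrow> 'g \<Rightarrow> 'g" where
  "proj \<beta> v = (\<Sum>b\<in>B. if (\<forall>h\<in>H. wt b h = \<beta> h) then scale (coord v b) b else 0)"

lemma proj_in_root_space: "proj \<beta> v \<in> RS \<beta>"
  unfolding proj_def
proof (intro subspace_sum[OF subspace_root_space])
  fix b assume b: "b \<in> B"
  show "(if (\<forall>h\<in>H. wt b h = \<beta> h) then scale (coord v b) b else 0) \<in> RS \<beta>"
    using br_B[OF b] subspace_0[OF subspace_root_space]
    by (auto simp: root_space_def bracket_scale_right mult.commute)
qed

lemma proj_add: "proj \<beta> (v + w) = proj \<beta> v + proj \<beta> w"
  by (simp add: proj_def coord_add scale_left_distrib if_distrib flip: sum.distrib cong: if_cong)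

lemma proj_scale: "proj \<beta> (scale c v) = scale c (proj \<beta> v)"
  by (auto simp: proj_def coord_scale scale_sum_right intro!: sum.cong)

lemma proj_sum: "proj \<beta> (sum v I) = (\<Sum>i\<in>I. proj \<beta> (v i))"
proof (induction I rule: infinite_finite_induct)
  case (infinite I)
  then show ?case using proj_scale[of \<beta> 0 0] by simp
next
  case empty
  then show ?case using proj_scale[of \<beta> 0 0] by simp
qed (simp add: proj_add)

lemma proj_root_space:
  assumes "v \<in> RS \<gamma>"
  shows "proj \<beta> v = (if (\<forall>h\<in>H. \<gamma> h = \<beta> h) then v else 0)"
proof -
  have "(if (\<forall>h\<in>H. wt b h = \<beta> h) then scale (coord v b) b else 0) =
      (if (\<forall>h\<in>H. \<gamma> h = \<beta> h) then scale (coord v b) b else 0)" if "b \<in> B" for b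
    using coord_root_space[OF assms that] by (cases "coord v b = 0") auto
  then have "proj \<beta> v = (\<Sum>b\<in>B. if (\<forall>h\<in>H. \<gamma> h = \<beta> h) then scale (coord v b) b else 0)"
    unfolding proj_def by (intro sum.cong) auto
  then show ?thesis using sum_coord[of v] by (cases "\<forall>h\<in>H. \<gamma> h = \<beta> h") auto
qed

text \<open>Bracketing with \<open>f\<close> shifts every weight by \<open>\<alpha>\<close>, so it
  commutes with taking components up to this shift. Hence the relations of a triple pass to its
  components.\<close>

lemma proj_bracket:
  assumes f: "f \<in> RS \<alpha>"
  shows "proj (\<lambda>h. \<beta> h + \<alpha> h) (br v f) = br (proj \<beta> v) f"
proof -
  have "proj (\<lambda>h. \<beta> h + \<alpha> h) (br v f) = (\<Sum>b\<in>B. scale (coord v b) (proj (\<lambda>h. \<beta> h + \<alpha> h) (br b f)))"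
    by (subst (1) sum_coord[of v, symmetric])
      (simp add: bracket_sum_left bracket_scale_left proj_sum proj_scale)
  also have "\<dots> = (\<Sum>b\<in>B. br (if (\<forall>h\<in>H. wt b h = \<beta> h) then scale (coord v b) b else 0) f)"
  proof (intro sum.cong refl)
    fix b assume "b \<in> B"
    have "proj (\<lambda>h. \<beta> h + \<alpha> h) (br b f) = (if (\<forall>h\<in>H. wt b h = \<beta> h) then br b f else 0)"
      by (subst proj_root_space[OF bracket_root_spaces[OF B_root_space[OF \<open>b \<in> B\<close>] f]]) simp
    then show "scale (coord v b) (proj (\<lambda>h. \<beta> h + \<alpha> h) (br b f)) =
        br (if (\<forall>h\<in>H. wt b h = \<beta> h) then scale (coord v b) b else 0) f"
      by (simp add: bracket_scale_left)
  qed
  also have "\<dots> = br (proj \<beta> v) f"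
    by (simp add: proj_def bracket_sum_left)
  finally show ?thesis .
qed

text \<open>The Cartan and opposite root components of any \<open>sl\<^sub>2\<close>-triple through a root vector again
  form an \<open>sl\<^sub>2\<close>-triple.\<close>

lemma adapted_sl2_triple:
  assumes f: "f \<in> RS \<alpha>" "f \<noteq> 0" and triple: "sl2_triple scale br f x e"
  obtains x' e' where "sl2_triple scale br f x' e'" "x' \<in> H" "\<alpha> x' = -1" "e' \<in> RS (\<lambda>h. - \<alpha> h)" "e' \<noteq> 0"
proof -
  define x' where "x' = proj (\<lambda>_. 0) x"
  define e' where "e' = proj (\<lambda>h. - \<alpha> h) e"
  have t: "br e f = scale 2 x" "br x f = - f" using triple by (auto simp: sl2_triple_def)
  have x'RS: "x' \<in> RS (\<lambda>_. 0)" unfolding x'_def by (rule proj_in_root_space)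
  then have x'H: "x' \<in> H" by (rule root_space_zero[rotated]) simp
  have e'RS: "e' \<in> RS (\<lambda>h. - \<alpha> h)" unfolding e'_def by (rule proj_in_root_space)
  have f': "proj \<alpha> f = f" using proj_root_space[OF f(1), of \<alpha>] by simp
  have x'f: "br x' f = - f"
    using proj_bracket[OF f(1), of "\<lambda>_. 0" x] f' proj_scale[of \<alpha> "-1" f] by (simp add: x'_def t)
  then have "scale (\<alpha> x') f = scale (-1) f"
    using f(1) x'H by (simp add: root_space_def)
  then have ax': "\<alpha> x' = -1" using f(2) by (simp only: scale_cancel_right) simp
  have "br e' f = scale 2 x'"
    using proj_bracket[OF f(1), of "\<lambda>h. - \<alpha> h" e] by (simp add: x'_def e'_def t proj_scale)
  moreover have "br x' e' = e'"
    using e'RS x'H ax' by (simp add: root_space_def)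
  moreover have "e' \<noteq> 0"
  proof
    assume "e' = 0"
    then have "scale 2 x' = 0" using \<open>br e' f = scale 2 x'\<close> by simp
    then have "x' = 0" by simp
    then show False using x'f f(2) by simp
  qed
  ultimately show ?thesis
    using that[of x' e'] x'f x'H ax' e'RS by (simp add: sl2_triple_def)
qed

text \<open>Evaluated at \<open>x\<close>, the weights met when applying \<open>e\<close> repeatedly
  are pairwise distinct in characteristic 0, while \<open>B\<close> has only finitely many.\<close>

lemma root_vector_nilpotent:
  assumes e: "e \<in> RS \<beta>" and x: "x \<in> H" "\<beta> x \<noteq> 0"
  shows "\<exists>n. (br e ^^ n) v = 0"
proof -
  have pow: "(br e ^^ n) v \<in> RS (\<lambda>h. \<gamma> h + of_nat n * \<beta> h)" if "v \<in> RS \<gamma>" for n v \<gamma>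
  proof (induction n)
    case (Suc n)
    have "RS (\<lambda>h. \<beta> h + (\<gamma> h + of_nat n * \<beta> h)) = RS (\<lambda>h. \<gamma> h + of_nat (Suc n) * \<beta> h)"
      by (rule root_space_cong) (simp add: algebra_simps)
    then show ?case using bracket_root_spaces[OF e Suc.IH] by simp
  qed (use that in simp)
  have basis: "\<exists>n. (br e ^^ n) b = 0" if b: "b \<in> B" for b
  proof (rule ccontr)
    assume *: "\<nexists>n. (br e ^^ n) b = 0"
    have "wt b x + of_nat n * \<beta> x \<in> (\<lambda>b. wt b x) ` B" for n
    proof -
      have nz: "(br e ^^ n) b \<noteq> 0" using * by blast
      obtain b' where "b' \<in> B" "\<forall>h\<in>H. wt b' h = wt b h + of_nat n * \<beta> h"
        using root_space_weight[OF pow[OF B_root_space[OF b]] nz] .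
      then show ?thesis using x(1) by (intro image_eqI[of _ _ b']) simp_all
    qed
    then have "range (\<lambda>n. wt b x + of_nat n * \<beta> x) \<subseteq> (\<lambda>b. wt b x) ` B" by auto
    then have "finite (range (\<lambda>n. wt b x + of_nat n * \<beta> x))"
      using finite_imageI[OF finite_B] by (rule finite_subset)
    moreover have "inj (\<lambda>n. wt b x + of_nat n * \<beta> x)"
      using x(2) by (auto simp: inj_on_def)
    ultimately show False by (simp add: finite_image_iff)
  qed
  have "v \<in> span B" using span_B by simp
  then show ?thesis
  proof (induction rule: span_induct_alt)
    case base
    show ?case by (intro exI[of _ 0]) simp
  next
    case (step c b w)
    obtain m where m: "(br e ^^ m) b = 0" using basis[OF step(1)] by (rule exE)
    obtain n where n: "(br e ^^ n) w = 0" using step(2) by (rule exE)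
    have zero: "(br e ^^ k) 0 = 0" for k by (induction k) auto
    have add: "(br e ^^ k) (scale c b + w) = scale c ((br e ^^ k) b) + (br e ^^ k) w" for k
      by (induction k) (auto simp: bracket_add_right bracket_scale_right)
    have "(br e ^^ (n + m)) b = 0" "(br e ^^ (m + n)) w = 0"
      unfolding funpow_add by (simp_all add: m n zero)
    then have "(br e ^^ (n + m)) (scale c b + w) = 0"
      unfolding add by (simp add: add.commute)
    then show ?case by blast
  qed
qed

section \<open>The Killing form\<close>

definition trace :: "('g \<Rightarrow> 'g) \<Rightarrow> 'k" where
  "trace T = (\<Sum>b\<in>B. coord (T b) b)"

lemma trace_commute:
  assumes "Vector_Spaces.linear scale scale S" "Vector_Spaces.linear scale scale T"
  shows "trace (\<lambda>v. S (T v)) = trace (\<lambda>v. T (S v))"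
proof -
  have expand: "coord (S v) b = (\<Sum>c\<in>B. coord v c * coord (S c) b)"
    if "Vector_Spaces.linear scale scale S" for S v b
  proof -
    interpret Vector_Spaces.linear scale scale S by fact
    show ?thesis
      by (subst sum_coord[of v, symmetric]) (simp add: sum scale coord_sum coord_scale)
  qed
  have "trace (\<lambda>v. S (T v)) = (\<Sum>b\<in>B. \<Sum>c\<in>B. coord (T b) c * coord (S c) b)"
    by (simp add: trace_def expand[OF assms(1), of "T _"])
  also have "\<dots> = (\<Sum>c\<in>B. \<Sum>b\<in>B. coord (S c) b * coord (T b) c)"
    by (subst sum.swap) (simp add: mult.commute)
  also have "\<dots> = trace (\<lambda>v. T (S v))"
    by (simp add: trace_def expand[OF assms(2), of "S _"])
  finally show ?thesis .
qed

lemma trace_diff: "trace (\<lambda>v. S v - T v) = trace S - trace T"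
  by (simp add: trace_def coord_diff sum_subtractf)

definition killing :: "'g \<Rightarrow> 'g \<Rightarrow> 'k" where
  "killing v w = trace (\<lambda>u. br v (br w u))"

lemma killing_add_left: "killing (v + v') w = killing v w + killing v' w"
  by (simp add: killing_def trace_def bracket_add_left coord_add sum.distrib)

lemma killing_scale_left: "killing (scale c v) w = c * killing v w"
  by (simp add: killing_def trace_def bracket_scale_left coord_scale sum_distrib_left)

lemma killing_scale_right: "killing v (scale c w) = c * killing v w"
  by (simp add: killing_def trace_def bracket_scale_left bracket_scale_right coord_scale sum_distrib_left)

lemma killing_sum_right: "killing v (sum w I) = (\<Sum>i\<in>I. killing v (w i))"
  by (simp add: killing_def trace_def bracket_sum_left bracket_sum_right coord_sum)
    (rule sum.swap)

lemma killing_invariant: "killing (br a b) c = killing a (br b c)"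
proof -
  have lin: "Vector_Spaces.linear scale scale (\<lambda>v. br a (br c v))"
    by (rule Vector_Spaces.linear_compose[OF linear_bracket_right linear_bracket_right, unfolded o_def])
  have "killing (br a b) c = trace (\<lambda>v. br a (br b (br c v))) - trace (\<lambda>v. br b (br a (br c v)))"
    by (simp add: killing_def bracket_bracket_left[of a b] trace_diff)
  also have "trace (\<lambda>v. br b (br a (br c v))) = trace (\<lambda>v. br a (br c (br b v)))"
    by (rule trace_commute[OF linear_bracket_right lin])
  also have "trace (\<lambda>v. br a (br b (br c v))) - \<dots> = killing a (br b c)"
    by (simp add: killing_def bracket_bracket_left[of b c] bracket_diff_right trace_diff)
  finally show ?thesis .
qed

lemma killing_root_spaces:
  assumes "v \<in> RS \<beta>" "w \<in> RS \<gamma>" "killing v w \<noteq> 0" "h \<in> H"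
  shows "\<gamma> h = - \<beta> h"
proof -
  have "killing (br v h) w = killing v (br h w)" by (rule killing_invariant)
  moreover have "br v h = scale (- \<beta> h) v"
    using assms(1,4) by (subst bracket_swap) (simp add: root_space_def)
  moreover have "br h w = scale (\<gamma> h) w" using assms(2,4) by (simp add: root_space_def)
  ultimately have "- \<beta> h * killing v w = \<gamma> h * killing v w"
    by (simp only: killing_scale_left killing_scale_right)
  then show ?thesis using assms(3) by (simp only: mult_cancel_right) simp
qed

lemma killing_cartan: "h \<in> H \<Longrightarrow> killing h h = (\<Sum>b\<in>B. (wt b h)\<^sup>2)"
  by (simp add: killing_def trace_def coord_bracket coord_basis power2_eq_square)

text \<open>The radical is an ideal, so by simplicity one nonzero value suffices. For
  \<open>x'\<close>, which acts diagonally on \<open>B\<close>, 4 times the value at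
  \<open>(x', x')\<close> is a sum of squares of integers; integrality substitutes for the order
  that the field lacks.\<close>

lemma killing_nondegenerate:
  assumes simple: "simple_lie_algebra scale br" and f: "f \<in> RS \<alpha>" "f \<noteq> 0"
    and triple: "sl2_triple scale br f x e" and "v \<noteq> 0"
  obtains w where "killing v w \<noteq> 0"
proof -
  obtain x' e' where t: "sl2_triple scale br f x' e'" "x' \<in> H" "\<alpha> x' = -1" "e' \<in> RS (\<lambda>h. - \<alpha> h)" "e' \<noteq> 0"
    using adapted_sl2_triple[OF f triple] .
  interpret sl2: sl2_module scale "br e'" "br f" "br (scale 2 x')"
    by (rule sl2_module_ad)
      (use t(1) in \<open>auto simp: sl2_triple_def bracket_scale_left lie_algebra_axioms\<close>)
  have "wt b (x') * 2 \<in> \<int>" if "b \<in> B" for b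
  proof (rule sl2.weight_integral)
    show "b \<noteq> 0" using that independent_B dependent_zero by blast
    show "br (scale 2 x') b = scale (wt b x' * 2) b"
      using br_B[OF that t(2)] by (simp add: bracket_scale_left mult.commute)
    show "\<exists>n. (br e' ^^ n) v = 0" "\<exists>n. (br f ^^ n) v = 0" for v
      using root_vector_nilpotent[OF t(4,2)] root_vector_nilpotent[OF f(1) t(2)] t(3) by simp_all
  qed
  then have "\<forall>b\<in>B. \<exists>m. wt b x' * 2 = of_int m" by (auto elim: Ints_cases)
  then obtain m where m: "\<And>b. b \<in> B \<Longrightarrow> wt b x' * 2 = of_int (m b)" by metis
  obtain b where b: "b \<in> B" "\<forall>h\<in>H. wt b h = \<alpha> h" using root_space_weight[OF f] .
  \<comment> \<open>The weight -2 of \<open>f\<close> makes one of the squares positive.\<close>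
  have "of_int (m b) = (of_int (-2) :: 'k)" using m[OF b(1)] b(2) t(2) t(3) by simp
  then have "m b = -2" by (simp only: of_int_eq_iff)
  then have "(\<Sum>b\<in>B. (m b)\<^sup>2) > 0"
    using b(1) finite_B by (intro sum_pos2[of B b]) auto
  have "4 * killing x' x' = (\<Sum>b\<in>B. (wt b x' * 2)\<^sup>2)"
    by (simp add: killing_cartan[OF t(2)] sum_distrib_left power_mult_distrib mult.commute)
  also have "\<dots> = of_int (\<Sum>b\<in>B. (m b)\<^sup>2)" using m by simp
  also have "\<dots> \<noteq> 0" using \<open>(\<Sum>b\<in>B. (m b)\<^sup>2) > 0\<close> by (simp only: of_int_eq_0_iff)
  finally have "killing x' x' \<noteq> 0" by auto
  let ?R = "{v. \<forall>w. killing v w = 0}"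
  have "lie_ideal scale br ?R"
    unfolding lie_ideal_def
  proof (intro conjI allI ballI)
    show "subspace ?R"
      using killing_scale_left[of 0 0] by (auto simp: subspace_def killing_add_left killing_scale_left)
    fix a b assume "b \<in> ?R"
    have "killing (br a b) w = - killing b (br a w)" for w
      using killing_scale_left[of "-1" "br b a" w]
      by (simp add: bracket_swap[of a b] killing_invariant)
    then show "br a b \<in> ?R" using \<open>b \<in> ?R\<close> by simp
  qed
  then have "?R = {0} \<or> ?R = UNIV" using simple by (simp add: simple_lie_algebra_def)
  then have "v \<notin> ?R" using \<open>killing x' x' \<noteq> 0\<close> \<open>v \<noteq> 0\<close> by auto
  then show ?thesis using that by blast
qed

text \<open>A root vector for \<open>\<beta>\<close> pairs nontrivially with some basis vector, and
  invariance of the form leaves only the weight \<open>- \<beta>\<close> for it.\<close>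

lemma neg_root:
  assumes simple: "simple_lie_algebra scale br" and f: "f \<in> RS \<alpha>" "f \<noteq> 0"
    and triple: "sl2_triple scale br f x e" and \<beta>: "is_root scale br H \<beta>"
  shows "is_root scale br H (\<lambda>h. - \<beta> h)"
proof -
  obtain v where v: "v \<in> RS \<beta>" "v \<noteq> 0" using \<beta> by (auto simp: is_root_def)
  obtain w where w: "killing v w \<noteq> 0" using killing_nondegenerate[OF simple f triple v(2)] .
  have "killing v w = (\<Sum>b\<in>B. coord w b * killing v b)"
    by (subst sum_coord[of w, symmetric]) (simp only: killing_sum_right killing_scale_right)
  moreover have "(\<Sum>b\<in>B. coord w b * killing v b) = 0" if "\<forall>b\<in>B. killing v b = 0"
    using that by (intro sum.neutral) simp
  ultimately obtain b where b: "b \<in> B" "killing v b \<noteq> 0" using w by fastforce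
  have "wt b h = - \<beta> h" if "h \<in> H" for h
    by (rule killing_root_spaces[OF v(1) B_root_space[OF b(1)] b(2) that])
  then have "b \<in> RS (\<lambda>h. - \<beta> h)" using b(1) by (simp add: root_space_def br_B)
  moreover have "b \<noteq> 0" using b(1) independent_B dependent_zero by blast
  ultimately show ?thesis using \<beta> by (auto simp: is_root_def)
qed

text \<open>By independence of the base the two coefficient families add up to 0, and natural
  numbers cannot cancel in characteristic 0.\<close>

lemma nat_combination_antisym:
  assumes "root_base scale br H \<Delta>" "nat_combination H \<Delta> \<mu>" "nat_combination H \<Delta> (\<lambda>h. - \<mu> h)" "h \<in> H"
  shows "\<mu> h = 0"
proof -
  obtain c d :: "('g \<Rightarrow> 'k) \<Rightarrow> nat"
    where c: "\<And>h. h \<in> H \<Longrightarrow> \<mu> h = (\<Sum>\<delta>\<in>\<Delta>. of_nat (c \<delta>) * \<delta> h)"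
      and d: "\<And>h. h \<in> H \<Longrightarrow> - \<mu> h = (\<Sum>\<delta>\<in>\<Delta>. of_nat (d \<delta>) * \<delta> h)"
    using assms(2,3) unfolding nat_combination_def by blast
  have "(\<Sum>\<delta>\<in>\<Delta>. of_nat (c \<delta> + d \<delta>) * \<delta> h) = 0" if "h \<in> H" for h
  proof -
    have "(\<Sum>\<delta>\<in>\<Delta>. of_nat (c \<delta> + d \<delta>) * \<delta> h) =
        (\<Sum>\<delta>\<in>\<Delta>. of_nat (c \<delta>) * \<delta> h) + (\<Sum>\<delta>\<in>\<Delta>. of_nat (d \<delta>) * \<delta> h)"
      by (simp add: distrib_right sum.distrib)
    also have "\<dots> = 0" unfolding c[OF that, symmetric] d[OF that, symmetric] by simp
    finally show ?thesis .
  qed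
  moreover have "\<forall>a :: ('g \<Rightarrow> 'k) \<Rightarrow> 'k. (\<forall>h\<in>H. (\<Sum>\<delta>\<in>\<Delta>. a \<delta> * \<delta> h) = 0) \<longrightarrow> (\<forall>\<delta>\<in>\<Delta>. a \<delta> = 0)"
    using assms(1) unfolding root_base_def by (elim conjE)
  note this[THEN spec, of "\<lambda>\<delta>. of_nat (c \<delta> + d \<delta>)"]
  ultimately have "\<forall>\<delta>\<in>\<Delta>. (of_nat (c \<delta> + d \<delta>) :: 'k) = 0" by blast
  then have "\<forall>\<delta>\<in>\<Delta>. c \<delta> = 0" by (simp only: of_nat_eq_0_iff) simp
  then show ?thesis using c[OF assms(4)] by simp
qed

lemma lowest_root_vector_extremal:
  assumes simple: "simple_lie_algebra scale br" and f: "f \<in> RS \<alpha>" "f \<noteq> 0"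
    and triple: "sl2_triple scale br f x e"
    and base: "root_base scale br H \<Delta>" and lowest: "lowest_root scale br H \<Delta> \<alpha>"
  shows "\<exists>c. br f (br f y) = scale c f"
proof -
  note neg = neg_root[OF simple f triple]
  have \<alpha>: "is_root scale br H \<alpha>" and le: "nat_combination H \<Delta> (\<lambda>h. \<beta> h - \<alpha> h)"
    if "is_root scale br H \<beta>" for \<beta>
    using lowest that by (auto simp: lowest_root_def)
  have cong: "nat_combination H \<Delta> \<mu> \<longleftrightarrow> nat_combination H \<Delta> \<nu>" if "\<And>h. h \<in> H \<Longrightarrow> \<mu> h = \<nu> h" for \<mu> \<nu>
    using that by (simp add: nat_combination_def)
  have basis: "br f (br f b) \<in> span {f}" if b: "b \<in> B" for b
  proof (cases "br f (br f b) = 0")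
    case False
    define \<beta> where "\<beta> = wt b"
    have fb: "br f b \<in> RS (\<lambda>h. \<alpha> h + \<beta> h)"
      unfolding \<beta>_def by (rule bracket_root_spaces[OF f(1) B_root_space[OF b]])
    have ffb: "br f (br f b) \<in> RS (\<lambda>h. \<alpha> h + (\<alpha> h + \<beta> h))"
      by (rule bracket_root_spaces[OF f(1) fb])
    have cartan: "br f h \<in> span {f}" if "h \<in> H" for h
    proof -
      have "br f h = scale (- \<alpha> h) f"
        using f(1) that by (subst bracket_swap) (simp add: root_space_def)
      then show ?thesis by (simp only: span_scale span_base insertI1)
    qed
    have "b \<noteq> 0" using b independent_B dependent_zero by blast
    then have root: "is_root scale br H \<beta>" if "\<exists>h\<in>H. \<beta> h \<noteq> 0"
      using that B_root_space[OF b] unfolding is_root_def \<beta>_def by (intro conjI exI[of _ b])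
    \<comment> \<open>In the first two cases \<open>b\<close> or \<open>[f, b]\<close> lies in
      \<open>H\<close>, and \<open>f\<close> sends elements of \<open>H\<close> into its own line.
      Only the third needs the order on roots.\<close>
    consider "\<forall>h\<in>H. \<beta> h = 0" | "\<forall>h\<in>H. \<alpha> h + \<beta> h = 0" |
      "is_root scale br H \<beta>" "\<exists>h\<in>H. \<alpha> h + \<beta> h \<noteq> 0"
      using root by blast
    then show ?thesis
    proof cases
      case 1
      then have "b \<in> H" using root_space_zero[OF _ B_root_space[OF b]] by (simp add: \<beta>_def)
      then obtain c where "br f b = scale c f" using cartan by (auto simp: span_singleton)
      then show ?thesis by (simp add: bracket_scale_right bracket_self span_zero)
    next
      case 2
      then show ?thesis using cartan root_space_zero[OF _ fb] by simp
    next
      case 3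
      have "nat_combination H \<Delta> (\<lambda>h. - \<beta> h - \<alpha> h)" by (rule le[OF neg[OF 3(1)]])
      then have neg_sum: "nat_combination H \<Delta> (\<lambda>h. - (\<alpha> h + \<beta> h))" by (rule cong[THEN iffD1, rotated]) simp
      \<comment> \<open>The weight \<open>2 \<alpha> + \<beta>\<close> could vanish and then be no
        root. In that case \<open>\<alpha> = - (\<alpha> + \<beta>)\<close> would be a sum of simple
        roots, and so would \<open>- 2 \<alpha>\<close>, since \<open>- \<alpha>\<close> is a root
        above \<open>\<alpha>\<close>; both together force \<open>\<alpha> = 0\<close>.\<close>
      have "\<exists>h\<in>H. \<alpha> h + (\<alpha> h + \<beta> h) \<noteq> 0"
      proof (rule ccontr)
        assume "\<not> ?thesis"
        then have *: "\<alpha> h + \<beta> h = - \<alpha> h" if "h \<in> H" for h using that by (simp add: eq_neg_iff_add_eq_0 add.commute)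
        have "nat_combination H \<Delta> \<alpha>"
          using neg_sum by (rule cong[THEN iffD1, rotated]) (simp add: *)
        have "is_root scale br H \<alpha>" by (rule \<alpha>[OF 3(1)])
        have "nat_combination H \<Delta> (\<lambda>h. - \<alpha> h - \<alpha> h)"
          by (rule le[OF neg]) fact
        then have "nat_combination H \<Delta> (\<lambda>h. - (\<alpha> h + \<alpha> h))" by (rule cong[THEN iffD1, rotated]) simp
        moreover have "nat_combination H \<Delta> (\<lambda>h. \<alpha> h + \<alpha> h)"
        proof -
          obtain c :: "_ \<Rightarrow> nat" where "\<forall>h\<in>H. \<alpha> h = (\<Sum>\<delta>\<in>\<Delta>. of_nat (c \<delta>) * \<delta> h)"
            using \<open>nat_combination H \<Delta> \<alpha>\<close> unfolding nat_combination_def by blast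
          then show ?thesis
            unfolding nat_combination_def
            by (intro exI[of _ "\<lambda>\<delta>. c \<delta> + c \<delta>"]) (simp add: distrib_right sum.distrib sum_distrib_left mult.assoc)
        qed
        ultimately have "\<alpha> h + \<alpha> h = 0" if "h \<in> H" for h
          using nat_combination_antisym[OF base _ _ that, of "\<lambda>h. \<alpha> h + \<alpha> h"] by simp
        then have "\<alpha> h = 0" if "h \<in> H" for h using that by (simp flip: mult_2)
        then show False using \<open>is_root scale br H \<alpha>\<close> by (auto simp: is_root_def)
      qed
      then have "is_root scale br H (\<lambda>h. \<alpha> h + (\<alpha> h + \<beta> h))"
        using ffb False unfolding is_root_def by (intro conjI exI[of _ "br f (br f b)"])
      then have "nat_combination H \<Delta> (\<lambda>h. \<alpha> h + (\<alpha> h + \<beta> h) - \<alpha> h)" by (rule le)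
      then have "nat_combination H \<Delta> (\<lambda>h. \<alpha> h + \<beta> h)" by simp
      then show ?thesis using nat_combination_antisym[OF base _ neg_sum] 3(2) by blast
    qed
  qed (simp add: span_zero)
  have "br f (br f y) = (\<Sum>b\<in>B. scale (coord y b) (br f (br f b)))"
    by (subst sum_coord[of y, symmetric]) (simp only: bracket_sum_right bracket_scale_right)
  also have "\<dots> \<in> span {f}"
    by (intro span_sum span_scale basis)
  finally show ?thesis by (auto simp: span_singleton)
qed

end

text \<open>A basis of \<open>H\<close> gives a finite commuting family of diagonalisable operators,
  hence common eigenvectors, and linearity extends them to all of \<open>H\<close>.\<close>

lemma cartan_weight_decomposition:
  fixes scale :: "'k::{alg_closed_field, field_char_0} \<Rightarrow> 'g::ab_group_add \<Rightarrow> 'g"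
  assumes "lie_algebra scale br" and "fin_dim scale" and cartan: "cartan_subalgebra scale br H"
  shows "\<exists>B wt. weight_decomposition scale br H B wt"
proof -
  interpret lie_algebra scale br by fact
  obtain C where C: "finite C" "span C = UNIV" using assms(2) by (auto simp: fin_dim_def)
  have H: "subspace H" "\<And>a b. a \<in> H \<Longrightarrow> b \<in> H \<Longrightarrow> br a b = 0"
    using cartan by (auto simp: cartan_subalgebra_def abelian_subalgebra_def)
  have max: "H' = H" if "abelian_subalgebra scale br H'" "H \<subseteq> H'" for H'
    using cartan that by (simp add: cartan_subalgebra_def)
  obtain S where S: "S \<subseteq> H" "independent S" "H \<subseteq> span S"
    using maximal_independent_subset[of H] by blast
  have "finite S" using independent_span_bound[OF C(1) S(2)] C(2) by simp
  have ss: "span {v. \<exists>\<mu>. br h v = scale \<mu> v} = UNIV" if "h \<in> H" for h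
    using semisimple_endo_span_eigenvectors[OF vector_space_axioms C] cartan that
    by (simp add: cartan_subalgebra_def semisimple_element_def)
  let ?E = "{v. \<forall>T\<in>br ` S. \<exists>\<mu>. T v = scale \<mu> v}"
  have "span ?E = UNIV"
  proof (rule span_common_eigenvectors)
    show "T (T' v) = T' (T v)" if TT': "T \<in> br ` S" "T' \<in> br ` S" for T T' v
    proof -
      obtain a b where "T = br a" "T' = br b" "a \<in> H" "b \<in> H" using TT' S(1) by auto
      then show ?thesis using bracket_bracket_right[of a b v] H(2)[of a b] by simp
    qed
  qed (use \<open>finite S\<close> S(1) ss linear_bracket_right in auto)
  moreover have weight: "\<exists>\<mu>. br h v = scale \<mu> v" if v: "v \<in> ?E" and h: "h \<in> H" for v h
  proof -
    have "h \<in> span S" using h S(3) by blast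
    then show ?thesis
    proof (induction rule: span_induct_alt)
      case base
      show ?case by (intro exI[of _ 0]) simp
    next
      case (step c a b)
      then obtain \<mu> where "br a v = scale \<mu> v" using v by auto
      moreover obtain \<nu> where "br b v = scale \<nu> v" using step(2) by (rule exE)
      ultimately have "br (scale c a + b) v = scale (c * \<mu> + \<nu>) v"
        by (simp add: bracket_add_left bracket_scale_left scale_left_distrib)
      then show ?case by blast
    qed
  qed
  obtain B where B: "B \<subseteq> ?E" "independent B" "?E \<subseteq> span B"
    using maximal_independent_subset[of ?E] by blast
  have "span B = UNIV" using span_mono[OF B(3)] \<open>span ?E = UNIV\<close> by (auto simp: span_span)
  moreover have "finite B" using independent_span_bound[OF C(1) B(2)] C(2) by simp
  moreover have "\<forall>b\<in>B. \<forall>h\<in>H. \<exists>\<mu>. br h b = scale \<mu> b" using weight B(1) by blast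
  then obtain wt where "\<And>b h. b \<in> B \<Longrightarrow> h \<in> H \<Longrightarrow> br h b = scale (wt b h) b" by metis
  moreover have centralizer: "v \<in> H" if v: "\<And>h. h \<in> H \<Longrightarrow> br h v = 0" for v
  proof -
    \<comment> \<open>Adjoining a centralizing \<open>v\<close> keeps the subalgebra abelian, so
      maximality puts \<open>v\<close> into \<open>H\<close>.\<close>
    let ?H' = "span (insert v H)"
    have "abelian_subalgebra scale br ?H'"
      unfolding abelian_subalgebra_def
    proof (intro conjI ballI)
      have vh: "br v h = 0" if "h \<in> H" for h using v[OF that] bracket_swap[of v h] by simp
      have gen: "br a b = 0" if "a \<in> insert v H" "b \<in> insert v H" for a b
        using that v vh H(2) bracket_self by auto
      fix a b assume ab: "a \<in> ?H'" "b \<in> ?H'"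
      have left: "br a b = 0" if "b \<in> insert v H" for b
        using ab(1) by (induction rule: span_induct_alt) (simp_all add: bracket_add_left bracket_scale_left gen[OF _ that])
      show "br a b = 0"
        using ab(2) by (induction rule: span_induct_alt) (simp_all add: bracket_add_right bracket_scale_right left)
    qed simp
    then have "?H' = H" using max span_superset by blast
    then show ?thesis using span_base by blast
  qed
  ultimately have "weight_decomposition scale br H B wt"
    using B(2) lie_algebra_axioms unfolding weight_decomposition_def weight_decomposition_axioms_def by blast
  then show ?thesis by blast
qed

lemma minimal_nilpotent_extremal:
  fixes scale :: "'k::{alg_closed_field, field_char_0} \<Rightarrow> 'g::ab_group_add \<Rightarrow> 'g"
  assumes simple: "simple_lie_algebra scale br" and fin: "fin_dim scale"
    and "minimal_nilpotent scale br f" and triple: "sl2_triple scale br f x e"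
  shows "f \<noteq> 0 \<and> (\<forall>y. \<exists>c. br f (br f y) = scale c f)"
proof -
  obtain H \<Delta> \<alpha> where *: "cartan_subalgebra scale br H" "root_base scale br H \<Delta>"
    "lowest_root scale br H \<Delta> \<alpha>" "f \<noteq> 0" "f \<in> root_space scale br H \<alpha>"
    using assms(3) by (auto simp: minimal_nilpotent_def)
  have "lie_algebra scale br" using simple by (simp add: simple_lie_algebra_def)
  then obtain B wt where "weight_decomposition scale br H B wt"
    using cartan_weight_decomposition[OF _ fin *(1)] by blast
  then interpret weight_decomposition scale br H B wt .
  show ?thesis using lowest_root_vector_extremal[OF simple *(5,4) triple *(2,3)] *(4) by blast
qed

section \<open>The grading of a minimal nilpotent element\<close>

text \<open>Roots are left behind here: of minimality only the extremality of \<open>f\<close> is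
  kept, together with the given triple through it.\<close>

locale minimal_grading = lie_algebra scale br
  for scale :: "'k::field_char_0 \<Rightarrow> 'g::ab_group_add \<Rightarrow> 'g" and br +
  fixes f x e :: 'g
  assumes e_f: "br e f = scale 2 x" and x_e: "br x e = e" and x_f: "br x f = - f"
    and f_nonzero: "f \<noteq> 0" and extremal: "\<exists>c. br f (br f v) = scale c f"
begin

text \<open>The index is twice the eigenvalue of \<open>ad x\<close>, so it is an integer and equals
  the weight for \<open>2 x\<close>.\<close>

definition gr :: "int \<Rightarrow> 'g set" where
  "gr n = {v. br x v = scale (of_int n / 2) v}"

lemma sl2: "sl2_module_cube_zero scale (br e) (br f) (br (scale 2 x))"
proof (intro sl2_module_cube_zero.intro sl2_module_cube_zero_axioms.intro)
  show "sl2_module scale (br e) (br f) (br (scale 2 x))"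
    by (rule sl2_module_ad[OF lie_algebra_axioms e_f])
      (simp_all add: bracket_scale_left x_e x_f)
  show "br f (br f (br f v)) = 0" for v
    using extremal[of v] by (auto simp: bracket_scale_right bracket_self)
qed

interpretation sl2: sl2_module_cube_zero scale "br e" "br f" "br (scale 2 x)"
  by (rule sl2)

lemma gr_iff: "v \<in> gr n \<longleftrightarrow> br (scale 2 x) v = scale (of_int n) v"
proof -
  have "br (scale 2 x) v = scale (of_int n) v \<longleftrightarrow> scale 2 (br x v) = scale 2 (scale (of_int n / 2) v)"
    by (simp add: bracket_scale_left)
  then show ?thesis by (simp only: gr_def mem_Collect_eq scale_cancel_left) simp
qed

lemma subspace_gr: "subspace (gr n)"
  by (auto simp: subspace_def gr_def bracket_add_right bracket_scale_right scale_right_distrib)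

lemma gr_bracket: "v \<in> gr m \<Longrightarrow> w \<in> gr n \<Longrightarrow> br v w \<in> gr (m + n)"
  by (simp add: gr_iff bracket_bracket_right[of _ v w] bracket_scale_left[of _ v w] bracket_scale_right[of v _ w]
      scale_left_distrib)

lemma gr_eq_0: "v \<in> gr n \<Longrightarrow> n \<notin> {-2, -1, 0, 1, 2} \<Longrightarrow> v = 0"
proof (rule ccontr)
  assume v: "v \<in> gr n" "v \<noteq> 0" and n: "n \<notin> {-2, -1, 0, 1, 2}"
  have "(of_int n :: 'k) \<in> {-2, -1, 0, 1, 2}"
    using sl2.weight_cases[OF v(2)] v(1) by (simp only: gr_iff)
  then have "(of_int n :: 'k) \<in> of_int ` {-2, -1, 0, 1, 2}" by simp
  then show False using n by (auto simp only: inj_image_mem_iff[OF injI[OF of_int_eq_iff[THEN iffD1]]])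
qed

lemma gr_simps [simp]: "x \<in> gr 0" "e \<in> gr 2" "f \<in> gr (-2)"
  by (simp_all add: gr_def bracket_self x_e x_f)

lemma gr_decomposition:
  obtains a b c d k where "a \<in> gr (-2)" "b \<in> gr (-1)" "c \<in> gr 0" "d \<in> gr 1" "k \<in> gr 2"
    "v = a + b + c + d + k"
proof -
  obtain w where w: "v = (\<Sum>\<mu>\<in>{-2, -1, 0, 1, 2 :: 'k}. w \<mu>)"
    "\<forall>\<mu>\<in>{-2, -1, 0, 1, 2}. br (scale 2 x) (w \<mu>) = scale \<mu> (w \<mu>)"
    using sl2.sum_of_weight_vectors[of v] by blast
  show ?thesis
    by (rule that[of "w (-2)" "w (-1)" "w 0" "w 1" "w 2"]) (use w in \<open>auto simp: gr_iff add.assoc\<close>)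
qed

lemma gr_independent:
  assumes "a \<in> gr (-2)" "b \<in> gr (-1)" "c \<in> gr 0" "d \<in> gr 1" "k \<in> gr 2" "a + b + c + d + k = 0"
  shows "a = 0 \<and> b = 0 \<and> c = 0 \<and> d = 0 \<and> k = 0"
proof -
  define w :: "'k \<Rightarrow> 'g" where
    "w \<mu> = (if \<mu> = -2 then a else if \<mu> = -1 then b else if \<mu> = 0 then c else if \<mu> = 1 then d else k)" for \<mu>
  have w: "w (-2) = a" "w (-1) = b" "w 0 = c" "w 1 = d" "w 2 = k"
    by (simp_all add: w_def)
  have "w \<mu> = 0" if "\<mu> \<in> {-2, -1, 0, 1, 2}" for \<mu>
  proof (rule eigenvectors_sum_eq_0[OF linear_bracket_right[of "scale 2 x"] _ _ _ that])
    show "(\<Sum>\<mu>\<in>{-2, -1, 0, 1, 2}. w \<mu>) = 0" using assms(6) by (simp add: w add.assoc)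
    show "br (scale 2 x) (w \<mu>) = scale \<mu> (w \<mu>)" if "\<mu> \<in> {-2, -1, 0, 1, 2}" for \<mu>
      using that assms(1-5) by (auto simp: w gr_iff)
  qed simp
  then show ?thesis using w by auto
qed

text \<open>\<open>f\<close> kills \<open>v\<close> for degree reasons, so raising twice and
  lowering twice multiplies \<open>v\<close> by 2 times 2. Thus \<open>v\<close> lies in the image
  of \<open>(ad f)^2\<close>, which is in the line of \<open>f\<close>.\<close>

lemma gr_minus_2:
  assumes "v \<in> gr (-2)"
  obtains c where "v = scale c f"
proof -
  have "br f v \<in> gr (-4)" using gr_bracket[of f "-2" v "-2"] assms by simp
  then have fv: "br f v = 0" by (rule gr_eq_0) simp
  have v: "br (scale 2 x) v = scale (-2) v" using assms by (simp add: gr_iff)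
  have "br f (br f (br e (br e v))) = scale 4 v"
    using sl2.F_E_pow[OF fv v, of 0] sl2.F_E_pow[OF fv v, of 1] by (simp add: bracket_scale_right)
  moreover obtain c where "br f (br f (br e (br e v))) = scale c f" using extremal by blast
  ultimately have "scale (1/4) (scale 4 v) = scale (1/4) (scale c f)" by simp
  then have "v = scale (c / 4) f" by simp
  then show ?thesis by (rule that)
qed

text \<open>Since \<open>[f, [f, e]] = - 2 f\<close>, adding \<open>c / 2\<close> times
  \<open>e\<close> cancels \<open>[f, [f, v]]\<close>. The result is a highest weight vector of
  weight 2 killed by \<open>(ad f)^2\<close>, hence 0.\<close>

lemma gr_2:
  assumes "v \<in> gr 2"
  obtains c where "v = scale c e"
proof -
  interpret dual: sl2_module scale "br f" "br e" "\<lambda>v. - br (scale 2 x) v" by (rule sl2.dual)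
  obtain c where c: "br f (br f v) = scale c f" using extremal by blast
  have "br f e = - scale 2 x" using bracket_swap[of f e] e_f by simp
  then have ffe: "br f (br f e) = - scale 2 f"
    using bracket_swap[of f x] x_f by (simp add: bracket_minus_right bracket_scale_right)
  define w where "w = v + scale (c / 2) e"
  have w: "w \<in> gr 2" unfolding w_def using assms by (intro subspace_add[OF subspace_gr] subspace_scale[OF subspace_gr]) simp_all
  have "br e w \<in> gr 4" using gr_bracket[of e 2 w 2] w by simp
  then have "br e w = 0" by (rule gr_eq_0) simp
  moreover have "- br (scale 2 x) w = scale (-2) w" using w by (simp add: gr_iff)
  moreover have "(br f ^^ 2) w = 0"
    by (simp add: w_def numeral_2_eq_2 bracket_add_right bracket_scale_right ffe c)
  moreover have "-2 + of_nat n \<noteq> (0 :: 'k)" if "n < 2" for n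
    using that by (auto simp: numeral_2_eq_2 less_Suc_eq)
  ultimately have "w = 0" by (rule dual.lowest_weight_vector_eq_0)
  then have "v = scale (- (c / 2)) e" by (simp add: w_def eq_neg_iff_add_eq_0)
  then show ?thesis by (rule that)
qed

lemma x_nonzero: "x \<noteq> 0" and e_nonzero: "e \<noteq> 0"
proof -
  show "x \<noteq> 0" using x_f f_nonzero by auto
  then have "scale 2 x \<noteq> 0" by simp
  then show "e \<noteq> 0" using e_f by auto
qed

lemma br_f_inj:
  assumes "u \<in> gr 1" "br f u = 0"
  shows "u = 0"
proof (rule sl2.lowest_weight_vector_eq_0[OF assms(2), of 1 1])
  show "br (scale 2 x) u = scale 1 u" using assms(1) by (simp add: gr_iff)
  have "br e u \<in> gr 3" using gr_bracket[of e 2 u 1] assms(1) by simp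
  then show "(br e ^^ 1) u = 0" using gr_eq_0 by simp
qed simp

lemma br_f_surj:
  assumes "v \<in> gr (-1)"
  shows "br e v \<in> gr 1" "br f (br e v) = v"
proof -
  show "br e v \<in> gr 1" using gr_bracket[of e 2 v "-1"] assms by simp
  have "br f v \<in> gr (-3)" using gr_bracket[of f "-2" v "-1"] assms by simp
  then have "br f v = 0" by (rule gr_eq_0) simp
  then show "br f (br e v) = v"
    using sl2.E_F[of v] assms by (simp add: gr_iff)
qed

end

text \<open>Here \<open>t\<close> is \<open>s\<^sup>*\<close>. Together with \<open>f\<close> and \<open>e\<close> the elements \<open>s\<close> and \<open>t\<close> generate a copy of
  \<open>sl\<^sub>3\<close>, in which \<open>f + z s\<close> is the cyclic element; all constants below are read off from it.\<close>

locale embedded_minimal = minimal_grading +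
  fixes s t :: 'b
  assumes s_gr: "s \<in> gr 1" and t_gr: "t \<in> gr (-1)" and s_t: "br s t = scale 2 x"
begin

text \<open>With \<open>s\<close> it spans the degree-one part of the \<open>sl\<^sub>3\<close>. As
  \<open>[s, s'] = 2 e\<close>, it also spans a complement in \<open>gr 1\<close> of the centralizer
  \<open>U\<close> of \<open>s\<close>.\<close>

definition s' where "s' = br t e"
definition U where "U = {u \<in> gr 1. br s u = 0}"

lemma s'_gr: "s' \<in> gr 1"
  using gr_bracket[OF t_gr, of e 2] by (simp add: s'_def)

lemma s_e: "br s e = 0" and f_t: "br f t = 0" and t_f: "br t f = 0"
proof -
  have "br s e \<in> gr 3" using gr_bracket[OF s_gr, of e 2] by simp
  then show "br s e = 0" by (rule gr_eq_0) simp
  have "br f t \<in> gr (-3)" using gr_bracket[OF _ t_gr, of f "-2"] by simp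
  then show "br f t = 0" by (rule gr_eq_0) simp
  then show "br t f = 0" using bracket_swap[of t f] by simp
qed

lemma x_s: "br x s = scale (1/2) s" and x_t: "br x t = - scale (1/2) t"
  and s_x: "br s x = - scale (1/2) s" and t_x: "br t x = scale (1/2) t"
proof -
  show xs: "br x s = scale (1/2) s" and xt: "br x t = - scale (1/2) t"
    using s_gr t_gr by (simp_all add: gr_def)
  show "br s x = - scale (1/2) s" "br t x = scale (1/2) t"
    using bracket_swap[of s x] bracket_swap[of t x] xs xt by simp_all
qed

lemma f_e: "br f e = - scale 2 x"
  using bracket_swap[of f e] e_f by simp

lemma f_x: "br f x = f"
  using bracket_swap[of f x] x_f by simp

lemma f_s': "br f s' = - t"
  unfolding s'_def by (subst bracket_bracket_right)
    (simp add: f_t f_e bracket_minus_right bracket_scale_right t_x)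

lemma s_s': "br s s' = scale 2 e"
  unfolding s'_def by (subst bracket_bracket_right)
    (simp add: s_t s_e bracket_scale_left x_e)

lemma sl2_s: "sl2_module scale (br s) (br (scale 2 t)) (br (scale 4 x))"
  by (rule sl2_module_ad[OF lie_algebra_axioms])
    (simp_all add: bracket_scale_left bracket_scale_right x_s x_t s_t)

interpretation S: sl2_module scale "br s" "br (scale 2 t)" "br (scale 4 x)"
  by (rule sl2_s)
interpretation Sd: sl2_module scale "br (scale 2 t)" "br s" "\<lambda>v. - br (scale 4 x) v"
  by (rule S.dual)

lemma gr_4x: "v \<in> gr n \<Longrightarrow> br (scale 4 x) v = scale (2 * of_int n) v"
  by (simp add: gr_def bracket_scale_left)

text \<open>Under the triple of \<open>s\<close>, \<open>f\<close> is a lowest weight vector of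
  weight -4, so \<open>(ad s)^4 f\<close> is a nonzero multiple of \<open>e\<close>. One step down
  from there by \<open>t\<close> leads to \<open>s' = [t, e]\<close>.\<close>

lemma s_cubed_f: "\<exists>b. b \<noteq> 0 \<and> br s (br s (br s f)) = scale (- b) s'"
proof -
  have lowest: "br (scale 2 t) f = 0" by (simp add: bracket_scale_left t_f)
  have weight: "br (scale 4 x) f = scale (-4) f" by (simp add: bracket_scale_left x_f)
  have gr: "br s (br s (br s (br s f))) \<in> gr 2"
    using gr_bracket[OF s_gr gr_bracket[OF s_gr gr_bracket[OF s_gr gr_bracket[OF s_gr gr_simps(3)]]]] by simp
  obtain c where c: "br s (br s (br s (br s f))) = scale c e" using gr_2[OF gr] .
  have "c \<noteq> 0"
  proof
    assume "c = 0"
    then have "(br s ^^ 4) f = 0" using c by (simp add: numeral_eq_Suc)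
    moreover have "-4 + of_nat n \<noteq> (0 :: 'a)" if "n < 4" for n
      using that by (auto simp: numeral_eq_Suc less_Suc_eq)
    ultimately have "f = 0" by (rule S.lowest_weight_vector_eq_0[OF lowest weight])
    then show False using f_nonzero by simp
  qed
  \<comment> \<open>The weight string runs from -4 to 4; its topmost lowering coefficient is
    \<open>- 4 (- 4 + 3) = 4\<close>.\<close>
  have "br (scale 2 t) ((br s ^^ 4) f) = scale 4 ((br s ^^ 3) f)"
    using S.F_E_pow[OF lowest weight, of 3] by (simp add: numeral_eq_Suc)
  then have "scale (c * 2) s' = scale 4 (br s (br s (br s f)))"
    using c by (simp add: numeral_eq_Suc bracket_scale_left bracket_scale_right s'_def)
  then have "scale (1/4) (scale (c * 2) s') = scale (1/4) (scale 4 (br s (br s (br s f))))" by simp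
  then have "br s (br s (br s f)) = scale (- (- c / 2)) s'" by simp
  then show ?thesis using \<open>c \<noteq> 0\<close> by (intro exI[of _ "- c / 2"]) simp
qed

text \<open>A free parameter: replacing \<open>s\<close> by \<open>r s\<close> and \<open>t\<close>
  by \<open>t / r\<close> multiplies it by \<open>r^4\<close>. The sign is chosen to give
  \<open>[s, k] = b s'\<close> for the element \<open>k\<close> below.\<close>

definition b where "b = (SOME b. b \<noteq> 0 \<and> br s (br s (br s f)) = scale (- b) s')"

lemma b_nonzero: "b \<noteq> 0" and s_s_s_f: "br s (br s (br s f)) = scale (- b) s'"
  using someI_ex[OF s_cubed_f] unfolding b_def by blast+

lemma s'_nonzero: "s' \<noteq> 0"
  using s_s' e_nonzero by auto

text \<open>For the triple of \<open>s\<close>, \<open>v\<close> would be a highest weight vector of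
  weight -2, while \<open>[t, [t, v]]\<close> vanishes by degree.\<close>

lemma s_inj:
  assumes "v \<in> gr (-1)" "br s v = 0"
  shows "v = 0"
proof (rule Sd.lowest_weight_vector_eq_0[OF assms(2), of 2 2])
  show "- br (scale 4 x) v = scale 2 v" using gr_4x[OF assms(1)] by simp
  have "br t (br t v) \<in> gr (-3)"
    using gr_bracket[OF t_gr gr_bracket[OF t_gr assms(1)]] by simp
  then have "br t (br t v) = 0" by (rule gr_eq_0) simp
  then show "(br (scale 2 t) ^^ 2) v = 0"
    by (simp add: numeral_2_eq_2 bracket_scale_left bracket_scale_right)
  show "2 + of_nat n \<noteq> (0 :: 'a)" for n
    by (metis of_nat_numeral of_nat_add of_nat_eq_0_iff add_is_0 zero_neq_numeral)
qed

lemma gr_1_U: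
  assumes "u \<in> gr 1"
  obtains c w where "w \<in> U" "u = w + scale c s'"
proof -
  have "br s u \<in> gr 2" using gr_bracket[OF s_gr assms] by simp
  then obtain c where c: "br s u = scale c e" by (rule gr_2)
  have "u - scale (c / 2) s' \<in> U"
    unfolding U_def using assms s'_gr
    by (simp add: subspace_diff[OF subspace_gr] subspace_scale[OF subspace_gr]
        bracket_diff_right bracket_scale_right c s_s')
  then show ?thesis by (rule that) (rule diff_add_cancel[symmetric])
qed

text \<open>\<open>ad e\<close> and \<open>ad f\<close> are inverse to each other between
  \<open>gr (-1)\<close> and \<open>gr 1\<close>; the splitting of \<open>gr 1\<close> is carried
  over, with \<open>s'\<close> going to \<open>- t\<close>.\<close>

lemma gr_minus_1_sum:
  assumes "v \<in> gr (-1)"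
  obtains c u where "u \<in> U" "v = scale c t + br f u"
proof -
  obtain c w where w: "w \<in> U" "br e v = w + scale c s'"
    using gr_1_U[OF br_f_surj(1)[OF assms]] .
  have "v = scale (- c) t + br f w"
    using br_f_surj(2)[OF assms] by (simp add: w(2) bracket_add_right bracket_scale_right f_s')
  with w(1) show ?thesis by (rule that)
qed

text \<open>Vectors of \<open>U\<close> are highest weight vectors of weight 2 for the triple of
  \<open>s\<close>, so lowering twice and raising twice multiplies them by 4. The remaining
  direction \<open>s'\<close> is reached from \<open>[s, f]\<close>, which \<open>(ad s)^2\<close>
  sends to \<open>- b s'\<close>.\<close>

lemma s_s_surj:
  assumes g: "g \<in> gr 1"
  obtains v where "v \<in> gr (-1)" "g = br s (br s v)"
proof -
  obtain c w where w: "w \<in> U" "g = w + scale c s'" using gr_1_U[OF g] .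
  have sw: "br s w = 0" "w \<in> gr 1" using w(1) by (auto simp: U_def)
  have weight: "- br (scale 4 x) w = scale (-2) w" using gr_4x[OF sw(2)] by simp
  let ?F = "br (scale 2 t)"
  have F: "v \<in> gr n \<Longrightarrow> ?F v \<in> gr (-1 + n)" for v n
    using gr_bracket[OF t_gr] by (simp add: bracket_scale_left subspace_scale[OF subspace_gr])
  have "?F (?F w) \<in> gr (-1)" using F[OF F[OF sw(2)]] by simp
  have "br s (?F (?F w)) = scale 2 (?F w)" "br s (?F w) = scale 2 w"
    using Sd.F_E_pow[OF sw(1) weight, of 1] Sd.F_E_pow[OF sw(1) weight, of 0] by simp_all
  then have ssFF: "br s (br s (?F (?F w))) = scale 4 w" by (simp add: bracket_scale_right)
  define v where "v = scale (1/4) (?F (?F w)) + scale (- c / b) (br s f)"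
  have "br s f \<in> gr (-1)" using gr_bracket[OF s_gr gr_simps(3)] by simp
  then have "v \<in> gr (-1)"
    unfolding v_def using \<open>?F (?F w) \<in> gr (-1)\<close>
    by (intro subspace_add[OF subspace_gr] subspace_scale[OF subspace_gr])
  moreover have "br s (br s v) = scale (1/4) (scale 4 w) + scale (- c / b) (scale (- b) s')"
    by (simp only: v_def bracket_add_right bracket_scale_right ssFF s_s_s_f)
  then have "g = br s (br s v)" using w(2) b_nonzero by simp
  ultimately show ?thesis by (rule that)
qed

text \<open>Image of the splitting of \<open>gr (-1)\<close> under the surjection
  \<open>(ad s)^2\<close>, which sends \<open>t\<close> to \<open>- s\<close>.\<close>

lemma gr_1_sum:
  assumes "g \<in> gr 1"
  obtains c u where "u \<in> U" "g = scale c s + br s (br s (br f u))"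
proof -
  obtain v where v: "v \<in> gr (-1)" "g = br s (br s v)" using s_s_surj[OF assms] .
  obtain c u where u: "u \<in> U" "v = scale c t + br f u" using gr_minus_1_sum[OF v(1)] .
  have "g = scale (- c) s + br s (br s (br f u))"
    using v(2) by (simp add: u(2) bracket_add_right bracket_scale_right s_t s_x bracket_minus_right)
  with u(1) show ?thesis by (rule that)
qed

text \<open>\<open>[s, v]\<close> has the form \<open>[s, [s, w]]\<close>, so
  \<open>v - [s, w]\<close> centralizes \<open>s\<close>; splitting \<open>w\<close> does the
  rest.\<close>

lemma gr_0_sum:
  assumes v: "v \<in> gr 0"
  obtains c g u where "g \<in> gr 0" "br s g = 0" "u \<in> U" "v = g + scale c x + br s (br f u)"
proof -
  have "br s v \<in> gr 1" using gr_bracket[OF s_gr v] by simp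
  then obtain w where w: "w \<in> gr (-1)" "br s v = br s (br s w)" using s_s_surj by blast
  obtain c u where u: "u \<in> U" "w = scale c t + br f u" using gr_minus_1_sum[OF w(1)] .
  have "v - br s w \<in> gr 0" using v gr_bracket[OF s_gr w(1)] by (simp add: subspace_diff[OF subspace_gr])
  moreover have "br s (v - br s w) = 0" using w(2) by (simp add: bracket_diff_right)
  moreover have "v = (v - br s w) + scale (c * 2) x + br s (br f u)"
    by (simp add: u(2) bracket_add_right bracket_scale_right s_t)
  ultimately show ?thesis using u(1) by (intro that)
qed

text \<open>Since \<open>t = - [f, s']\<close> and \<open>ad f\<close> is injective on
  \<open>gr 1\<close>, a relation would give \<open>u = c s'\<close>; but \<open>s\<close> kills
  \<open>u\<close> and not \<open>s'\<close>.\<close>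

lemma t_f_U_independent:
  assumes "u \<in> U" "scale c t + br f u = 0"
  shows "c = 0" "br f u = 0"
proof -
  have "br f (u - scale c s') = 0"
    using assms(2) by (simp add: bracket_diff_right bracket_scale_right f_s' add.commute)
  moreover have "u - scale c s' \<in> gr 1"
    using assms(1) s'_gr by (simp add: U_def subspace_diff[OF subspace_gr] subspace_scale[OF subspace_gr])
  ultimately have "u - scale c s' = 0" using br_f_inj by blast
  then have "br s (scale c s') = 0" using assms(1) by (simp add: U_def)
  then have "scale (c * 2) e = 0" by (simp add: bracket_scale_right s_s')
  then show "c = 0" using e_nonzero by simp
  then show "br f u = 0" using assms(2) by simp
qed

lemma f_U_gr: "u \<in> U \<Longrightarrow> br f u \<in> gr (-1)"
  and s_f_U_gr: "u \<in> U \<Longrightarrow> br s (br f u) \<in> gr 0"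
  and s_s_f_U_gr: "u \<in> U \<Longrightarrow> br s (br s (br f u)) \<in> gr 1"
proof -
  assume "u \<in> U"
  then have "u \<in> gr 1" by (simp add: U_def)
  show 1: "br f u \<in> gr (-1)" using gr_bracket[OF gr_simps(3) \<open>u \<in> gr 1\<close>] by simp
  show 2: "br s (br f u) \<in> gr 0" using gr_bracket[OF s_gr 1] by simp
  show "br s (br s (br f u)) \<in> gr 1" using gr_bracket[OF s_gr 2] by simp
qed

lemma x_s_f_U_independent:
  assumes "u \<in> U" "scale c x + br s (br f u) = 0"
  shows "c = 0" "br s (br f u) = 0"
proof -
  have "br s (scale (c / 2) t + br f u) = 0"
    using assms(2) by (simp add: bracket_add_right bracket_scale_right s_t)
  moreover have "scale (c / 2) t + br f u \<in> gr (-1)"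
    using t_gr f_U_gr[OF assms(1)] by (simp add: subspace_add[OF subspace_gr] subspace_scale[OF subspace_gr])
  ultimately have "scale (c / 2) t + br f u = 0" using s_inj by blast
  from t_f_U_independent[OF assms(1) this] show "c = 0" "br s (br f u) = 0" by simp_all
qed

text \<open>\<open>g\<close> acts on the lines through \<open>f\<close> and \<open>e\<close> by opposite scalars because \<open>[g, x] = 0\<close>, and by the
  same scalar because \<open>(ad s)\<^sup>4\<close> maps \<open>f\<close> to a nonzero multiple of \<open>e\<close>.\<close>

lemma f_centralizer:
  assumes g: "g \<in> gr 0" and sg: "br s g = 0"
  shows "br f g = 0"
proof -
  have "br g f \<in> gr (-2)" using gr_bracket[OF g gr_simps(3)] by simp
  then obtain c where c: "br g f = scale c f" by (rule gr_minus_2)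
  have gs: "br g s = 0" using bracket_swap[of g s] sg by simp
  have g_s: "br g (br s v) = br s (br g v)" for v using bracket_bracket_right[of g s v] gs by simp
  have "br s (br s (br s (br s f))) = scale (- b * 2) e"
    by (simp add: s_s_s_f bracket_scale_right bracket_minus_right s_s')
  moreover have "br g (br s (br s (br s (br s f)))) = scale c (br s (br s (br s (br s f))))"
    by (simp add: g_s c bracket_scale_right)
  ultimately have "br g (scale (- b * 2) e) = scale c (scale (- b * 2) e)" by simp
  then have "scale (- b * 2) (br g e) = scale (- b * 2) (scale c e)"
    by (simp only: bracket_scale_right scale_left_commute)
  then have ge: "br g e = scale c e" using b_nonzero by (simp only: scale_cancel_left) simp
  have "br x g = 0" using g by (simp add: gr_def)
  then have "br g x = 0" using bracket_swap[of g x] by simp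
  then have "br g (br e f) = 0" by (simp add: e_f bracket_scale_right)
  moreover have "br g (br e f) = scale c (br e f) + scale c (br e f)"
    by (subst bracket_bracket_right) (simp add: c ge bracket_scale_left bracket_scale_right)
  ultimately have "scale (2 * c) (br e f) = 0" by (simp only: mult_2 scale_left_distrib)
  then have "c = 0" using x_nonzero by (simp add: e_f)
  then show ?thesis using c bracket_swap[of f g] by simp
qed

section \<open>A degree-zero element \<open>k\<close> and its square on \<open>U0\<close>\<close>

definition y where "y = br f s"
text \<open>In the matrix model a multiple of diag(1, -2, 1), the Cartan direction commuting with
  \<open>f\<close>. It turns chains of brackets with \<open>f\<close> and \<open>s\<close> on
  \<open>U\<close> into a single bracket.\<close>

definition k where "k = br s y"

lemma y_gr: "y \<in> gr (-1)"
  using gr_bracket[OF gr_simps(3) s_gr] by (simp add: y_def)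

lemma k_gr: "k \<in> gr 0"
  using gr_bracket[OF s_gr y_gr] by (simp add: k_def)

lemma s_f: "br s f = - y"
  unfolding y_def by (rule bracket_swap)

lemma s_k: "br s k = scale b s'"
  using s_s_s_f by (simp add: k_def s_f bracket_minus_right)

lemma f_y: "br f y = 0"
proof -
  have "br f y \<in> gr (-3)" using gr_bracket[OF gr_simps(3) y_gr] by simp
  then show ?thesis by (rule gr_eq_0) simp
qed

lemma f_k: "br f k = 0"
  unfolding k_def by (subst bracket_bracket_right) (simp add: f_y bracket_self flip: y_def)

lemma k_f: "br k f = 0"
  using f_k bracket_swap[of k f] by simp

lemma k_y: "br k y = scale b t"
proof -
  have "br k y = br (br k f) s + br f (br k s)" unfolding y_def by (rule bracket_bracket_right)
  also have "br k s = - scale b s'" using s_k bracket_swap[of k s] by simp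
  finally show ?thesis by (simp add: k_f bracket_minus_right bracket_scale_right f_s')
qed

lemma y_U: "u \<in> U \<Longrightarrow> br s (br f u) = - br y u"
  by (subst bracket_bracket_right) (simp add: U_def s_f bracket_minus_left)

lemma s_y_U: "u \<in> U \<Longrightarrow> br s (br y u) = br k u"
  by (subst bracket_bracket_right) (simp add: U_def flip: k_def)

text \<open>Applying \<open>f\<close> once and \<open>s\<close> twice, which is half of a six-step
  orbit of \<open>T\<close>, amounts to the derivation \<open>- ad k\<close>.\<close>

lemma s_s_f_U: "u \<in> U \<Longrightarrow> br s (br s (br f u)) = - br k u"
  by (simp add: y_U s_y_U bracket_minus_right)

text \<open>\<open>[f, [s, [f, u]]]\<close> equals \<open>[y, [f, u]]\<close> by the Jacobi
  identity, and its negative by \<open>y_U\<close>.\<close>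

lemma y_f_U:
  assumes "u \<in> U"
  shows "br y (br f u) = 0"
proof -
  have "u \<in> gr 1" using assms by (simp add: U_def)
  have "br f (br f u) \<in> gr (-3)"
    using gr_bracket[OF gr_simps(3) gr_bracket[OF gr_simps(3) \<open>u \<in> gr 1\<close>]] by simp
  then have ffu: "br f (br f u) = 0" by (rule gr_eq_0) simp
  have "br f (br s (br f u)) = br y (br f u)"
    by (subst bracket_bracket_right) (simp add: ffu flip: y_def)
  moreover have "br f (br y u) = br y (br f u)"
    by (subst bracket_bracket_right) (simp add: f_y)
  ultimately have "br y (br f u) = - br y (br f u)"
    using y_U[OF assms] by (simp add: bracket_minus_right)
  then have "scale 2 (br y (br f u)) = 0"
    using scale_left_distrib[of 1 1 "br y (br f u)"] by (simp add: eq_neg_iff_add_eq_0)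
  then show ?thesis by simp
qed

lemma f_s_f_U: "u \<in> U \<Longrightarrow> br f (br s (br f u)) = 0"
proof -
  assume u: "u \<in> U"
  have "br f (br y u) = br y (br f u)"
    by (subst bracket_bracket_right) (simp add: f_y)
  then show ?thesis using y_U[OF u] y_f_U[OF u] by (simp add: bracket_minus_right)
qed

lemma f_f_U: "u \<in> U \<Longrightarrow> br f (br f u) = 0"
proof -
  assume "u \<in> U"
  then have "br f (br f u) \<in> gr (-3)" using gr_bracket[OF gr_simps(3) f_U_gr] by simp
  then show ?thesis by (rule gr_eq_0) simp
qed

text \<open>The orthogonal complement of \<open>s\<close> and \<open>s'\<close> for the pairing of
  \<open>gr 1\<close> with itself into the line of \<open>e\<close>. It carries the
  three-dimensional modules; the rest of \<open>U\<close> is the line of \<open>s\<close>, which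
  belongs to the adjoint one.\<close>

definition U0 where "U0 = {u \<in> U. br s' u = 0}"

lemma k_U0: "u \<in> U0 \<Longrightarrow> br k u \<in> U"
proof -
  assume u: "u \<in> U0"
  then have "br k u \<in> gr 1" using gr_bracket[OF k_gr, of u 1] by (simp add: U0_def U_def)
  moreover have "br s (br k u) = 0"
    using u by (subst bracket_bracket_right) (simp add: s_k U0_def U_def bracket_scale_left)
  ultimately show ?thesis by (simp add: U_def)
qed

text \<open>With \<open>v = [k, u]\<close>, expanding \<open>[y, v]\<close> reproduces it twice with
  negative sign, so \<open>3 [y, v] = - b [t, u]\<close>. This is the origin of the factor 3;
  applying \<open>s\<close> turns the two sides into \<open>3 [k, v]\<close> and
  \<open>- b u\<close>.\<close>

lemma k_k_U0:
  assumes u: "u \<in> U0"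
  shows "scale 3 (br k (br k u)) = - scale b u"
proof -
  define v where "v = br k u"
  have v: "v \<in> U" unfolding v_def by (rule k_U0[OF u])
  have uU: "u \<in> U" using u by (simp add: U0_def)
  have "br y (br y u) = br f v"
  proof -
    have "br y (br s (br f u)) = br (br y s) (br f u) + br s (br y (br f u))"
      by (rule bracket_bracket_right)
    also have "br y s = - k" unfolding k_def by (rule bracket_swap)
    also have "br k (br f u) = br f v"
      unfolding v_def by (subst bracket_bracket_right) (simp add: k_f)
    then have "br (- k) (br f u) = - br f v" by (simp add: bracket_minus_left)
    finally show ?thesis using y_U[OF uU] y_f_U[OF uU] by (simp add: bracket_minus_right)
  qed
  \<comment> \<open>\<open>v\<close> is rewritten as \<open>[s, [y, u]]\<close>, so that
    \<open>ad y\<close> acts on it as a derivation.\<close>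
  moreover have "br y v = br (br y s) (br y u) + br s (br y (br y u))"
    unfolding v_def s_y_U[OF uU, symmetric] by (rule bracket_bracket_right)
  moreover have "br y s = - k" unfolding k_def by (rule bracket_swap)
  moreover have "br k (br y u) = scale b (br t u) + br y v"
    unfolding v_def by (subst bracket_bracket_right) (simp add: k_y bracket_scale_left)
  ultimately have "br y v = - (scale b (br t u) + br y v) - br y v"
    using y_U[OF v] by (simp add: bracket_minus_left)
  then have "br y v - (- (scale b (br t u) + br y v) - br y v) = 0"
    by (simp only: right_minus_eq)
  moreover have "scale 3 (br y v) + scale b (br t u) = br y v - (- (scale b (br t u) + br y v) - br y v)"
    using scale_left_distrib[of 2 1 "br y v"] scale_left_distrib[of 1 1 "br y v"]
    by (simp add: algebra_simps)
  ultimately have 3: "scale 3 (br y v) = - scale b (br t u)"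
    by (simp only: eq_neg_iff_add_eq_0)
  \<comment> \<open>\<open>s\<close> kills \<open>u\<close>, so only
    \<open>[[s, t], u] = [2 x, u] = u\<close> remains.\<close>
  have "br s (br t u) = u"
    using uU by (subst bracket_bracket_right) (simp add: s_t U_def gr_iff)
  then have "br s (scale 3 (br y v)) = - scale b u"
    unfolding 3 by (simp add: bracket_minus_right bracket_scale_right)
  then show ?thesis using s_y_U[OF v] by (simp add: bracket_scale_right v_def)
qed

lemma phi_phi_U0:
  assumes "u \<in> U0"
  shows "br s (br s (br f (br s (br s (br f u))))) = scale (- b / 3) u"
proof -
  have uU: "u \<in> U" using assms by (simp add: U0_def)
  have "br s (br s (br f (br s (br s (br f u))))) = br k (br k u)"
    using s_s_f_U[OF k_U0[OF assms]] by (simp add: s_s_f_U[OF uU] bracket_minus_right)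
  also have "\<dots> = scale (1/3) (scale 3 (br k (br k u)))" by simp
  also have "\<dots> = scale (- b / 3) u" unfolding k_k_U0[OF assms] by simp
  finally show ?thesis .
qed

lemma U_sum:
  assumes u: "u \<in> U"
  obtains c w where "w \<in> U0" "u = w + scale c s"
proof -
  have "u \<in> gr 1" using u by (simp add: U_def)
  then have "br s' u \<in> gr 2" using gr_bracket[OF s'_gr] by force
  then obtain c where c: "br s' u = scale c e" by (rule gr_2)
  have "br s' s = - scale 2 e" using s_s' bracket_swap[of s' s] by simp
  moreover have "u + scale (c / 2) s \<in> U"
    using u s_gr by (simp add: U_def subspace_add[OF subspace_gr] subspace_scale[OF subspace_gr]
        bracket_add_right bracket_scale_right bracket_self)
  ultimately have "u + scale (c / 2) s \<in> U0"
    by (simp add: U0_def bracket_add_right bracket_scale_right c)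
  moreover have "u = (u + scale (c / 2) s) + scale (- (c / 2)) s" by simp
  ultimately show ?thesis by (rule that)
qed

end

section \<open>Laurent series\<close>

unbundle fps_syntax

text \<open>The window in the definition depends on both subdegrees. Freedom in the choice of the
  index set allows several series to be summed over one common window.\<close>

lemma fls_bilinear_nth_sum:
  assumes "finite S" "\<And>y. B 0 y = 0" "\<And>x. B x 0 = 0"
    and "\<And>i. i \<notin> S \<Longrightarrow> fls_nth a i = 0 \<or> fls_nth b (n - i) = 0"
  shows "fls_nth (fls_bilinear B a b) n = (\<Sum>i\<in>S. B (fls_nth a i) (fls_nth b (n - i)))"
proof -
  let ?W = "{fls_subdegree a..n - fls_subdegree b}"
  let ?g = "\<lambda>i. B (fls_nth a i) (fls_nth b (n - i))"
  have "sum ?g ?W = sum ?g (S \<union> ?W)"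
    using assms(1-3) by (intro sum.mono_neutral_left) (auto simp: not_le)
  moreover have "sum ?g S = sum ?g (S \<union> ?W)"
  proof (rule sum.mono_neutral_left)
    show "\<forall>i\<in>S \<union> ?W - S. ?g i = 0" using assms(2-4) by fastforce
  qed (use assms(1) in auto)
  ultimately show ?thesis by (simp add: fls_bilinear_nth)
qed

lemma fls_times_nth_sum:
  fixes a b :: "'k::field fls"
  assumes "finite S" "\<And>i. i \<notin> S \<Longrightarrow> fls_nth a i = 0 \<or> fls_nth b (n - i) = 0"
  shows "fls_nth (a * b) n = (\<Sum>i\<in>S. fls_nth a i * fls_nth b (n - i))"
proof -
  have "fls_nth (a * b) n = fls_nth (fls_bilinear (*) a b) n"
    by (simp add: fls_bilinear_nth fls_times_nth(2))
  then show ?thesis using fls_bilinear_nth_sum[OF assms(1) _ _ assms(2), of "(*)"] by simp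
qed

text \<open>\<open>fls_monom m v\<close> stands for \<open>z\<^sup>m v\<close>; since \<open>fls_X\<close> is \<open>z\<^sup>-\<^sup>1\<close>, its coefficient
  sits in position \<open>- m\<close>.\<close>

definition fls_monom :: "int \<Rightarrow> 'a::zero \<Rightarrow> 'a fls" where
  "fls_monom m v = fls_shift m (fls_const v)"

lemma fls_monom_nth [simp]: "fls_nth (fls_monom m v) n = (if n = - m then v else 0)"
  by (auto simp: fls_monom_def)

lemma fls_monom_zero [simp]: "fls_monom m 0 = 0"
  by (rule fls_eqI) simp

lemma fls_monom_add: "fls_monom m (v + w) = fls_monom m v + (fls_monom m w :: 'a::monoid_add fls)"
  by (rule fls_eqI) simp

lemma fls_monom_diff: "fls_monom m (v - w) = fls_monom m v - (fls_monom m w :: 'a::group_add fls)"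
  by (rule fls_eqI) simp

lemma fls_monom_minus: "fls_monom m (- v) = - (fls_monom m v :: 'a::group_add fls)"
  by (rule fls_eqI) simp

lemma fls_monom_conv [simp]:
  "fls_monom 0 v = fls_const v" "fls_monom (-1) 1 = fls_X" "fls_monom 1 1 = fls_X_inv"
  by (rule fls_eqI; simp)+

lemma fls_monom_eq_0_iff [simp]: "fls_monom m v = 0 \<longleftrightarrow> v = 0"
  by (auto simp: fls_eq_iff)

context vector_space
begin

lemmas lscale_nth_sum = fls_bilinear_nth_sum[of _ scale, simplified]

lemma lscale_monom_nth:
  fixes r :: 'a and v :: "'b fls"
  shows "fls_nth (laurent_scale scale (fls_monom i r) v) n = scale r (fls_nth v (n + i))"
  by (subst lscale_nth_sum[of "{-i}"]) auto

lemma lscale_monom: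
  fixes r :: 'a and v :: 'b
  shows "laurent_scale scale (fls_monom i r) (fls_monom j v) = fls_monom (i + j) (scale r v)"
  by (rule fls_eqI) (simp add: lscale_monom_nth)

lemma lscale_const_nth:
  fixes a :: "'a fls" and v :: 'b
  shows "fls_nth (laurent_scale scale a (fls_const v)) n = scale (fls_nth a n) v"
  by (subst lscale_nth_sum[of "{n}"]) auto

lemma lscale_monom_right_nth:
  fixes a :: "'a fls" and v :: 'b
  shows "fls_nth (laurent_scale scale a (fls_monom m v)) n = scale (fls_nth a (n + m)) v"
  by (subst lscale_nth_sum[of "{n + m}"]) auto

lemma lscale_times:
  fixes a b :: "'a fls" and v :: "'b fls"
  shows "laurent_scale scale a (laurent_scale scale b v) = laurent_scale scale (a * b) v"
proof (rule fls_eqI)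
  fix n
  define p q r where "p = fls_subdegree a" and "q = fls_subdegree b" and "r = fls_subdegree v"
  \<comment> \<open>Two fixed ranges that cover all nonzero terms, so that the double sum is over a
    rectangle and can be swapped.\<close>
  let ?I = "{p..n - q - r}" and ?J = "{p + q..n - r}"
  have "fls_nth (laurent_scale scale (a * b) v) n = (\<Sum>j\<in>?J. scale (fls_nth (a * b) j) (fls_nth v (n - j)))"
    by (rule lscale_nth_sum) (auto simp: p_def q_def r_def not_le fls_times_nth_eq0)
  also have "\<dots> = (\<Sum>j\<in>?J. \<Sum>i\<in>?I. scale (fls_nth a i * fls_nth b (j - i)) (fls_nth v (n - j)))"
  proof (intro sum.cong refl)
    fix j assume "j \<in> ?J"
    then have "fls_nth (a * b) j = (\<Sum>i\<in>?I. fls_nth a i * fls_nth b (j - i))"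
      by (intro fls_times_nth_sum) (auto simp: p_def q_def r_def not_le)
    then show "scale (fls_nth (a * b) j) (fls_nth v (n - j)) =
        (\<Sum>i\<in>?I. scale (fls_nth a i * fls_nth b (j - i)) (fls_nth v (n - j)))"
      by (simp add: scale_sum_left)
  qed
  also have "\<dots> = (\<Sum>i\<in>?I. \<Sum>j\<in>?J. scale (fls_nth a i * fls_nth b (j - i)) (fls_nth v (n - j)))"
    by (rule sum.swap)
  also have "\<dots> = (\<Sum>i\<in>?I. scale (fls_nth a i) (fls_nth (laurent_scale scale b v) (n - i)))"
  proof (intro sum.cong refl)
    fix i assume i: "i \<in> ?I"
    have "fls_nth (laurent_scale scale b v) (n - i) =
        (\<Sum>k\<in>(\<lambda>j. j - i) ` ?J. scale (fls_nth b k) (fls_nth v (n - i - k)))"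
    proof (rule lscale_nth_sum)
      fix k assume "k \<notin> (\<lambda>j. j - i) ` ?J"
      then have "k + i \<notin> ?J" by (auto simp: image_iff)
      then have "k < q \<or> n - i - k < r" using i by auto
      then show "fls_nth b k = 0 \<or> fls_nth v (n - i - k) = 0" by (auto simp: q_def r_def)
    qed simp
    also have "\<dots> = (\<Sum>j\<in>?J. scale (fls_nth b (j - i)) (fls_nth v (n - j)))"
      by (subst sum.reindex) (auto simp: inj_on_def)
    finally show "(\<Sum>j\<in>?J. scale (fls_nth a i * fls_nth b (j - i)) (fls_nth v (n - j))) =
        scale (fls_nth a i) (fls_nth (laurent_scale scale b v) (n - i))"
      by (simp add: scale_sum_right)
  qed
  also have "\<dots> = fls_nth (laurent_scale scale a (laurent_scale scale b v)) n"
  proof (rule lscale_nth_sum[symmetric])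
    fix i assume "i \<notin> ?I"
    moreover have "fls_nth (laurent_scale scale b v) (n - i) = 0" if "n - i < q + r"
      using that by (simp add: fls_bilinear_nth q_def r_def)
    ultimately show "fls_nth a i = 0 \<or> fls_nth (laurent_scale scale b v) (n - i) = 0" by (auto simp: p_def)
  qed simp
  finally show "fls_nth (laurent_scale scale a (laurent_scale scale b v)) n = fls_nth (laurent_scale scale (a * b) v) n" by simp
qed

lemma vector_space_lscale: "vector_space (laurent_scale scale)"
proof
  fix a b :: "'a fls" and v w :: "'b fls"
  show "laurent_scale scale a (v + w) = laurent_scale scale a v + laurent_scale scale a w"
  proof (rule fls_eqI)
    fix n
    \<comment> \<open>The subdegree of \<open>v + w\<close> can exceed both of the others; the
      minimum gives one window for all three.\<close>
    let ?S = "{fls_subdegree a..n - min (fls_subdegree v) (fls_subdegree w)}"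
    have "fls_nth (laurent_scale scale a u) n = (\<Sum>i\<in>?S. scale (fls_nth a i) (fls_nth u (n - i)))"
      if "u \<in> {v, w, v + w}" for u
      using that by (intro lscale_nth_sum) (auto simp: not_le)
    then show "fls_nth (laurent_scale scale a (v + w)) n = fls_nth (laurent_scale scale a v + laurent_scale scale a w) n"
      by (simp add: scale_right_distrib sum.distrib)
  qed
  show "laurent_scale scale (a + b) v = laurent_scale scale a v + laurent_scale scale b v"
  proof (rule fls_eqI)
    fix n
    let ?S = "{min (fls_subdegree a) (fls_subdegree b)..n - fls_subdegree v}"
    have "fls_nth (laurent_scale scale c v) n = (\<Sum>i\<in>?S. scale (fls_nth c i) (fls_nth v (n - i)))"
      if "c \<in> {a, b, a + b}" for c
      using that by (intro lscale_nth_sum) (auto simp: not_le)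
    then show "fls_nth (laurent_scale scale (a + b) v) n = fls_nth (laurent_scale scale a v + laurent_scale scale b v) n"
      by (simp add: scale_left_distrib sum.distrib)
  qed
  show "laurent_scale scale a (laurent_scale scale b v) = laurent_scale scale (a * b) v" by (rule lscale_times)
  show "laurent_scale scale 1 v = v"
    using lscale_monom_nth[of 0 1 v] by (intro fls_eqI) simp
qed

text \<open>This is where finite dimension enters: the coordinates of the coefficients in a finite
  basis are themselves Laurent series.\<close>

lemma laurent_span_UNIV:
  assumes "finite B" "span B = UNIV"
  shows "laurent_span scale UNIV = UNIV"
proof -
  interpret L: vector_space "laurent_scale scale" by (rule vector_space_lscale)
  obtain C where C: "independent C" "span C = UNIV" "finite C"
  proof -
    obtain C where "C \<subseteq> UNIV" "independent C" "UNIV \<subseteq> span C"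
      using maximal_independent_subset[of UNIV] by blast
    then show ?thesis using independent_span_bound[OF assms(1), of C] assms(2) that by auto
  qed
  have "a \<in> laurent_span scale UNIV" for a
  proof -
    \<comment> \<open>The coordinates vanish below the subdegree of \<open>a\<close>, so
      \<open>Abs_fls\<close> is applied to a genuine Laurent series.\<close>
    define p where "p b = Abs_fls (\<lambda>n. representation C (fls_nth a n) b)" for b
    have p: "fls_nth (p b) n = representation C (fls_nth a n) b" for b n
      unfolding p_def
      by (rule nth_Abs_fls_lower_bound[of "fls_subdegree a"]) (simp add: representation_zero)
    have nth_sum: "fls_nth (sum v I) n = (\<Sum>i\<in>I. fls_nth (v i) n)" for v :: "'b \<Rightarrow> 'b fls" and I n
      by (induction I rule: infinite_finite_induct) simp_all
    have "a = (\<Sum>b\<in>C. laurent_scale scale (p b) (fls_const b))"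
    proof (rule fls_eqI)
      fix n
      have "(\<Sum>b\<in>C. scale (representation C (fls_nth a n) b) b) = fls_nth a n"
        by (rule sum_representation_eq[OF C(1) _ C(3)]) (use C(2) in auto)
      then show "fls_nth a n = fls_nth (\<Sum>b\<in>C. laurent_scale scale (p b) (fls_const b)) n"
        by (simp add: nth_sum lscale_const_nth p)
    qed
    also have "\<dots> \<in> laurent_span scale UNIV"
      unfolding laurent_span_def by (intro L.span_sum L.span_scale L.span_base imageI UNIV_I)
    finally show ?thesis .
  qed
  then show ?thesis by blast
qed

text \<open>Series with all coefficients in \<open>V\<close> form a subspace containing the
  constants from \<open>V\<close>. Directness of sums can thus be tested coefficientwise.\<close>

lemma laurent_span_nth:
  assumes "subspace V" "a \<in> laurent_span scale V"
  shows "fls_nth a n \<in> V"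
proof -
  interpret L: vector_space "laurent_scale scale" by (rule vector_space_lscale)
  have "L.subspace {a. \<forall>n. fls_nth a n \<in> V}"
    using assms(1) by (auto simp: L.subspace_def fls_bilinear_nth subspace_0 subspace_add
        intro!: subspace_sum subspace_scale)
  moreover have "fls_const ` V \<subseteq> {a. \<forall>n. fls_nth a n \<in> V}"
    using assms(1) by (auto simp: subspace_0)
  ultimately show ?thesis using L.span_minimal assms(2) unfolding laurent_span_def by blast
qed

end

section \<open>The cyclic element acting on Laurent series\<close>

context embedded_minimal
begin

abbreviation lscale :: "'a fls \<Rightarrow> 'b fls \<Rightarrow> 'b fls" where
  "lscale \<equiv> laurent_scale scale"

sublocale L: vector_space lscale
  by (rule vector_space_lscale)

definition \<Lambda> :: "'b fls" where
  "\<Lambda> = fls_const f + lscale fls_X_inv (fls_const s)"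

definition T :: "'b fls \<Rightarrow> 'b fls" where
  "T = laurent_bracket br \<Lambda>"

lemma \<Lambda>_conv: "\<Lambda> = fls_monom 0 f + fls_monom 1 s"
  using lscale_monom[of 1 1 0 s] by (simp add: \<Lambda>_def)

text \<open>Since \<open>z\<close> is \<open>fls_X_inv\<close>, \<open>z s\<close> sits in position
  -1 and picks up the coefficient at \<open>n + 1\<close>.\<close>

lemma T_nth: "fls_nth (T a) n = br f (fls_nth a n) + br s (fls_nth a (n + 1))"
  unfolding T_def by (subst fls_bilinear_nth_sum[of "{-1, 0}"]) (auto simp: \<Lambda>_conv)

lemma linear_T: "Vector_Spaces.linear lscale lscale T"
proof -
  have "T (v + w) = T v + T w" for v w
    by (rule fls_eqI) (simp add: T_nth bracket_add_right)
  moreover have "T (lscale c v) = lscale c (T v)" for c v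
  proof (rule fls_eqI)
    fix n
    \<comment> \<open>The upper end is \<open>n + 1\<close> rather than \<open>n\<close>, so that
      one window serves both coefficients in \<open>T_nth\<close>.\<close>
    let ?S = "{fls_subdegree c..n + 1 - fls_subdegree v}"
    have "fls_nth (lscale c v) m = (\<Sum>i\<in>?S. scale (fls_nth c i) (fls_nth v (m - i)))"
      if "m \<le> n + 1" for m
      using that by (intro lscale_nth_sum) (auto simp: not_le)
    moreover have "fls_nth (lscale c (T v)) n = (\<Sum>i\<in>?S. scale (fls_nth c i) (fls_nth (T v) (n - i)))"
      by (intro lscale_nth_sum) (auto simp: not_le T_nth)
    ultimately show "fls_nth (T (lscale c v)) n = fls_nth (lscale c (T v)) n"
      by (simp add: T_nth bracket_sum_right bracket_scale_right scale_right_distrib sum.distrib algebra_simps)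
  qed
  ultimately show ?thesis by unfold_locales
qed

sublocale T: Vector_Spaces.linear lscale lscale T
  by (rule linear_T)

lemma T_monom: "T (fls_monom m v) = fls_monom m (br f v) + fls_monom (m + 1) (br s v)"
  by (rule fls_eqI) (auto simp: T_nth)

text \<open>The nonzero eigenvalues of \<open>T\<^sup>6\<close>: \<open>9 b z\<^sup>4\<close> on the adjoint \<open>sl\<^sub>3\<close> and \<open>- b z\<^sup>4 / 3\<close> on the
  three-dimensional \<open>sl\<^sub>3\<close>-modules in the algebra.\<close>

definition c1 where "c1 = fls_monom 4 (9 * b)"
definition c2 where "c2 = fls_monom 4 (- b / 3)"

text \<open>Kernel of the expected annihilating polynomial. It is a \<open>T\<close>-invariant
  subspace over the Laurent series, so a few generators and their orbits suffice to show that it is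
  everything.\<close>

definition N where
  "N = {v. T ((T ^^ 6) ((T ^^ 6) v) - lscale (c1 + c2) ((T ^^ 6) v) + lscale (c1 * c2) v) = 0}"

lemma br_s_s: "br s s = 0" and br_f_f: "br f f = 0"
  by (rule bracket_self)+

lemma lscale_X [simp]:
  "lscale fls_X_inv (fls_const v) = fls_monom 1 v" "lscale fls_X (fls_const v) = fls_monom (-1) v"
  using lscale_monom[of 1 1 0 v] lscale_monom[of "-1" 1 0 v] by simp_all

definition Fz where "Fz = fls_const (scale 2 f) - lscale fls_X_inv (fls_const s)"
definition Ez where "Ez = fls_const (scale 2 e) - lscale fls_X (fls_const t)"
definition Ek where "Ek = fls_const e + lscale fls_X (fls_const t)"

lemma Fz_conv: "Fz = fls_monom 0 (scale 2 f) - fls_monom 1 s"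
  and Ez_conv: "Ez = fls_monom 0 (scale 2 e) - fls_monom (-1) t"
  and Ek_conv: "Ek = fls_monom 0 e + fls_monom (-1) t"
  by (simp_all add: Fz_def Ez_def Ek_def)

lemma T_\<Lambda>: "T \<Lambda> = 0"
  using bracket_swap[of s f]
  by (simp add: \<Lambda>_conv T.add T_monom br_s_s br_f_f fls_monom_minus flip: fls_monom_conv)

lemma T_Ek: "T Ek = 0"
  by (simp add: Ek_conv T.add T_monom f_e s_e f_t s_t fls_monom_minus flip: fls_monom_conv)

lemma T_g0s: "g \<in> gr 0 \<Longrightarrow> br s g = 0 \<Longrightarrow> T (fls_const g) = 0"
  using T_monom[of 0 g] f_centralizer by simp

lemma T_x: "T (fls_const (scale 2 x)) = Fz"
  using T_monom[of 0 "scale 2 x"]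
  by (simp add: Fz_conv bracket_scale_right f_x s_x fls_monom_minus)

lemma T_Ez: "T (lscale (- (1 / 6)) Ez) = fls_const x"
proof -
  have "(- (1 / 6) :: 'a fls) = fls_monom 0 (- (1 / 6))"
    using fls_const_divide_const[of "1 :: 'a" 6] by (simp add: fls_monom_minus)
  \<comment> \<open>The -6 is -4 from \<open>2 [f, e]\<close> plus -2 from \<open>- [s, t]\<close>;
    the terms \<open>[f, t]\<close> and \<open>[s, e]\<close> vanish.\<close>
  moreover have "T Ez = fls_monom 0 (scale (-6) x)"
    using fls_monom_add[of 0 "scale (-4) x" "scale (-2) x"]
    by (simp add: Ez_conv T.diff T_monom bracket_scale_right bracket_minus_right f_e s_e f_t s_t
        flip: fls_monom_diff fls_monom_conv scale_left_distrib scale_left_diff_distrib scale_minus_left)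
  ultimately show ?thesis
    by (simp only: T.scale lscale_monom) simp
qed

lemma T_s': "T (lscale fls_X (fls_const s')) = Ez"
  by (simp add: Ez_conv T_monom f_s' s_s' fls_monom_minus)

lemma T_U:
  assumes "u \<in> U"
  shows "T (fls_const u) = fls_const (br f u)"
    and "T (lscale fls_X (fls_const (br f u))) = fls_const (br s (br f u))"
    and "T (lscale fls_X (fls_const (br s (br f u)))) = fls_const (br s (br s (br f u)))"
  using T_monom[of 0 u] assms
  by (simp_all add: T_monom f_f_U f_s_f_U U_def)

text \<open>Powers of \<open>z\<close> are scalars here, so membership of monomials does not depend
  on the exponent.\<close>

lemma monom_scale_mem:
  assumes "L.subspace W" "fls_monom m v \<in> W"
  shows "fls_monom n (scale r v) \<in> W"
  using L.subspace_scale[OF assms, of "fls_monom (n - m) r"] lscale_monom[of "n - m" r m v] by simp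

lemma monom_mem:
  assumes "L.subspace W" "fls_monom m (scale r v) \<in> W" "r \<noteq> 0"
  shows "fls_monom n v \<in> W"
  using monom_scale_mem[OF assms(1,2), of n "1 / r"] assms(3) by simp

text \<open>Applied both to \<open>N\<close> and to the sum of the two claimed subspaces.
  \<open>\<Lambda> + Fz = 3 f\<close> and \<open>Ek + Ez = 3 e\<close> recover \<open>f\<close>,
  \<open>s\<close>, \<open>e\<close> and \<open>t\<close>; the splittings of the graded pieces give
  the rest.\<close>

lemma subspace_eq_UNIV:
  assumes fin: "finite B" "span B = UNIV" and W: "L.subspace W"
    and mem: "\<Lambda> \<in> W" "Fz \<in> W" "Ek \<in> W" "Ez \<in> W" "fls_const x \<in> W"
    and g0s: "\<And>g. g \<in> gr 0 \<Longrightarrow> br s g = 0 \<Longrightarrow> fls_const g \<in> W"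
    and U: "\<And>u. u \<in> U \<Longrightarrow> fls_const (br f u) \<in> W" "\<And>u. u \<in> U \<Longrightarrow> fls_const (br s (br f u)) \<in> W"
      "\<And>u. u \<in> U \<Longrightarrow> fls_const (br s (br s (br f u))) \<in> W"
  shows "W = UNIV"
proof -
  note add = L.subspace_add[OF W] and diff = L.subspace_diff[OF W]
  have scale: "fls_const (scale r v) \<in> W" if "fls_const v \<in> W" for r v
    using monom_scale_mem[OF W, of 0 v 0 r] that by simp
  have const_add: "fls_const (v + w) \<in> W" if "fls_const v \<in> W" "fls_const w \<in> W" for v w
    using add[OF that] fls_monom_add[of 0 v w] by simp
  have "\<Lambda> + Fz = fls_monom 0 (scale 3 f)"
    using scale_left_distrib[of 1 2 f] by (simp add: \<Lambda>_conv Fz_conv flip: fls_monom_conv fls_monom_add)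
  then have f: "fls_const f \<in> W" using monom_mem[OF W, of 0 3 f 0] add[OF mem(1,2)] by simp
  have "\<Lambda> - fls_const f = fls_monom 1 s" by (simp add: \<Lambda>_conv)
  then have s: "fls_const s \<in> W" using monom_mem[OF W, of 1 1 s 0] diff[OF mem(1) f] by simp
  have "Ek + Ez = fls_monom 0 (scale 3 e)"
    using scale_left_distrib[of 1 2 e] by (simp add: Ek_conv Ez_conv flip: fls_monom_conv fls_monom_add)
  then have e: "fls_const e \<in> W" using monom_mem[OF W, of 0 3 e 0] add[OF mem(3,4)] by simp
  have "Ek - fls_const e = fls_monom (-1) t" by (simp add: Ek_conv)
  then have t: "fls_const t \<in> W" using monom_mem[OF W, of "-1" 1 t 0] diff[OF mem(3) e] by simp
  have "fls_const v \<in> W" for v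
  proof -
    obtain a b c d k where v: "a \<in> gr (-2)" "b \<in> gr (-1)" "c \<in> gr 0" "d \<in> gr 1" "k \<in> gr 2"
      "v = a + b + c + d + k"
      by (rule gr_decomposition)
    obtain r where "a = scale r f" using gr_minus_2[OF v(1)] .
    then have a: "fls_const a \<in> W" using scale f by simp
    obtain r u where "u \<in> U" "b = scale r t + br f u" using gr_minus_1_sum[OF v(2)] .
    then have b: "fls_const b \<in> W" using const_add scale t U(1) by simp
    obtain r g u where "g \<in> gr 0" "br s g = 0" "u \<in> U" "c = g + scale r x + br s (br f u)"
      using gr_0_sum[OF v(3)] .
    then have c: "fls_const c \<in> W" using const_add scale mem(5) g0s U(2) by simp
    obtain r u where "u \<in> U" "d = scale r s + br s (br s (br f u))" using gr_1_sum[OF v(4)] .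
    then have d: "fls_const d \<in> W" using const_add scale s U(3) by simp
    obtain r where "k = scale r e" using gr_2[OF v(5)] .
    then have k: "fls_const k \<in> W" using scale e by simp
    show ?thesis unfolding v(6) by (intro const_add a b c d k)
  qed
  then have "laurent_span scale UNIV \<subseteq> W"
    unfolding laurent_span_def by (intro L.span_minimal W) auto
  then show ?thesis using laurent_span_UNIV[OF fin] by blast
qed

section \<open>The annihilating polynomial of \<open>T\<close>\<close>

lemma T_pow_add: "(T ^^ i) (v + w) = (T ^^ i) v + (T ^^ i) w"
  and T_pow_scale: "(T ^^ i) (lscale c v) = lscale c ((T ^^ i) v)"
  by (induction i) (simp_all add: T.add T.diff T.scale)

lemma c_nonzero: "c1 \<noteq> 0" "c2 \<noteq> 0" "c1 \<noteq> c2"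
proof -
  show "c1 \<noteq> 0" "c2 \<noteq> 0" using b_nonzero by (simp_all add: c1_def c2_def)
  have "9 * b - (- b / 3) = b * (28 / 3)" by (simp add: field_simps)
  also have "\<dots> \<noteq> 0" using b_nonzero by simp
  finally have "c1 - c2 \<noteq> 0"
    unfolding c1_def c2_def fls_monom_diff[symmetric] fls_monom_eq_0_iff .
  then show "c1 \<noteq> c2" by simp
qed

lemma N_subspace: "L.subspace N"
proof -
  define p where "p v = T ((T ^^ 6) ((T ^^ 6) v) - lscale (c1 + c2) ((T ^^ 6) v) + lscale (c1 * c2) v)" for v
  have "p (v + w) = p v + p w" for v w
    by (simp add: p_def T_pow_add T.add T.diff L.scale_right_distrib)
  moreover have "p (lscale c v) = lscale c (p v)" for c v
    by (simp add: p_def T_pow_scale T.add T.diff T.scale L.scale_right_distrib L.scale_right_diff_distrib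
        mult.commute)
  moreover have "p 0 = 0" using \<open>\<And>v w. p (v + w) = p v + p w\<close>[of 0 0] by simp
  ultimately show ?thesis unfolding N_def p_def[symmetric] L.subspace_def by simp
qed

lemma N_T: "v \<in> N \<Longrightarrow> T v \<in> N"
proof -
  let ?q = "\<lambda>v. (T ^^ 6) ((T ^^ 6) v) - lscale (c1 + c2) ((T ^^ 6) v) + lscale (c1 * c2) v"
  assume v: "v \<in> N"
  have "(T ^^ 6) (T u) = T ((T ^^ 6) u)" for u by (simp only: funpow_swap1)
  then have "T (?q (T v)) = T (T (?q v))" by (simp only: T.add T.diff T.scale)
  also have "\<dots> = 0" using v by (simp add: N_def T.zero)
  finally show ?thesis by (simp add: N_def)
qed

lemma N_ker: "T v = 0 \<Longrightarrow> v \<in> N"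
proof -
  assume v: "T v = 0"
  have "(T ^^ 6) v = (T ^^ 5) (T v)" by (simp add: numeral_eq_Suc funpow_swap1)
  moreover have "(T ^^ i) 0 = 0" for i by (induction i) (simp_all add: T.zero)
  ultimately show ?thesis using v by (simp add: N_def T.scale)
qed

lemma N_eigenvector: "(T ^^ 6) v = lscale c v \<Longrightarrow> c \<in> {c1, c2} \<Longrightarrow> v \<in> N"
proof -
  assume v: "(T ^^ 6) v = lscale c v" and c: "c \<in> {c1, c2}"
  have "c * c - (c1 + c2) * c + c1 * c2 = 0" using c by (auto simp: algebra_simps)
  moreover have "(T ^^ 6) ((T ^^ 6) v) - lscale (c1 + c2) ((T ^^ 6) v) + lscale (c1 * c2) v =
      lscale (c * c - (c1 + c2) * c + c1 * c2) v"
    by (simp add: v T_pow_scale L.scale_left_distrib L.scale_left_diff_distrib)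
  ultimately show ?thesis by (simp add: N_def T.zero)
qed

text \<open>\<open>f\<close> lowers the degree by 2, and \<open>s\<close> raises it by 1 with a
  factor \<open>z\<close>. A closed walk of six steps therefore uses \<open>f\<close> twice and
  \<open>s\<close> four times, whence \<open>z^4\<close>.\<close>

lemma T_orbit_x:
  "T (fls_monom 0 x) = fls_monom 0 f + fls_monom 1 (scale (- (1/2)) s)" (is "T ?x = ?x1")
  "T (T (fls_monom 0 x)) = fls_monom 1 (scale (- (3/2)) y)"
  "T (T (T (fls_monom 0 x))) = fls_monom 2 (scale (- (3/2)) k)"
  "T (T (T (T (fls_monom 0 x)))) = fls_monom 3 (scale (- (3/2) * b) s')"
  "T (T (T (T (T (fls_monom 0 x))))) = fls_monom 3 (scale (3/2 * b) t) + fls_monom 4 (scale (- 3 * b) e)"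
  "T (T (T (T (T (T (fls_monom 0 x)))))) = fls_monom 4 (scale (9 * b) x)"
proof -
  note br = bracket_scale_right bracket_minus_right bracket_zero_right
  show 1: "T ?x = ?x1" by (simp add: T_monom f_x s_x fls_monom_minus del: fls_monom_conv)
  have "T (T ?x) = fls_monom 1 (br s f + scale (- (1/2)) (br f s)) + fls_monom 2 (scale (- (1/2)) (br s s))"
    unfolding 1 by (simp add: T.add T.diff T.neg T_monom br fls_monom_add fls_monom_diff fls_monom_minus br_f_f br_s_s del: fls_monom_conv)
  also have "br s f + scale (- (1/2)) (br f s) = scale (-1 - 1/2) y"
    unfolding s_f y_def[symmetric] by (simp only: scale_left_diff_distrib) simp
  finally show 2: "T (T ?x) = fls_monom 1 (scale (- (3/2)) y)" by (simp add: br_s_s del: fls_monom_conv)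
  show 3: "T (T (T ?x)) = fls_monom 2 (scale (- (3/2)) k)"
    unfolding 2 by (simp add: T.neg fls_monom_minus T_monom br f_y flip: k_def)
  show 4: "T (T (T (T ?x))) = fls_monom 3 (scale (- (3/2) * b) s')"
    unfolding 3 by (simp add: T.neg fls_monom_minus T_monom br f_k s_k)
  show 5: "T (T (T (T (T ?x)))) = fls_monom 3 (scale (3/2 * b) t) + fls_monom 4 (scale (- 3 * b) e)"
    unfolding 4 by (simp add: T.neg fls_monom_minus T_monom br f_s' s_s')
  have "T (T (T (T (T (T ?x))))) = fls_monom 4 (scale (3/2 * b * 2) x + scale (- 3 * b * - 2) x)"
    unfolding 5 by (simp add: T.add T.diff T.neg T_monom br f_t s_t f_e s_e fls_monom_add fls_monom_diff fls_monom_minus)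
  also have "scale (3/2 * b * 2) x + scale (- 3 * b * - 2) x = scale (9 * b) x"
  proof -
    have "3/2 * b * 2 + - 3 * b * - 2 = 9 * b" by simp
    then show ?thesis by (simp only: scale_left_distrib[symmetric])
  qed
  finally show "T (T (T (T (T (T ?x))))) = fls_monom 4 (scale (9 * b) x)" .
qed

lemma N_orbit_x: "fls_const x \<in> N" "Fz \<in> N" "Ez \<in> N" "fls_const y \<in> N" "fls_const k \<in> N" "fls_const s' \<in> N"
proof -
  have "(T ^^ 6) (fls_monom 0 x) = lscale c1 (fls_monom 0 x)"
    unfolding c1_def lscale_monom by (simp add: T_orbit_x(6) numeral_eq_Suc del: fls_monom_conv)
  then have x: "fls_monom 0 x \<in> N" by (rule N_eigenvector) simp
  then show "fls_const x \<in> N" by simp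
  have "fls_const (scale 2 x) \<in> N" using monom_scale_mem[OF N_subspace x, of 0 2] by simp
  then show "Fz \<in> N" unfolding T_x[symmetric] by (rule N_T)
  note T1 = N_T[OF x] and T2 = N_T[OF N_T[OF x]]
  note T3 = N_T[OF T2] and T4 = N_T[OF N_T[OF T2]]
  show "fls_const y \<in> N" using monom_mem[OF N_subspace T2[unfolded T_orbit_x(2)], of 0] by simp
  show "fls_const k \<in> N" using monom_mem[OF N_subspace T3[unfolded T_orbit_x(3)], of 0] by simp
  show "fls_const s' \<in> N" using monom_mem[OF N_subspace T4[unfolded T_orbit_x(4)], of 0] b_nonzero by simp
  then have "lscale fls_X (fls_const s') \<in> N" by (rule L.subspace_scale[OF N_subspace])
  then show "Ez \<in> N" unfolding T_s'[symmetric] by (rule N_T)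
qed

text \<open>The orbit of \<open>[f, u]\<close> passes through \<open>[s, [f, u]]\<close>,
  \<open>w\<close>, \<open>[f, w]\<close>, \<open>[s, [f, w]]\<close> and a multiple of
  \<open>u\<close> before closing; \<open>phi_phi_U0\<close> gives the scalar.\<close>

lemma N_U0:
  assumes u: "u \<in> U0"
  shows "fls_const (br f u) \<in> N" "fls_const (br s (br f u)) \<in> N" "fls_const (br s (br s (br f u))) \<in> N"
proof -
  define w where "w = br s (br s (br f u))"
  have uU: "u \<in> U" using u by (simp add: U0_def)
  have wU: "w \<in> U" unfolding w_def s_s_f_U[OF uU] using k_U0[OF u]
    by (simp add: U_def subspace_neg[OF subspace_gr] bracket_minus_right)
  let ?v = "fls_monom 0 (br f u)"
  have 1: "T ?v = fls_monom 1 (br s (br f u))" by (simp add: T_monom f_f_U[OF uU] del: fls_monom_conv)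
  have 2: "T (T ?v) = fls_monom 2 w" unfolding 1 by (simp add: T_monom f_s_f_U[OF uU] w_def)
  have 3: "T (T (T ?v)) = fls_monom 2 (br f w)"
    unfolding 2 using wU by (simp add: T_monom U_def)
  have 4: "T (T (T (T ?v))) = fls_monom 3 (br s (br f w))"
    unfolding 3 by (simp add: T_monom f_f_U[OF wU])
  have 5: "T (T (T (T (T ?v)))) = fls_monom 4 (scale (- b / 3) u)"
    unfolding 4 using phi_phi_U0[OF u, folded w_def] by (simp add: T_monom f_s_f_U[OF wU])
  have "T (T (T (T (T (T ?v))))) = lscale c2 ?v"
    unfolding 5 c2_def lscale_monom using uU
    by (simp add: T_monom bracket_scale_right bracket_minus_right U_def)
  then have "(T ^^ 6) ?v = lscale c2 ?v" by (simp add: numeral_eq_Suc del: fls_monom_conv)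
  then have v: "?v \<in> N" by (rule N_eigenvector) simp
  then show "fls_const (br f u) \<in> N" by simp
  show "fls_const (br s (br f u)) \<in> N" using monom_scale_mem[OF N_subspace N_T[OF v, unfolded 1], of 0 1] by simp
  show "fls_const (br s (br s (br f u))) \<in> N"
    using monom_scale_mem[OF N_subspace N_T[OF N_T[OF v], unfolded 2], of 0 1] by (simp add: w_def)
qed

text \<open>\<open>U\<close> is \<open>U0\<close> plus the line of \<open>s\<close>, and the chain
  starting from \<open>s\<close> runs through \<open>y\<close>, \<open>k\<close> and
  \<open>b s'\<close>, all in the orbit of \<open>x\<close>.\<close>

lemma N_UNIV:
  assumes "finite B" "span B = UNIV"
  shows "N = UNIV"
proof (rule subspace_eq_UNIV[OF assms N_subspace])
  show "\<Lambda> \<in> N" "Ek \<in> N" by (rule N_ker, rule T_\<Lambda> T_Ek)+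
  show "Fz \<in> N" "Ez \<in> N" "fls_const x \<in> N" by (rule N_orbit_x)+
  show "fls_const g \<in> N" if "g \<in> gr 0" "br s g = 0" for g
    by (rule N_ker, rule T_g0s[OF that])
  have add: "fls_const (v + scale r w) \<in> N" if "fls_const v \<in> N" "fls_const w \<in> N" for v w r
    using L.subspace_add[OF N_subspace that(1) monom_scale_mem[OF N_subspace, of 0 w 0 r]] that(2)
      fls_monom_add[of 0 v "scale r w"] by simp
  have ssfs: "br s (br f s) = k"
    by (simp flip: y_def k_def)
  fix u assume "u \<in> U"
  then obtain c w where w: "w \<in> U0" "u = w + scale c s" by (rule U_sum)
  show "fls_const (br f u) \<in> N"
    using add[OF N_U0(1)[OF w(1)] N_orbit_x(4), of c]
    by (simp add: w(2) bracket_add_right bracket_scale_right y_def)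
  show "fls_const (br s (br f u)) \<in> N"
    using add[OF N_U0(2)[OF w(1)] N_orbit_x(5), of c]
    by (simp add: w(2) bracket_add_right bracket_scale_right ssfs)
  show "fls_const (br s (br s (br f u))) \<in> N"
    using add[OF N_U0(3)[OF w(1)] N_orbit_x(6), of "c * b"]
    by (simp add: w(2) bracket_add_right bracket_scale_right ssfs s_k)
qed

lemma semisimple_T:
  assumes "finite B" "span B = UNIV"
  shows "semisimple_endo lscale T"
proof (rule L.semisimple_endo_if_annihilated[OF linear_T _ c_nonzero])
  show "T ((T ^^ 6) ((T ^^ 6) v) - lscale (c1 + c2) ((T ^^ 6) v) + lscale (c1 * c2) v) = 0" for v
    using N_UNIV[OF assms] by (auto simp: N_def)
  show "of_nat 6 \<noteq> (0 :: 'a fls)" by simp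
qed

text \<open>From \<open>T (T w) = 0\<close> only the constant term of the second factor survives on
  \<open>w\<close>, so \<open>c1 c2 T w = 0\<close>.\<close>

lemma ker_im_T:
  assumes "finite B" "span B = UNIV" and v: "T v = 0" "v = T w"
  shows "v = 0"
proof -
  have zero: "(T ^^ i) 0 = 0" for i by (induction i) (simp_all add: T.zero)
  have "(T ^^ 6) w = (T ^^ 4) (T (T w))" by (simp add: numeral_eq_Suc funpow_swap1)
  then have "(T ^^ 6) w = 0" using v zero by simp
  moreover have "w \<in> N" using N_UNIV[OF assms(1,2)] by simp
  ultimately have "lscale (c1 * c2) v = 0" using v by (simp add: N_def zero T.scale)
  then show ?thesis using c_nonzero by simp
qed

section \<open>Kernel and image of the cyclic element\<close>

definition g0s where "g0s = {g \<in> gr 0. br s g = 0}"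

definition h_parts where
  "h_parts = [laurent_line scale \<Lambda>, laurent_span scale g0s, laurent_line scale Ek]"

definition hp_parts where
  "hp_parts = [laurent_line scale Fz, laurent_line scale (fls_const x), laurent_line scale Ez,
     laurent_span scale (br f ` U), laurent_span scale (br s ` br f ` U),
     laurent_span scale (br s ` br s ` br f ` U)]"

lemma subspace_g0s: "subspace g0s"
  using subspace_gr[of 0] by (auto simp: g0s_def subspace_def bracket_add_right bracket_scale_right)

lemma subspace_U: "subspace U"
  using subspace_gr[of 1] by (auto simp: U_def subspace_def bracket_add_right bracket_scale_right)

lemma subspace_br_image: "subspace V \<Longrightarrow> subspace (br a ` V)"
  using linear_bracket_right[of a] unfolding module_hom_iff_linear[symmetric] by (rule module_hom.subspace_image)

lemma subspace_laurent_line: "L.subspace (laurent_line scale a)"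
  and subspace_laurent_span: "L.subspace (laurent_span scale V)"
  unfolding laurent_line_def laurent_span_def by (rule L.subspace_span)+

lemma laurent_line_subset: "L.subspace W \<Longrightarrow> a \<in> W \<Longrightarrow> laurent_line scale a \<subseteq> W"
  unfolding laurent_line_def by (rule L.span_minimal) simp_all

lemma laurent_span_subset:
  "L.subspace W \<Longrightarrow> (\<And>v. v \<in> V \<Longrightarrow> fls_const v \<in> W) \<Longrightarrow> laurent_span scale V \<subseteq> W"
  unfolding laurent_span_def by (rule L.span_minimal) (rule image_subsetI)

lemma subspace_parts: "V \<in> set h_parts \<Longrightarrow> L.subspace V" "V \<in> set hp_parts \<Longrightarrow> L.subspace V"
  unfolding h_parts_def hp_parts_def using subspace_laurent_line subspace_laurent_span by force+

lemma h_parts_ker: "sum_of h_parts \<subseteq> {v. T v = 0}"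
proof (rule L.sum_of_subset)
  show ker: "L.subspace {v. T v = 0}" by (rule T.subspace_kernel)
  have "\<forall>V\<in>set h_parts. V \<subseteq> {v. T v = 0}"
    unfolding h_parts_def list.set ball_simps
    by (intro conjI laurent_line_subset laurent_span_subset ker) (simp_all add: T_\<Lambda> T_Ek T_g0s g0s_def)
  then show "V \<subseteq> {v. T v = 0}" if "V \<in> set h_parts" for V
    using that by blast
qed

lemma hp_parts_im: "sum_of hp_parts \<subseteq> range T"
proof (rule L.sum_of_subset)
  show im: "L.subspace (range T)" by (rule T.subspace_image) simp
  have "Fz \<in> range T" "fls_const x \<in> range T" "Ez \<in> range T"
    unfolding T_x[symmetric] T_Ez[symmetric] T_s'[symmetric] by (rule rangeI)+
  moreover have U: "fls_const (br f u) \<in> range T" "fls_const (br s (br f u)) \<in> range T"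
    "fls_const (br s (br s (br f u))) \<in> range T" if "u \<in> U" for u
    unfolding T_U[OF that, symmetric] by (rule rangeI)+
  ultimately have "\<forall>V\<in>set hp_parts. V \<subseteq> range T"
    unfolding hp_parts_def list.set ball_simps
    by (intro conjI laurent_line_subset laurent_span_subset im TrueI) (auto simp del: fls_monom_conv)
  then show "V \<subseteq> range T" if "V \<in> set hp_parts" for V
    using that by blast
qed

lemma sum_h_hp:
  assumes "finite B" "span B = UNIV"
  shows "sum_of [sum_of h_parts, sum_of hp_parts] = UNIV"
proof (rule subspace_eq_UNIV[OF assms])
  let ?W = "sum_of [sum_of h_parts, sum_of hp_parts]"
  have sub: "L.subspace (sum_of h_parts)" "L.subspace (sum_of hp_parts)"
    by (intro L.subspace_sum_of subspace_parts; assumption)+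
  then have sub': "V \<in> set [sum_of h_parts, sum_of hp_parts] \<Longrightarrow> L.subspace V" for V by auto
  show "L.subspace ?W" by (rule L.subspace_sum_of) (erule sub')
  have W: "sum_of h_parts \<subseteq> ?W" "sum_of hp_parts \<subseteq> ?W"
    by (rule L.subset_sum_of, erule sub', simp)+
  have h: "V \<subseteq> ?W" if "V \<in> set h_parts" for V
    using L.subset_sum_of[OF subspace_parts(1) that] W(1) by (rule subset_trans)
  have hp: "V \<subseteq> ?W" if "V \<in> set hp_parts" for V
    using L.subset_sum_of[OF subspace_parts(2) that] W(2) by (rule subset_trans)
  have line: "a \<in> laurent_line scale a" for a
    unfolding laurent_line_def by (rule L.span_base) simp
  have span: "fls_const v \<in> laurent_span scale V" if "v \<in> V" for v V
    unfolding laurent_span_def using that by (intro L.span_base) simp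
  show "\<Lambda> \<in> ?W" "Ek \<in> ?W"
    by (rule subsetD[OF h line], simp add: h_parts_def)+
  show "Fz \<in> ?W" "Ez \<in> ?W" "fls_const x \<in> ?W"
    by (rule subsetD[OF hp line], simp add: hp_parts_def)+
  show "fls_const g \<in> ?W" if "g \<in> gr 0" "br s g = 0" for g
    by (rule subsetD[OF h span[of _ g0s]]) (use that in \<open>auto simp: h_parts_def g0s_def\<close>)
  fix u assume u: "u \<in> U"
  show "fls_const (br f u) \<in> ?W"
    by (rule subsetD[OF hp span[of _ "br f ` U"]]) (use u in \<open>auto simp: hp_parts_def\<close>)
  show "fls_const (br s (br f u)) \<in> ?W"
    by (rule subsetD[OF hp span[of _ "br s ` br f ` U"]]) (use u in \<open>auto simp: hp_parts_def\<close>)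
  show "fls_const (br s (br s (br f u))) \<in> ?W"
    by (rule subsetD[OF hp span[of _ "br s ` br s ` br f ` U"]]) (use u in \<open>auto simp: hp_parts_def\<close>)
qed

text \<open>No dimensions are counted: the two sums lie in the kernel and the image and together
  give everything. As kernel and image meet in 0, neither inclusion can be strict.\<close>

lemma h_hp_eq:
  assumes fin: "finite B" "span B = UNIV"
  shows "sum_of h_parts = {v. T v = 0}" "sum_of hp_parts = range T"
proof -
  have decomp: "\<exists>p q. v = p + q \<and> p \<in> sum_of h_parts \<and> q \<in> sum_of hp_parts" for v
  proof -
    have "v \<in> sum_of [sum_of h_parts, sum_of hp_parts]" using sum_h_hp[OF fin] by simp
    then show ?thesis unfolding sum_of_2 by blast
  qed
  have "v \<in> sum_of h_parts" if v: "T v = 0" for v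
  proof -
    obtain p q where pq: "v = p + q" "p \<in> sum_of h_parts" "q \<in> sum_of hp_parts" using decomp by blast
    obtain w where "q = T w" using pq(3) hp_parts_im by blast
    moreover have "T p = 0" using pq(2) h_parts_ker by blast
    then have "T q = 0" using v pq(1) by (simp add: T.add)
    ultimately have "q = 0" using ker_im_T[OF fin] by blast
    then show ?thesis using pq by simp
  qed
  then show "sum_of h_parts = {v. T v = 0}" using h_parts_ker by blast
  have "T v \<in> sum_of hp_parts" for v
  proof -
    obtain p q where pq: "T v = p + q" "p \<in> sum_of h_parts" "q \<in> sum_of hp_parts" using decomp by blast
    obtain w where w: "q = T w" using pq(3) hp_parts_im by blast
    have "T p = 0" using pq(2) h_parts_ker by blast
    moreover have "p = T (v - w)" using pq(1) w by (simp add: T.diff)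
    ultimately have "p = 0" using ker_im_T[OF fin] by blast
    then show ?thesis using pq by simp
  qed
  then show "sum_of hp_parts = range T" using hp_parts_im by blast
qed

lemma direct_h_hp:
  assumes fin: "finite B" "span B = UNIV"
  shows "direct_sum_of [sum_of h_parts, sum_of hp_parts] UNIV"
proof -
  have "direct_sum_of [sum_of h_parts, sum_of hp_parts] (sum_of [sum_of h_parts, sum_of hp_parts])"
  proof (rule L.direct_sum_ofI)
    show "L.subspace V" if "V \<in> set [sum_of h_parts, sum_of hp_parts]" for V
      using that L.subspace_sum_of[of h_parts] L.subspace_sum_of[of hp_parts] subspace_parts by auto
    fix l assume l: "l \<in> listset [sum_of h_parts, sum_of hp_parts]" "sum_list l = 0"
    from l(1) obtain p q where pq: "l = [p, q]" "p \<in> sum_of h_parts" "q \<in> sum_of hp_parts"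
      by (auto simp: set_Cons_def)
    have "p + q = 0" using l(2) pq(1) by simp
    obtain w where "q = T w" using pq(3) hp_parts_im by blast
    have "T p = 0" using pq(2) h_parts_ker by blast
    then have "T q = 0" using \<open>p + q = 0\<close> T.add[of p q] T.zero by simp
    then have "q = 0" using ker_im_T[OF fin _ \<open>q = T w\<close>] by blast
    then show "\<forall>v\<in>set l. v = 0" using \<open>p + q = 0\<close> pq(1) by simp
  qed
  then show ?thesis using sum_h_hp[OF fin] by simp
qed

lemma laurent_line_iff: "v \<in> laurent_line scale a \<longleftrightarrow> (\<exists>p. v = lscale p a)"
  unfolding laurent_line_def L.span_singleton by auto

lemma direct_h_parts: "direct_sum_of h_parts (sum_of h_parts)"
proof (rule L.direct_sum_ofI)
  show "L.subspace V" if "V \<in> set h_parts" for V using that by (rule subspace_parts(1))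
  fix l assume l: "l \<in> listset h_parts" "sum_list l = 0"
  from l(1) obtain a g c where agc: "l = [a, g, c]" "a \<in> laurent_line scale \<Lambda>"
    "g \<in> laurent_span scale g0s" "c \<in> laurent_line scale Ek"
    by (auto simp: h_parts_def set_Cons_def)
  obtain p q where pq: "a = lscale p \<Lambda>" "c = lscale q Ek" using agc by (auto simp: laurent_line_iff)
  have g: "fls_nth g n \<in> gr 0" for n
    using laurent_span_nth[OF subspace_g0s agc(3)] by (simp add: g0s_def)
  have "p $$ n = 0 \<and> g $$ n = 0 \<and> q $$ n = 0" for n
  proof -
    have "fls_nth (a + g + c) n = 0" using l(2) agc(1) by (simp add: add.assoc)
    \<comment> \<open>The factors \<open>z\<close> and \<open>z^(-1)\<close> shift the coefficients
      of \<open>s\<close> and \<open>t\<close> to \<open>n + 1\<close> and \<open>n - 1\<close>. The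
      five terms now have distinct degrees.\<close>
    then have "scale (p $$ n) f + scale (q $$ (n - 1)) t + g $$ n + scale (p $$ (n + 1)) s + scale (q $$ n) e = 0"
      unfolding pq \<Lambda>_conv Ek_conv L.scale_right_distrib fls_plus_nth lscale_monom_right_nth
      by (simp add: add_ac)
    then have "scale (p $$ n) f = 0 \<and> scale (q $$ (n - 1)) t = 0 \<and> g $$ n = 0 \<and>
        scale (p $$ (n + 1)) s = 0 \<and> scale (q $$ n) e = 0"
      by (intro gr_independent subspace_scale[OF subspace_gr] s_gr t_gr g gr_simps)
    then show ?thesis using f_nonzero e_nonzero by simp
  qed
  then have "p = 0" "g = 0" "q = 0" by (auto intro: fls_eqI)
  then show "\<forall>v\<in>set l. v = 0" by (simp add: agc(1) pq)
qed

lemma direct_hp_parts: "direct_sum_of hp_parts (sum_of hp_parts)"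
proof (rule L.direct_sum_ofI)
  show "L.subspace V" if "V \<in> set hp_parts" for V using that by (rule subspace_parts(2))
  fix l assume l: "l \<in> listset hp_parts" "sum_list l = 0"
  from l(1) obtain a b' c v1 v2 v3 where abc: "l = [a, b', c, v1, v2, v3]" "a \<in> laurent_line scale Fz"
    "b' \<in> laurent_line scale (fls_const x)" "c \<in> laurent_line scale Ez"
    "v1 \<in> laurent_span scale (br f ` U)" "v2 \<in> laurent_span scale (br s ` br f ` U)"
    "v3 \<in> laurent_span scale (br s ` br s ` br f ` U)"
    by (auto simp: hp_parts_def set_Cons_def)
  obtain p q r where pqr: "a = lscale p Fz" "b' = lscale q (fls_const x)" "c = lscale r Ez"
    using abc by (auto simp: laurent_line_iff)
  note sub = subspace_br_image[OF subspace_U, of f]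
  have v1: "v1 $$ n \<in> br f ` U" and v2: "v2 $$ n \<in> br s ` br f ` U" and v3: "v3 $$ n \<in> br s ` br s ` br f ` U" for n
    using laurent_span_nth[OF sub abc(5)] laurent_span_nth[OF subspace_br_image[OF sub] abc(6)]
      laurent_span_nth[OF subspace_br_image[OF subspace_br_image[OF sub]] abc(7)] by blast+
  have gr: "v1 $$ n \<in> gr (-1)" "v2 $$ n \<in> gr 0" "v3 $$ n \<in> gr 1" for n
    using v1[of n] v2[of n] v3[of n] f_U_gr s_f_U_gr s_s_f_U_gr by auto
  \<comment> \<open>Degrees -2 and 2 contain a single term each, so \<open>p\<close> and
    \<open>r\<close> vanish at every index, which clears \<open>t\<close> and \<open>s\<close> from
    degrees -1 and 1. Degree 0 still mixes \<open>x\<close> with \<open>v2\<close> and needs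
    \<open>x_s_f_U_independent\<close>.\<close>
  have indep: "scale (p $$ n * 2) f = 0 \<and> v1 $$ n - scale (r $$ (n - 1)) t = 0 \<and>
      scale (q $$ n) x + v2 $$ n = 0 \<and> v3 $$ n - scale (p $$ (n + 1)) s = 0 \<and> scale (r $$ n * 2) e = 0" for n
  proof (rule gr_independent)
    have "fls_nth (a + b' + c + v1 + v2 + v3) n = 0" using l(2) abc(1) by (simp add: add.assoc)
    then show "scale (p $$ n * 2) f + (v1 $$ n - scale (r $$ (n - 1)) t) + (scale (q $$ n) x + v2 $$ n) +
        (v3 $$ n - scale (p $$ (n + 1)) s) + scale (r $$ n * 2) e = 0"
      unfolding pqr Fz_conv Ez_conv L.scale_right_diff_distrib fls_plus_nth fls_minus_nth
        lscale_monom_right_nth lscale_const_nth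
      by (simp add: algebra_simps)
  qed (intro subspace_scale[OF subspace_gr] subspace_add[OF subspace_gr] subspace_diff[OF subspace_gr]
      s_gr t_gr gr gr_simps)+
  then have "p = 0" "r = 0" using f_nonzero e_nonzero by (auto intro: fls_eqI)
  moreover have "q $$ n = 0 \<and> v2 $$ n = 0" for n
  proof -
    obtain u where "u \<in> U" "v2 $$ n = br s (br f u)" using v2[of n] by auto
    then show ?thesis using x_s_f_U_independent[of u "q $$ n"] indep[of n] by auto
  qed
  then have "q = 0" "v2 = 0" by (auto intro: fls_eqI)
  moreover have "v1 = 0" "v3 = 0" using indep \<open>p = 0\<close> \<open>r = 0\<close> by (auto intro!: fls_eqI)
  ultimately show "\<forall>v\<in>set l. v = 0" by (simp add: abc(1) pqr)
qed

lemma U_conv: "centralizer_in br s (ad_eigenspace scale br x (1/2)) = U"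
  and g0s_conv: "centralizer_in br s (ad_eigenspace scale br x 0) = g0s"
  by (simp_all add: centralizer_in_def ad_eigenspace_def U_def g0s_def gr_def)

end

theorem proposition9p5:
  fixes scale :: "'k::{alg_closed_field, field_char_0} \<Rightarrow> 'g::ab_group_add \<Rightarrow> 'g"
    and br :: "'g \<Rightarrow> 'g \<Rightarrow> 'g"
    and f x e s s_star :: 'g
  assumes "simple_lie_algebra scale br"
    and "fin_dim scale"
    and "minimal_nilpotent scale br f"
    and "sl2_triple scale br f x e"
    and "s \<in> ad_eigenspace scale br x (1/2)"
    and "s_star \<in> ad_eigenspace scale br x (- (1/2))"
    and "br s s_star = scale 2 x"
  shows
    "let z = (fls_X_inv :: 'k fls);
         z_inv = (fls_X :: 'k fls);
         sc = laurent_scale scale;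
         lbr = laurent_bracket br;
         c = (fls_const :: 'g \<Rightarrow> 'g fls);
         \<Lambda> = c f + sc z (c s);
         g0s = centralizer_in br s (ad_eigenspace scale br x 0);
         ghs = centralizer_in br s (ad_eigenspace scale br x (1/2));
         F_2fs = c (scale 2 f) - sc z (c s);
         E_2es = c (scale 2 e) - sc z_inv (c s_star);
         V1 = br f ` ghs;
         V2 = br s ` V1;
         V3 = br s ` V2;
         h_parts =
           [laurent_line scale \<Lambda>,
            laurent_span scale g0s,
            laurent_line scale (c e + sc z_inv (c s_star))];
         hp_parts =
           [laurent_line scale F_2fs,
            laurent_line scale (c x),
            laurent_line scale E_2es,
            laurent_span scale V1,
            laurent_span scale V2,
            laurent_span scale V3];
         h = sum_of h_parts;
         hp = sum_of hp_parts
     in semisimple_element sc lbr \<Lambda> \<and>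
        direct_sum_of [h, hp] UNIV \<and>
        direct_sum_of h_parts h \<and> h = {a. lbr \<Lambda> a = 0} \<and>
        direct_sum_of hp_parts hp \<and> hp = range (lbr \<Lambda>) \<and>
        lbr \<Lambda> (c (scale 2 x)) = F_2fs \<and>
        lbr \<Lambda> (sc (- (1/6)) E_2es) = c x \<and>
        lbr \<Lambda> (sc z_inv (c (br s_star e))) = E_2es \<and>
        (\<forall>u\<in>ghs. lbr \<Lambda> (c u) = c (br f u) \<and> br f u \<in> V1) \<and>
        (\<forall>u\<in>ghs. lbr \<Lambda> (sc z_inv (c (br f u))) = c (br s (br f u)) \<and> br s (br f u) \<in> V2) \<and>
        (\<forall>u\<in>ghs. lbr \<Lambda> (sc z_inv (c (br s (br f u)))) = c (br s (br s (br f u)))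
                  \<and> br s (br s (br f u)) \<in> V3)"
proof -
  have lie: "lie_algebra scale br" using assms(1) by (simp add: simple_lie_algebra_def)
  interpret minimal_grading scale br f x e
    using minimal_nilpotent_extremal[OF assms(1-4)] assms(4) lie
    by (auto simp: minimal_grading_def minimal_grading_axioms_def sl2_triple_def)
  interpret embedded_minimal scale br f x e s s_star
    by unfold_locales (use assms(5-7) in \<open>simp_all add: gr_def ad_eigenspace_def\<close>)
  obtain B where fin: "finite B" "span B = UNIV" using assms(2) by (auto simp: fin_dim_def)
  note [simp del] = lscale_X
  show ?thesis
    unfolding Let_def U_conv g0s_conv \<Lambda>_def[symmetric] T_def[symmetric] Fz_def[symmetric] Ez_def[symmetric]
      Ek_def[symmetric] h_parts_def[symmetric] hp_parts_def[symmetric] semisimple_element_def s'_def[symmetric]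
    using semisimple_T[OF fin] direct_h_hp[OF fin] direct_h_parts direct_hp_parts h_hp_eq[OF fin]
      T_x T_Ez T_s' T_U
    by (intro conjI ballI imageI) assumption+
qed

end
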